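(* Let $\Omega\subset\mathbb{R}^m$ be a measurable set of finite perimeter, let $n=m-1$, and let $\Sigma(\Omega,1)$ be a minimizer of $$F_{CE}^{1}(\Sigma)=\operatorname{Per}(\Sigma)+|\Sigma\vartriangle\Omega|$$ over all measurable sets $\Sigma\subset\mathbb{R}^m$. Then $$\mathbb{F}(T_{\partial\Omega})=F_{CE}^{1}(\Sigma(\Omega,1)),$$ and $\{T_{\partial\Omega},\,S_{\Sigma(\Omega,1)\vartriangle\Omega}\}$ is the optimal decomposition required by the flat norm; that is, $S=S_{\Sigma(\Omega,1)\vartriangle\Omega}$ attains the minimum in the definition of $\mathbb{F}(T_{\partial\Omega})$: $$\mathbb{F}(T_{\partial\Omega})=\mathbf{M}\big(S_{\Sigma(\Omega,1)\vartriangle\Omega}\big)+\mathbf{M}\big(T_{\partial\Omega}-\partial S_{\Sigma(\Omega,1)\vartriangle\Omega}\big).$$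
   Context: $|\cdot|$ of a set is Lebesgue measure on $\mathbb{R}^m$, $\vartriangle$ is symmetric difference, and $\operatorname{Per}(\Sigma)\in[0,\infty]$ is the perimeter of $\Sigma$ (total variation of the distributional gradient of its characteristic function $\chi_\Sigma$). An $n$-current in $\mathbb{R}^m$ is a continuous linear functional on the space $\mathcal{D}^n$ of smooth compactly supported $n$-forms on $\mathbb{R}^m$. The boundary of a current is $\partial T(\phi)=T(d\phi)$. The mass is $\mathbf{M}(T)=\sup\{T(\phi):\phi\in\mathcal{D}^n,\ |\phi|\le 1\}\in[0,\infty]$, where $|\phi|$ is the pointwise comass norm. The flat norm of an $n$-current $T$ is $$\mathbb{F}(T)=\min_{S}\{\mathbf{M}(S)+\mathbf{M}(T-\partial S)\},$$ where $S$ ranges over all $(n+1)$-currents in $\mathbb{R}^m$. If $S$ attains this minimum, the pair $\{T,S\}$ is called an optimal decomposition for the flat norm. For a measurable set $E\subset\mathbb{R}^m$ let $[E]$ denote the $m$-current $[E](\phi)=\int_E\phi$ (standard orientation of $\mathbb{R}^m$). Then $T_{\partial\Omega}=\partial[\Omega]$ is the oriented boundary of $\Omega$ regarded as an $(m-1)$-current, and $S_{\Sigma\vartriangle\Omega}=[\Omega]-[\Sigma]=[\Omega\setminus\Sigma]-[\Sigma\setminus\Omega]$ is the $m$-current carried by $\Sigma\vartriangle\Omega$, oriented so that $T_{\partial\Omega}-\partial S_{\Sigma\vartriangle\Omega}=T_{\partial\Sigma}$. *)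

theory Defs
  imports "HOL-Analysis.Analysis"
begin

section \<open>Smooth maps\<close>

primrec iter_deriv :: "'a list \<Rightarrow> ('a::real_normed_vector \<Rightarrow> 'b::real_normed_vector) \<Rightarrow> 'a \<Rightarrow> 'b" where
  "iter_deriv [] f = f"
| "iter_deriv (u # us) f = iter_deriv us (\<lambda>x. frechet_derivative f (at x) u)"

text \<open>Every iterated directional derivative is differentiable, hence continuous, so that this is
  \<open>C\<^sup>\<infinity>\<close> on a Euclidean space.\<close>

definition smooth :: "('a::euclidean_space \<Rightarrow> 'b::real_normed_vector) \<Rightarrow> bool" where
  "smooth f \<longleftrightarrow> (\<forall>us x. iter_deriv us f differentiable (at x))"

section \<open>Perimeter\<close>

definition divergence :: "('a::euclidean_space \<Rightarrow> 'a) \<Rightarrow> 'a \<Rightarrow> real" where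
  "divergence X x = (\<Sum>b\<in>Basis. frechet_derivative X (at x) b \<bullet> b)"

definition test_fields :: "('a::euclidean_space \<Rightarrow> 'a) set" where
  "test_fields = {X. smooth X \<and> (\<exists>K. compact K \<and> (\<forall>x. x \<notin> K \<longrightarrow> X x = 0))}"

text \<open>The distributional gradient of the characteristic function of \<open>E\<close>.\<close>

definition indicator_gradient :: "'a::euclidean_space set \<Rightarrow> ('a \<Rightarrow> 'a) \<Rightarrow> real" where
  "indicator_gradient E X = - set_lebesgue_integral lebesgue E (divergence X)"

text \<open>Its total variation. As \<open>X = 0\<close> is admissible, cutting negative values off to \<open>0\<close> by
  \<open>ennreal\<close> does not affect the supremum; the same applies to \<open>mass\<close> below.\<close>

definition perimeter :: "'a::euclidean_space set \<Rightarrow> ennreal" where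
  "perimeter E = (SUP X \<in> {X \<in> test_fields. \<forall>x. norm (X x) \<le> 1}. ennreal (indicator_gradient E X))"

definition F_CE :: "'a::euclidean_space set \<Rightarrow> 'a set \<Rightarrow> ennreal" where
  "F_CE \<Omega> \<Sigma> = perimeter \<Sigma> + emeasure lebesgue (sym_diff \<Sigma> \<Omega>)"

section \<open>Differential forms\<close>

text \<open>A \<open>k\<close>-covector is an alternating \<open>k\<close>-linear function of \<open>v 0, \<dots>, v (k - 1)\<close>. The vectors
  are the first \<open>k\<close> entries of a sequence; the first clause makes the others irrelevant.\<close>

definition covector :: "nat \<Rightarrow> ((nat \<Rightarrow> 'a::real_vector) \<Rightarrow> real) \<Rightarrow> bool" where
  "covector k \<omega> \<longleftrightarrow>
     (\<forall>v w. (\<forall>i<k. v i = w i) \<longrightarrow> \<omega> v = \<omega> w) \<and>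
     (\<forall>v. \<forall>i<k. linear (\<lambda>u. \<omega> (v(i := u)))) \<and>
     (\<forall>v. \<forall>i<k. \<forall>j<k. i \<noteq> j \<and> v i = v j \<longrightarrow> \<omega> v = 0)"

text \<open>The unit simple \<open>k\<close>-vectors are the wedge products of orthonormal \<open>k\<close>-frames. The absolute
  value only matters for \<open>k = 0\<close>, where the unit simple vectors are \<open>1\<close> and \<open>-1\<close>.\<close>

definition comass :: "nat \<Rightarrow> ((nat \<Rightarrow> 'a::real_inner) \<Rightarrow> real) \<Rightarrow> ennreal" where
  "comass k \<omega> =
     (SUP v \<in> {v. \<forall>i<k. \<forall>j<k. v i \<bullet> v j = (if i = j then 1 else 0)}. ennreal \<bar>\<omega> v\<bar>)"

type_synonym 'a dform = "'a \<Rightarrow> (nat \<Rightarrow> 'a) \<Rightarrow> real"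

definition test_forms_on :: "nat \<Rightarrow> 'a set \<Rightarrow> ('a::euclidean_space) dform set" where
  "test_forms_on k K = {\<phi>. (\<forall>x. covector k (\<phi> x)) \<and> (\<forall>v. smooth (\<lambda>x. \<phi> x v)) \<and>
     (\<forall>x v. x \<notin> K \<longrightarrow> \<phi> x v = 0)}"

definition test_forms :: "nat \<Rightarrow> ('a::euclidean_space) dform set" where
  "test_forms k = (\<Union>K\<in>{K. compact K}. test_forms_on k K)"

text \<open>\<open>d\<phi>(v\<^sub>0, \<dots>, v\<^sub>k)\<close> is the alternating sum, over \<open>i\<close>, of the derivative of \<open>\<phi>\<close> in direction
  \<open>v\<^sub>i\<close>, applied to the remaining vectors (no factor \<open>1/(k+1)\<close>).\<close>

definition ext_deriv :: "nat \<Rightarrow> ('a::euclidean_space) dform \<Rightarrow> 'a dform" where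
  "ext_deriv k \<phi> = (\<lambda>x v. \<Sum>i\<le>k. (-1) ^ i *
     frechet_derivative (\<lambda>y. \<phi> y (\<lambda>j. if j < i then v j else v (Suc j))) (at x) (v i))"

section \<open>Topology on test forms\<close>

text \<open>The \<open>C\<^sup>N\<close>-ball of radius \<open>\<epsilon>\<close> about \<open>\<phi>\<close>: all partial derivatives up to order \<open>N\<close> of all
  components of \<open>\<psi> - \<phi>\<close> are less than \<open>\<epsilon>\<close>.\<close>

definition form_ball :: "nat \<Rightarrow> nat \<Rightarrow> real \<Rightarrow> ('a::euclidean_space) dform \<Rightarrow> 'a dform set" where
  "form_ball k N \<epsilon> \<phi> = {\<psi>. \<forall>us v x. set us \<subseteq> Basis \<and> length us \<le> N \<and> (\<forall>i<k. v i \<in> Basis) \<longrightarrow>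
     \<bar>iter_deriv us (\<lambda>y. \<psi> y v - \<phi> y v) x\<bar> < \<epsilon>}"

text \<open>The finest topology on the test forms for which the inclusions of all the spaces
  \<open>test_forms_on k K\<close>, \<open>K\<close> compact, with their \<open>C\<^sup>\<infinity>\<close> topology, are continuous. It has the same
  continuous linear functionals as the locally convex inductive limit topology.\<close>

definition open_test_forms :: "nat \<Rightarrow> ('a::euclidean_space) dform set \<Rightarrow> bool" where
  "open_test_forms k U \<longleftrightarrow> U \<subseteq> test_forms k \<and>
     (\<forall>K. compact K \<longrightarrow> (\<forall>\<phi>\<in>U \<inter> test_forms_on k K. \<exists>N. \<exists>\<epsilon>>0.
        test_forms_on k K \<inter> form_ball k N \<epsilon> \<phi> \<subseteq> U))"

lemma form_ball_mono:
  fixes \<phi> :: "('a::euclidean_space) dform"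
  assumes "M \<le> N" "\<delta> \<le> \<epsilon>"
  shows "form_ball k N \<delta> \<phi> \<subseteq> form_ball k M \<epsilon> \<phi>"
proof
  fix \<psi>
  assume \<psi>: "\<psi> \<in> form_ball k N \<delta> \<phi>"
  show "\<psi> \<in> form_ball k M \<epsilon> \<phi>"
    unfolding form_ball_def mem_Collect_eq
  proof (intro allI impI)
    fix us :: "'a list" and v :: "nat \<Rightarrow> 'a" and x :: 'a
    assume "set us \<subseteq> Basis \<and> length us \<le> M \<and> (\<forall>i<k. v i \<in> Basis)"
    then have "set us \<subseteq> Basis \<and> length us \<le> N \<and> (\<forall>i<k. v i \<in> Basis)"
      using assms(1) by auto
    then have "\<bar>iter_deriv us (\<lambda>y. \<psi> y v - \<phi> y v) x\<bar> < \<delta>"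
      using \<psi> unfolding form_ball_def mem_Collect_eq by blast
    then show "\<bar>iter_deriv us (\<lambda>y. \<psi> y v - \<phi> y v) x\<bar> < \<epsilon>"
      using assms(2) by linarith
  qed
qed

lemma istopology_open_test_forms: "istopology (open_test_forms k)"
  unfolding istopology_def
proof (intro conjI allI impI)
  fix S T :: "'a dform set"
  assume S: "open_test_forms k S" and T: "open_test_forms k T"
  show "open_test_forms k (S \<inter> T)"
    unfolding open_test_forms_def
  proof (intro conjI allI impI ballI)
    show "S \<inter> T \<subseteq> test_forms k" using S unfolding open_test_forms_def by blast
    fix K :: "'a set" and \<phi>
    assume K: "compact K" and \<phi>: "\<phi> \<in> S \<inter> T \<inter> test_forms_on k K"
    obtain N \<epsilon> where 1: "\<epsilon> > 0" "test_forms_on k K \<inter> form_ball k N \<epsilon> \<phi> \<subseteq> S"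
      using S K \<phi> unfolding open_test_forms_def by blast
    obtain M \<delta> where 2: "\<delta> > 0" "test_forms_on k K \<inter> form_ball k M \<delta> \<phi> \<subseteq> T"
      using T K \<phi> unfolding open_test_forms_def by blast
    have "form_ball k (max N M) (min \<epsilon> \<delta>) \<phi> \<subseteq> form_ball k N \<epsilon> \<phi>"
      "form_ball k (max N M) (min \<epsilon> \<delta>) \<phi> \<subseteq> form_ball k M \<delta> \<phi>"
      by (rule form_ball_mono; simp)+
    then have "test_forms_on k K \<inter> form_ball k (max N M) (min \<epsilon> \<delta>) \<phi> \<subseteq> S \<inter> T"
      using 1 2 by blast
    moreover have "min \<epsilon> \<delta> > 0" using 1 2 by simp
    ultimately show "\<exists>N. \<exists>\<epsilon>>0. test_forms_on k K \<inter> form_ball k N \<epsilon> \<phi> \<subseteq> S \<inter> T"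
      by blast
  qed
next
  fix \<U> :: "'a dform set set"
  assume U: "\<forall>S\<in>\<U>. open_test_forms k S"
  show "open_test_forms k (\<Union>\<U>)"
    unfolding open_test_forms_def
  proof (intro conjI allI impI ballI)
    show "\<Union>\<U> \<subseteq> test_forms k" using U unfolding open_test_forms_def by blast
    fix K :: "'a set" and \<phi>
    assume K: "compact K" and "\<phi> \<in> \<Union>\<U> \<inter> test_forms_on k K"
    then obtain S where S: "S \<in> \<U>" "\<phi> \<in> S \<inter> test_forms_on k K" by blast
    then obtain N \<epsilon> where "\<epsilon> > 0" "test_forms_on k K \<inter> form_ball k N \<epsilon> \<phi> \<subseteq> S"
      using U K unfolding open_test_forms_def by blast
    then show "\<exists>N. \<exists>\<epsilon>>0. test_forms_on k K \<inter> form_ball k N \<epsilon> \<phi> \<subseteq> \<Union>\<U>"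
      using S by blast
  qed
qed

definition test_form_topology :: "nat \<Rightarrow> ('a::euclidean_space) dform topology" where
  "test_form_topology k = topology (open_test_forms k)"

lemma openin_test_form_topology [simp]:
  "openin (test_form_topology k) = open_test_forms k"
  unfolding test_form_topology_def by (rule topology_inverse'[OF istopology_open_test_forms])

lemma topspace_test_form_topology [simp]:
  "topspace (test_form_topology k) = (test_forms k :: ('a::euclidean_space) dform set)"
proof -
  have "test_forms_on k K \<inter> form_ball k 0 1 \<phi> \<subseteq> test_forms k" if "compact K"
    for K and \<phi> :: "'a dform"
    using that unfolding test_forms_def by blast
  then have "open_test_forms k (test_forms k :: 'a dform set)"
    unfolding open_test_forms_def using zero_less_one by blast
  moreover have "U \<subseteq> test_forms k" if "open_test_forms k U" for U :: "'a dform set"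
    using that unfolding open_test_forms_def by simp
  ultimately show ?thesis
    unfolding topspace_def openin_test_form_topology by blast
qed

section \<open>Currents\<close>

type_synonym 'a functional = "'a dform \<Rightarrow> real"

text \<open>Values outside \<open>test_forms k\<close> are irrelevant: neither this predicate nor \<open>mass\<close> depends on
  them.\<close>

definition is_current :: "nat \<Rightarrow> ('a::euclidean_space) functional \<Rightarrow> bool" where
  "is_current k T \<longleftrightarrow>
     (\<forall>\<phi>\<in>test_forms k. \<forall>\<psi>\<in>test_forms k. \<forall>a b.
        T (\<lambda>x v. a * \<phi> x v + b * \<psi> x v) = a * T \<phi> + b * T \<psi>) \<and>
     continuous_map (test_form_topology k) euclideanreal T"

text \<open>\<open>boundary k T\<close> is the \<open>k\<close>-current that is the boundary of the \<open>(k+1)\<close>-current \<open>T\<close>.\<close>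

definition boundary :: "nat \<Rightarrow> ('a::euclidean_space) functional \<Rightarrow> 'a functional" where
  "boundary k T = (\<lambda>\<phi>. T (ext_deriv k \<phi>))"

definition mass :: "nat \<Rightarrow> ('a::euclidean_space) functional \<Rightarrow> ennreal" where
  "mass k T = (SUP \<phi> \<in> {\<phi> \<in> test_forms k. \<forall>x. comass k (\<phi> x) \<le> 1}. ennreal (T \<phi>))"

definition flat_norm :: "nat \<Rightarrow> ('a::euclidean_space) functional \<Rightarrow> ennreal" where
  "flat_norm n T =
     (INF S \<in> {S. is_current (Suc n) S}. mass (Suc n) S + mass n (T - boundary n S))"

definition optimal_decomposition ::
    "nat \<Rightarrow> ('a::euclidean_space) functional \<Rightarrow> 'a functional \<Rightarrow> bool" where
  "optimal_decomposition n T S \<longleftrightarrow> is_current (Suc n) S \<and>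
     flat_norm n T = mass (Suc n) S + mass n (T - boundary n S)"

text \<open>The coordinate directions of \<open>\<real>\<^sup>m\<close> in increasing order of their indices, which fixes the
  standard orientation. Only the entries below \<open>m\<close> are meaningful.\<close>

definition std_frame :: "nat \<Rightarrow> real ^ 'm::{finite, linorder}" where
  "std_frame i = axis (sorted_list_of_set UNIV ! i) 1"

definition set_current :: "(real ^ 'm::{finite, linorder}) set \<Rightarrow> (real ^ 'm::{finite, linorder}) functional" where
  "set_current E = (\<lambda>\<phi>. set_lebesgue_integral lebesgue E (\<lambda>x. \<phi> x std_frame))"

definition boundary_current :: "(real ^ 'm::{finite, linorder}) set \<Rightarrow> (real ^ 'm::{finite, linorder}) functional" where
  "boundary_current \<Omega> = boundary (CARD('m) - 1) (set_current \<Omega>)"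

text \<open>The current carried by the symmetric difference, oriented such that subtracting its boundary
  from that of \<open>\<Omega>\<close> leaves that of \<open>\<Sigma>\<close>.\<close>

definition sym_diff_current ::
    "(real ^ 'm::{finite, linorder}) set \<Rightarrow> (real ^ 'm::{finite, linorder}) set \<Rightarrow> (real ^ 'm::{finite, linorder}) functional" where
  "sym_diff_current \<Sigma> \<Omega> = set_current \<Omega> - set_current \<Sigma>"

end

theory Submission
  imports Defs
begin

text \<open>Write \<open>M\<close> for the mass, \<open>T\<close> for the boundary of \<open>\<Omega>\<close> and \<open>m\<close> for the dimension.

  The current \<open>[\<Omega>] - [\<Sigma>]\<close> is admissible in the flat norm and costs at most \<open>F_CE \<Omega> \<Sigma>\<close>. Its mass is
  at most the measure of the symmetric difference, because a form of comass at most one has a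
  coefficient of absolute value at most one (\<open>mass_sym_diff_current_le\<close>). The rest is \<open>\<partial>[\<Sigma>]\<close>, whose
  mass is at most the perimeter, because an \<open>(m - 1)\<close>-form is the contraction of the volume form with a
  vector field whose norm is bounded by the comass of the form and whose divergence is the exterior
  derivative (\<open>mass_boundary_set_current_le\<close>).

  Conversely, \<open>F_CE \<Omega> \<Sigma>\<close> is at most \<open>M(S) + M(T - \<partial>S)\<close> for every \<open>m\<close>-current \<open>S\<close>; this is the main
  point, since \<open>S\<close> need not come from a set. If the masses are finite, \<open>S\<close> is a functional \<open>\<Lambda>\<close> on
  functions that is bounded by \<open>M(S)\<close> in the supremum norm, and \<open>A = \<chi>\<^sub>\<Omega> - \<Lambda>\<close> has a distributional gradient
  of total variation at most \<open>M(T - \<partial>S)\<close>. If \<open>A\<close> is a smooth function \<open>u\<close>, the coarea formula and the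
  layer cake formula give
    \<open>\<integral>\<^sub>0\<^sup>1 F_CE \<Omega> {u > s} ds \<le> \<integral> |\<nabla>u| + \<integral> |u - \<chi>\<^sub>\<Omega>|\<close>,
  and the left-hand side is at least \<open>F_CE \<Omega> \<Sigma>\<close> because \<open>\<Sigma>\<close> minimises
  (\<open>F_CE_lower_bound_of_smooth_function\<close>). In general \<open>A\<close> is mollified at scale \<open>\<epsilon>\<close>. Mollification does
  not increase the total variation of the gradient, and it takes \<open>A - \<chi>\<^sub>\<Omega>\<close> to a function of norm at
  most \<open>M(S)\<close> in \<open>L\<^sup>1\<close>. The indicator function of \<open>\<Omega>\<close> itself moves by at most \<open>\<epsilon> Per \<Omega>\<close> in \<open>L\<^sup>1\<close>, so
  that the error vanishes as \<open>\<epsilon>\<close> tends to \<open>0\<close> (\<open>F_CE_lower_bound_of_functional\<close>). The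
  \<open>L\<^sup>1\<close> bounds follow from those on \<open>A\<close> and \<open>\<Lambda>\<close> by moving the mollification to the test map
  (\<open>radon_integral_swap\<close>) and by duality (\<open>nn_integral_norm_le_of_pairing\<close>).\<close>

section \<open>Smooth maps\<close>

abbreviation DF :: "('a::real_normed_vector \<Rightarrow> 'b::real_normed_vector) \<Rightarrow> 'a \<Rightarrow> 'a \<Rightarrow> 'b" where
  "DF f x \<equiv> frechet_derivative f (at x)"

text \<open>Smoothness is a greatest fixed point: a class of differentiable maps that is closed under
  directional derivatives consists of smooth maps. The closure properties below rest on this.\<close>

lemma smooth_coinduct:
  assumes "f \<in> P" and "\<And>g x. g \<in> P \<Longrightarrow> g differentiable (at x)"
    and "\<And>g u. g \<in> P \<Longrightarrow> (\<lambda>x. DF g x u) \<in> P"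
  shows "smooth f"
proof -
  have "\<forall>x. iter_deriv us f differentiable (at x)" for us
    using assms(1) by (induction us arbitrary: f) (auto simp: assms(2,3))
  then show ?thesis by (simp add: smooth_def)
qed

lemma smooth_differentiable: "smooth f \<Longrightarrow> f differentiable (at x)"
  unfolding smooth_def by (drule spec[of _ "[]"]) simp

lemma smooth_has_derivative: "smooth f \<Longrightarrow> (f has_derivative DF f x) (at x)"
  using smooth_differentiable frechet_derivative_works by blast

lemma smooth_directional_derivative:
  "smooth f \<Longrightarrow> smooth (\<lambda>x. DF f x u)"
  unfolding smooth_def
proof (intro allI)
  fix us x
  assume "\<forall>us x. iter_deriv us f differentiable (at x)"
  then have "iter_deriv (u # us) f differentiable (at x)" by blast
  then show "iter_deriv us (\<lambda>x. DF f x u) differentiable (at x)" by simp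
qed

lemma smooth_continuous_on: "smooth f \<Longrightarrow> continuous_on A f"
  by (meson continuous_at_imp_continuous_on differentiable_imp_continuous_within smooth_differentiable)

lemma frechet_derivative_eqI:
  "(f has_derivative f') (at x) \<Longrightarrow> DF f x = f'"
  by (rule frechet_derivative_at[symmetric])

lemma smooth_borel_measurable_lebesgue:
  fixes u :: "'a::euclidean_space \<Rightarrow> 'b::euclidean_space"
  assumes "smooth u" shows "u \<in> borel_measurable lebesgue"
proof -
  have "u \<in> borel_measurable lborel"
    using borel_measurable_continuous_onI[OF smooth_continuous_on[OF assms]] by simp
  then show ?thesis by (rule measurable_completion)
qed

lemma smooth_bounded_on_balls:
  fixes u :: "'a::euclidean_space \<Rightarrow> 'b::real_normed_vector"
  assumes "smooth u" obtains B where "\<And>x. norm x \<le> R \<Longrightarrow> norm (u x) \<le> B"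
proof -
  have "bounded (u ` cball 0 R)"
    by (intro compact_imp_bounded compact_continuous_image smooth_continuous_on[OF assms] compact_cball)
  then obtain B where "\<forall>z\<in>u ` cball 0 R. norm z \<le> B" unfolding bounded_iff by blast
  then show ?thesis by (intro that[of B]) simp
qed

lemma smooth_const: "smooth (\<lambda>x. c)"
proof (rule smooth_coinduct[where P = "{g. \<exists>c. g = (\<lambda>x. c)}"])
  fix g :: "'a \<Rightarrow> 'b" and u assume "g \<in> {g. \<exists>c. g = (\<lambda>x. c)}"
  then obtain c where g: "g = (\<lambda>x. c)" by blast
  have "DF g x = (\<lambda>h. 0)" for x
    unfolding g by (rule frechet_derivative_eqI) simp
  then show "(\<lambda>x. DF g x u) \<in> {g. \<exists>c. g = (\<lambda>x. c)}" by auto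
qed auto

lemma smooth_bounded_linear:
  fixes f :: "'a::euclidean_space \<Rightarrow> 'b::real_normed_vector"
  assumes "bounded_linear F" "smooth f" shows "smooth (\<lambda>x. F (f x))"
proof (rule smooth_coinduct[where P = "{g. \<exists>f. g = (\<lambda>x. F (f x)) \<and> smooth f}"])
  fix g :: "'a \<Rightarrow> 'c" and u x assume "g \<in> {g. \<exists>f. g = (\<lambda>x. F (f x)) \<and> smooth f}"
  then obtain f where g: "g = (\<lambda>x. F (f x))" and f: "smooth f" by blast
  have D: "(g has_derivative (\<lambda>h. F (DF f x h))) (at x)" for x
    unfolding g by (rule bounded_linear.has_derivative[OF assms(1) smooth_has_derivative[OF f]])
  then show "g differentiable (at x)" by (auto simp: differentiable_def)
  have "(\<lambda>x. DF g x u) = (\<lambda>x. F (DF f x u))"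
    using frechet_derivative_eqI[OF D] by simp
  then show "(\<lambda>x. DF g x u) \<in> {g. \<exists>f. g = (\<lambda>x. F (f x)) \<and> smooth f}"
    using smooth_directional_derivative[OF f, of u] by auto
qed (use assms(2) in blast)

lemma smooth_linear:
  fixes F :: "'a::euclidean_space \<Rightarrow> 'b::real_normed_vector"
  assumes "bounded_linear F" shows "smooth F"
proof (rule smooth_coinduct[where P = "{F. bounded_linear F \<or> smooth F}"])
  fix g :: "'a \<Rightarrow> 'b" and u x assume g: "g \<in> {F. bounded_linear F \<or> smooth F}"
  then show "g differentiable (at x)"
    by (auto simp: bounded_linear_imp_differentiable smooth_differentiable)
  show "(\<lambda>x. DF g x u) \<in> {F. bounded_linear F \<or> smooth F}"
  proof (cases "smooth g")
    case False
    then have "bounded_linear g" using g by blast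
    then have "DF g x = g" for x
      by (intro frechet_derivative_eqI bounded_linear_imp_has_derivative)
    then show ?thesis by (simp add: smooth_const)
  qed (simp add: smooth_directional_derivative)
qed (use assms in blast)

text \<open>Reduces vector-valued maps to real-valued ones, for which products make sense.\<close>

lemma smooth_componentwise:
  fixes X :: "'a::euclidean_space \<Rightarrow> 'b::euclidean_space"
  shows "smooth X \<longleftrightarrow> (\<forall>b\<in>Basis. smooth (\<lambda>x. X x \<bullet> b))"
proof
  assume "smooth X" then show "\<forall>b\<in>Basis. smooth (\<lambda>x. X x \<bullet> b)"
    using smooth_bounded_linear[OF bounded_linear_inner_left] by blast
next
  let ?P = "{X::'a \<Rightarrow> 'b. \<forall>b\<in>Basis. smooth (\<lambda>x. X x \<bullet> b)}"
  assume "\<forall>b\<in>Basis. smooth (\<lambda>x. X x \<bullet> b)"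
  then have "X \<in> ?P" by blast
  then show "smooth X"
  proof (rule smooth_coinduct)
    fix g :: "'a \<Rightarrow> 'b" and u x assume g: "g \<in> ?P"
    then show d: "g differentiable (at x)" for x
      using differentiable_componentwise_within[of g x UNIV] smooth_differentiable by auto
    have "(\<lambda>x. DF g x u \<bullet> b) = (\<lambda>x. DF (\<lambda>x. g x \<bullet> b) x u)"
      for b
    proof
      fix x
      have "((\<lambda>x. g x \<bullet> b) has_derivative (\<lambda>h. DF g x h \<bullet> b)) (at x)"
        using has_derivative_inner_left d frechet_derivative_works by blast
      then show "DF g x u \<bullet> b = DF (\<lambda>x. g x \<bullet> b) x u"
        using frechet_derivative_eqI by fastforce
    qed
    then show "(\<lambda>x. DF g x u) \<in> ?P"
      using g smooth_directional_derivative by auto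
  qed
qed

text \<open>The algebra of functions generated by the smooth functions and \<open>G\<close>. It is the invariant class
  for the coinduction when the derivatives of a family \<open>G\<close> (such as all powers of one function) are
  combinations of members of \<open>G\<close> with smooth coefficients.\<close>

inductive_set smooth_hull :: "('a::euclidean_space \<Rightarrow> real) set \<Rightarrow> ('a \<Rightarrow> real) set"
  for G where
  smooth: "smooth f \<Longrightarrow> f \<in> smooth_hull G"
| gen: "g \<in> G \<Longrightarrow> g \<in> smooth_hull G"
| add: "f \<in> smooth_hull G \<Longrightarrow> g \<in> smooth_hull G \<Longrightarrow> (\<lambda>x. f x + g x) \<in> smooth_hull G"
| mult: "f \<in> smooth_hull G \<Longrightarrow> g \<in> smooth_hull G \<Longrightarrow> (\<lambda>x. f x * g x) \<in> smooth_hull G"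

lemma smooth_hull_smooth:
  assumes "\<And>g x. g \<in> G \<Longrightarrow> g differentiable (at x)"
    and "\<And>g u. g \<in> G \<Longrightarrow> (\<lambda>x. DF g x u) \<in> smooth_hull G"
    and "f \<in> smooth_hull G"
  shows "smooth f"
proof -
  have *: "(\<forall>x. f differentiable (at x)) \<and> (\<forall>u. (\<lambda>x. DF f x u) \<in> smooth_hull G)"
    if "f \<in> smooth_hull G" for f
    using that
  proof induction
    case (smooth f)
    then show ?case
      using smooth_differentiable smooth_directional_derivative smooth_hull.smooth by blast
  next
    case (gen g) then show ?case using assms by blast
  next
    case (add f g)
    then have "DF (\<lambda>x. f x + g x) x =
        (\<lambda>u. DF f x u + DF g x u)" for x
      by (intro frechet_derivative_eqI has_derivative_add) (auto simp: frechet_derivative_works)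
    then show ?case using add by (auto intro: smooth_hull.add)
  next
    case (mult f g)
    then have "DF (\<lambda>x. f x * g x) x =
        (\<lambda>u. f x * DF g x u + DF f x u * g x)" for x
      by (intro frechet_derivative_eqI has_derivative_mult) (auto simp: frechet_derivative_works)
    then show ?case using mult by (auto intro!: smooth_hull.add smooth_hull.mult)
  qed
  show ?thesis
    by (rule smooth_coinduct[where P = "smooth_hull G"]) (use assms(3) * in auto)
qed

lemma smooth_add_real:
  fixes f g :: "'a::euclidean_space \<Rightarrow> real"
  assumes "smooth f" "smooth g" shows "smooth (\<lambda>x. f x + g x)"
proof (rule smooth_hull_smooth[where G = "{}"])
  show "(\<lambda>x. f x + g x) \<in> smooth_hull {}"
    by (intro smooth_hull.add smooth_hull.smooth assms)
qed auto

lemma smooth_mult: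
  fixes f g :: "'a::euclidean_space \<Rightarrow> real"
  assumes "smooth f" "smooth g" shows "smooth (\<lambda>x. f x * g x)"
proof (rule smooth_hull_smooth[where G = "{}"])
  show "(\<lambda>x. f x * g x) \<in> smooth_hull {}"
    by (intro smooth_hull.mult smooth_hull.smooth assms)
qed auto

lemma smooth_sum_real: "(\<And>i. i \<in> I \<Longrightarrow> smooth (f i)) \<Longrightarrow> smooth (\<lambda>x. \<Sum>i\<in>I. f i x :: real)"
  by (induction I rule: infinite_finite_induct) (auto intro: smooth_add_real smooth_const)

lemma smooth_scaleR:
  fixes X :: "'a::euclidean_space \<Rightarrow> 'b::euclidean_space"
  assumes "smooth f" "smooth X" shows "smooth (\<lambda>x. f x *\<^sub>R X x)"
  unfolding smooth_componentwise[of "\<lambda>x. f x *\<^sub>R X x"]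
  using assms(1) assms(2)[unfolded smooth_componentwise[of X]] by (auto intro: smooth_mult)

lemma smooth_sum:
  fixes X :: "'i \<Rightarrow> 'a::euclidean_space \<Rightarrow> 'b::euclidean_space"
  assumes "\<And>i. i \<in> I \<Longrightarrow> smooth (X i)" shows "smooth (\<lambda>x. \<Sum>i\<in>I. X i x)"
  unfolding smooth_componentwise[of "\<lambda>x. \<Sum>i\<in>I. X i x"] inner_sum_left
  by (intro ballI smooth_sum_real smooth_bounded_linear[OF bounded_linear_inner_left] assms)

lemma smooth_diff:
  fixes f g :: "'a::euclidean_space \<Rightarrow> 'b::euclidean_space"
  assumes "smooth f" "smooth g" shows "smooth (\<lambda>x. f x - g x)"
  unfolding smooth_componentwise[of "\<lambda>x. f x - g x"] inner_diff_left
proof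
  fix b
  have "smooth (\<lambda>x. f x \<bullet> b + (-1) * (g x \<bullet> b))"
    by (intro smooth_add_real smooth_mult smooth_const smooth_bounded_linear[OF bounded_linear_inner_left] assms)
  then show "smooth (\<lambda>x. f x \<bullet> b - g x \<bullet> b)" by simp
qed

lemma smooth_inner:
  fixes X Y :: "'a::euclidean_space \<Rightarrow> 'b::euclidean_space"
  assumes "smooth X" "smooth Y" shows "smooth (\<lambda>x. X x \<bullet> Y x)"
proof -
  have "(\<lambda>x. X x \<bullet> Y x) = (\<lambda>x. \<Sum>b\<in>Basis. (X x \<bullet> b) * (Y x \<bullet> b))"
    by (rule ext, rule euclidean_inner)
  then show ?thesis
    by (simp only:) (intro smooth_sum_real smooth_mult smooth_bounded_linear[OF bounded_linear_inner_left] assms)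
qed

lemma smooth_powr:
  fixes f :: "'a::euclidean_space \<Rightarrow> real"
  assumes "smooth f" "\<And>x. f x > 0" shows "smooth (\<lambda>x. f x powr a)"
proof (rule smooth_hull_smooth[where G = "{g. \<exists>f a. g = (\<lambda>x. f x powr a) \<and> smooth f \<and> (\<forall>x. f x > 0)}"])
  let ?G = "{g. \<exists>f a. g = (\<lambda>x::'a. (f x :: real) powr a) \<and> smooth f \<and> (\<forall>x. f x > 0)}"
  fix g u x assume "g \<in> ?G"
  then obtain f a where g: "g = (\<lambda>x. f x powr a)" and f: "smooth f" "\<And>x. f x > 0" by blast
  have D: "(g has_derivative (\<lambda>h. a * f x powr (a - 1) * DF f x h)) (at x)" for x
  proof -
    have "((\<lambda>t. t powr a) has_derivative (\<lambda>h. a * f x powr (a - 1) * h)) (at (f x))"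
      using has_real_derivative_powr[OF f(2)[of x], of a] by (simp add: has_field_derivative_def)
    from diff_chain_at[OF smooth_has_derivative[OF f(1)] this] show ?thesis
      by (simp add: g o_def)
  qed
  then show "g differentiable (at x)" by (auto simp: differentiable_def)
  have "(\<lambda>x. DF g x u) =
      (\<lambda>x. (\<lambda>x. a) x * (\<lambda>x. f x powr (a - 1)) x * DF f x u)"
    using frechet_derivative_eqI[OF D] by simp
  moreover have "(\<lambda>x. f x powr (a - 1)) \<in> ?G" using f by blast
  ultimately show "(\<lambda>x. DF g x u) \<in> smooth_hull ?G"
    by (simp only:) (intro smooth_hull.mult smooth_hull.smooth[OF smooth_const] smooth_hull.gen
        smooth_hull.smooth[OF smooth_directional_derivative[OF f(1)]])
qed (use assms in \<open>blast intro: smooth_hull.gen\<close>)+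

lemma smooth_polynomial_function:
  fixes p :: "'a::euclidean_space \<Rightarrow> 'b::euclidean_space"
  assumes "polynomial_function p" shows "smooth p"
proof -
  have "smooth q" if "real_polynomial_function q" for q :: "'a \<Rightarrow> real"
    using that by induction (auto intro: smooth_linear smooth_const smooth_add_real smooth_mult)
  then show ?thesis
    unfolding smooth_componentwise[of p] using assms polynomial_function_iff_Basis_inner by blast
qed

text \<open>The functions \<open>exp (-1/t) / t\<^sup>k\<close>, extended by zero. Differentiation maps this family into its
  linear span, so that its members are smooth at the origin, too.\<close>

definition flat_exp :: "nat \<Rightarrow> real \<Rightarrow> real" where
  "flat_exp k t = (if t > 0 then exp (- inverse t) * inverse t ^ k else 0)"

lemma flat_exp_has_derivative:
  "(flat_exp k has_real_derivative flat_exp (k + 2) t - real k * flat_exp (k + 1) t) (at t)"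
proof -
  consider "t > 0" | "t < 0" | "t = 0" by linarith
  then show ?thesis
  proof cases
    case 1
    have a: "((\<lambda>t. exp (- inverse t)) has_real_derivative exp (- inverse t) * (inverse t * inverse t)) (at t)"
      using 1 by (auto intro!: derivative_eq_intros)
    have b: "((\<lambda>t. inverse t ^ k) has_real_derivative real k * (- (inverse t ^ Suc (Suc 0)) * inverse t ^ (k - Suc 0))) (at t)"
      using 1 by (intro DERIV_power DERIV_inverse) auto
    have c: "exp (- r) * (r * r) * r ^ k + real k * (- (r ^ Suc (Suc 0)) * r ^ (k - Suc 0)) * exp (- r)
        = exp (- r) * r ^ (k + 2) - real k * (exp (- r) * r ^ (k + 1))" for r
      by (cases k) simp_all
    have d: "flat_exp j t = exp (- inverse t) * inverse t ^ j" for j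
      using 1 by (simp add: flat_exp_def)
    have "((\<lambda>t. exp (- inverse t) * inverse t ^ k) has_real_derivative
        flat_exp (k + 2) t - real k * flat_exp (k + 1) t) (at t)"
      unfolding d by (rule DERIV_cong[OF DERIV_mult[OF a b] c])
    then show ?thesis
      by (rule has_field_derivative_transform_within_open[where S = "{0<..}"])
        (use 1 in \<open>auto simp: flat_exp_def\<close>)
  next
    case 2
    have "((\<lambda>t. 0) has_real_derivative flat_exp (k + 2) t - real k * flat_exp (k + 1) t) (at t)"
      using 2 by (simp add: flat_exp_def)
    then show ?thesis
      by (rule has_field_derivative_transform_within_open[where S = "{..<0}"])
        (use 2 in \<open>auto simp: flat_exp_def\<close>)
  next
    case 3
    have "((\<lambda>h. flat_exp k h / h) \<longlongrightarrow> 0) (at 0)"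
    proof (rule filterlim_split_at)
      have "((\<lambda>t::real. t ^ Suc k / exp t) \<longlongrightarrow> 0) at_top" by (rule tendsto_power_div_exp_0)
      then have "((\<lambda>h::real. (inverse h) ^ Suc k / exp (inverse h)) \<longlongrightarrow> 0) (at_right 0)"
        using filterlim_compose[OF _ filterlim_inverse_at_top_right] by fast
      then show "((\<lambda>h. flat_exp k h / h) \<longlongrightarrow> 0) (at_right 0)"
        by (rule Lim_transform_eventually)
          (auto simp: flat_exp_def eventually_at_filter exp_minus divide_inverse mult_ac)
      show "((\<lambda>h. flat_exp k h / h) \<longlongrightarrow> 0) (at_left 0)"
        by (rule Lim_transform_eventually[OF tendsto_const])
          (auto simp: flat_exp_def eventually_at_filter)
    qed
    then show ?thesis using 3 by (simp add: has_field_derivative_iff flat_exp_def)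
  qed
qed

lemma smooth_flat_exp:
  fixes f :: "'a::euclidean_space \<Rightarrow> real"
  assumes "smooth f" shows "smooth (\<lambda>x. flat_exp k (f x))"
proof (rule smooth_hull_smooth[where G = "{g. \<exists>f k. g = (\<lambda>x. flat_exp k (f x)) \<and> smooth f}"])
  let ?G = "{g. \<exists>f k. g = (\<lambda>x::'a. flat_exp k (f x)) \<and> smooth f}"
  fix g u x assume "g \<in> ?G"
  then obtain f k where g: "g = (\<lambda>x. flat_exp k (f x))" and f: "smooth f" by blast
  have D: "(g has_derivative (\<lambda>h. (flat_exp (k + 2) (f x) - real k * flat_exp (k + 1) (f x)) * DF f x h)) (at x)" for x
  proof -
    have "(flat_exp k has_derivative (\<lambda>h. (flat_exp (k + 2) (f x) - real k * flat_exp (k + 1) (f x)) * h)) (at (f x))"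
      using flat_exp_has_derivative[of k "f x"] by (simp add: has_field_derivative_def)
    from diff_chain_at[OF smooth_has_derivative[OF f(1)] this] show ?thesis
      by (simp add: g o_def)
  qed
  then show "g differentiable (at x)" by (auto simp: differentiable_def)
  have "(\<lambda>x. DF g x u) =
      (\<lambda>x. ((\<lambda>x. flat_exp (k + 2) (f x)) x + (\<lambda>x. - real k) x * (\<lambda>x. flat_exp (k + 1) (f x)) x)
        * DF f x u)"
    using frechet_derivative_eqI[OF D] by simp
  moreover have "(\<lambda>x. flat_exp (k + 2) (f x)) \<in> ?G" "(\<lambda>x. flat_exp (k + 1) (f x)) \<in> ?G" using f by blast+
  ultimately show "(\<lambda>x. DF g x u) \<in> smooth_hull ?G"
    by (simp only:) (intro smooth_hull.mult smooth_hull.add smooth_hull.smooth[OF smooth_const]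
        smooth_hull.gen smooth_hull.smooth[OF smooth_directional_derivative[OF f]])
qed (use assms in \<open>blast intro: smooth_hull.gen\<close>)+

lemma smooth_affine:
  fixes f :: "'a::euclidean_space \<Rightarrow> 'b::real_normed_vector"
  assumes "smooth f" shows "smooth (\<lambda>y. f (c *\<^sub>R y + a))"
proof (rule smooth_coinduct[where P = "{g. \<exists>f. g = (\<lambda>y. f (c *\<^sub>R y + a)) \<and> smooth f}"])
  fix g :: "'a \<Rightarrow> 'b" and u x assume "g \<in> {g. \<exists>f. g = (\<lambda>y. f (c *\<^sub>R y + a)) \<and> smooth f}"
  then obtain f where g: "g = (\<lambda>y. f (c *\<^sub>R y + a))" and f: "smooth f" by blast
  have D: "(g has_derivative (\<lambda>h. DF f (c *\<^sub>R x + a) (c *\<^sub>R h))) (at x)" for x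
  proof -
    have "((\<lambda>y. c *\<^sub>R y + a) has_derivative (\<lambda>h. c *\<^sub>R h)) (at x)"
      by (auto intro!: derivative_eq_intros)
    from diff_chain_at[OF this smooth_has_derivative[OF f]] show ?thesis by (simp add: g o_def)
  qed
  then show "g differentiable (at x)" by (auto simp: differentiable_def)
  have "(\<lambda>x. DF g x u) =
      (\<lambda>y. (\<lambda>z. DF f z (c *\<^sub>R u)) (c *\<^sub>R y + a))"
    using frechet_derivative_eqI[OF D] by simp
  then show "(\<lambda>x. DF g x u) \<in> {g. \<exists>f. g = (\<lambda>y. f (c *\<^sub>R y + a)) \<and> smooth f}"
    using smooth_directional_derivative[OF f, of "c *\<^sub>R u"] by (intro CollectI exI conjI)
qed (use assms in blast)

section \<open>Test maps\<close>

text \<open>Test maps with values in any Euclidean space. A bound on the norm is easier to compute with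
  than a compact support.\<close>

definition test_maps :: "('a::euclidean_space \<Rightarrow> 'b::euclidean_space) set" where
  "test_maps = {X. smooth X \<and> (\<exists>R. \<forall>x. norm x \<ge> R \<longrightarrow> X x = 0)}"

lemma test_fields_eq_test_maps: "test_fields = test_maps"
proof -
  have "(\<exists>K. compact K \<and> (\<forall>x. x \<notin> K \<longrightarrow> X x = 0)) \<longleftrightarrow> (\<exists>R. \<forall>x. norm x \<ge> R \<longrightarrow> X x = 0)"
    for X :: "'a \<Rightarrow> 'a"
  proof
    assume "\<exists>K. compact K \<and> (\<forall>x. x \<notin> K \<longrightarrow> X x = 0)"
    then obtain K where K: "compact K" "\<And>x. x \<notin> K \<Longrightarrow> X x = 0" by blast
    then obtain R where "\<forall>x\<in>K. norm x < R"
      using bounded_normE_less[of K] compact_imp_bounded by metis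
    then show "\<exists>R. \<forall>x. norm x \<ge> R \<longrightarrow> X x = 0" using K(2) by (meson linorder_not_le)
  next
    assume "\<exists>R. \<forall>x. norm x \<ge> R \<longrightarrow> X x = 0"
    then obtain R where "\<forall>x. norm x \<ge> R \<longrightarrow> X x = 0" by blast
    then show "\<exists>K. compact K \<and> (\<forall>x. x \<notin> K \<longrightarrow> X x = 0)"
      by (intro exI[of _ "cball 0 R"]) (auto simp: not_le less_imp_le)
  qed
  then show ?thesis unfolding test_fields_def test_maps_def by presburger
qed

lemma test_mapsE:
  assumes "X \<in> test_maps"
  obtains R where "R > 0" "\<And>x. norm x \<ge> R \<Longrightarrow> X x = 0" "smooth X"
proof -
  obtain R where R: "\<forall>x. norm x \<ge> R \<longrightarrow> X x = 0" "smooth X"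
    using assms unfolding test_maps_def by blast
  then show ?thesis by (intro that[of "max R 1"]) auto
qed

lemma test_mapsI: "smooth X \<Longrightarrow> (\<And>x. norm x \<ge> R \<Longrightarrow> X x = 0) \<Longrightarrow> X \<in> test_maps"
  unfolding test_maps_def by blast

lemma test_maps_smooth: "X \<in> test_maps \<Longrightarrow> smooth X"
  unfolding test_maps_def by blast

lemma test_maps_continuous_on: "X \<in> test_maps \<Longrightarrow> continuous_on A X"
  by (simp add: smooth_continuous_on test_maps_smooth)

lemma zero_test_map: "(\<lambda>x. 0) \<in> test_maps"
  by (simp add: test_maps_def smooth_const)

lemma test_maps_inner:
  assumes "X \<in> test_maps" shows "(\<lambda>x. X x \<bullet> b) \<in> test_maps"
proof -
  obtain R where "\<And>x. norm x \<ge> R \<Longrightarrow> X x = 0" "smooth X" using test_mapsE[OF assms] by blast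
  then show ?thesis
    by (intro test_mapsI[of _ R] smooth_bounded_linear[OF bounded_linear_inner_left]) auto
qed

lemma test_maps_mult_smooth:
  fixes f :: "'a::euclidean_space \<Rightarrow> real" and X :: "'a \<Rightarrow> 'b::euclidean_space"
  assumes "f \<in> test_maps" "smooth X" shows "(\<lambda>x. f x *\<^sub>R X x) \<in> test_maps"
proof -
  obtain R where "\<And>x. norm x \<ge> R \<Longrightarrow> f x = 0" "smooth f" using test_mapsE[OF assms(1)] by blast
  then show ?thesis using assms(2) by (intro test_mapsI[of _ R] smooth_scaleR) auto
qed

lemma test_maps_smooth_mult:
  fixes f :: "'a::euclidean_space \<Rightarrow> real" and X :: "'a \<Rightarrow> 'b::euclidean_space"
  assumes "smooth f" "X \<in> test_maps" shows "(\<lambda>x. f x *\<^sub>R X x) \<in> test_maps"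
proof -
  obtain R where "\<And>x. norm x \<ge> R \<Longrightarrow> X x = 0" "smooth X" using test_mapsE[OF assms(2)] by blast
  then show ?thesis using assms(1) by (intro test_mapsI[of _ R] smooth_scaleR) auto
qed

lemma test_maps_sum:
  fixes X :: "'i \<Rightarrow> 'a::euclidean_space \<Rightarrow> 'b::euclidean_space"
  assumes "\<And>i. i \<in> I \<Longrightarrow> X i \<in> test_maps" shows "(\<lambda>x. \<Sum>i\<in>I. X i x) \<in> test_maps"
proof (cases "finite I")
  case True
  have "\<forall>i\<in>I. \<exists>R. \<forall>x. norm x \<ge> R \<longrightarrow> X i x = 0" using assms unfolding test_maps_def by blast
  then obtain R where R: "\<And>i x. i \<in> I \<Longrightarrow> norm x \<ge> R i \<Longrightarrow> X i x = 0" by metis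
  have "norm x \<ge> R i" if "norm x \<ge> Max (insert 0 (R ` I))" "i \<in> I" for x i
    using that True Max_ge[of "insert 0 (R ` I)" "R i"] by fastforce
  then show ?thesis
    using R
    by (intro test_mapsI[of _ "Max (insert 0 (R ` I))"] smooth_sum test_maps_smooth[OF assms])
      (auto intro!: sum.neutral)
qed (simp add: test_maps_def smooth_const)

lemma test_maps_scaleR: "X \<in> test_maps \<Longrightarrow> (\<lambda>x. c *\<^sub>R X x) \<in> test_maps"
  using test_maps_smooth_mult[OF smooth_const[of c]] .

lemma test_maps_mult: "f \<in> test_maps \<Longrightarrow> (\<lambda>x. c * f x :: real) \<in> test_maps"
  using test_maps_scaleR[of f c] by simp

lemma test_maps_add:
  assumes "X \<in> test_maps" "Y \<in> test_maps" shows "(\<lambda>x. X x + Y x) \<in> test_maps"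
  using test_maps_sum[of "UNIV :: bool set" "\<lambda>b. if b then X else Y"] assms
  by (simp add: UNIV_bool add.commute)

lemma test_maps_diff:
  assumes "X \<in> test_maps" "Y \<in> test_maps" shows "(\<lambda>x. X x - Y x) \<in> test_maps"
  using test_maps_add[OF assms(1) test_maps_scaleR[OF assms(2), of "-1"]] by simp

lemma frechet_derivative_outside_support:
  fixes X :: "'a::euclidean_space \<Rightarrow> 'b::euclidean_space"
  assumes "\<And>x. norm x \<ge> R \<Longrightarrow> X x = 0" "norm x > R"
  shows "DF X x = (\<lambda>h. 0)"
proof (rule frechet_derivative_eqI, rule has_derivative_transform_within_open)
  show "((\<lambda>x. 0) has_derivative (\<lambda>h. 0)) (at x)" by simp
  show "open (- cball (0::'a) R)" by (simp add: open_Compl)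
qed (use assms in auto)

lemma test_maps_directional_derivative:
  assumes "X \<in> test_maps"
  shows "(\<lambda>x. DF X x u) \<in> test_maps"
proof -
  obtain R where R: "\<And>x. norm x \<ge> R \<Longrightarrow> X x = 0" "smooth X" using test_mapsE[OF assms] by blast
  have "DF X x = (\<lambda>h. 0)" if "norm x \<ge> R + 1" for x
    by (rule frechet_derivative_outside_support[OF R(1)]) (use that in auto)
  then show ?thesis
    by (intro test_mapsI[of _ "R + 1"] smooth_directional_derivative R(2)) auto
qed

lemma test_maps_affine:
  assumes "X \<in> test_maps" "c \<noteq> 0"
  shows "(\<lambda>y. X (c *\<^sub>R y + a)) \<in> test_maps"
proof -
  obtain R where R: "\<And>x. norm x \<ge> R \<Longrightarrow> X x = 0" "smooth X" using test_mapsE[OF assms(1)] by blast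
  have "norm (c *\<^sub>R y + a) \<ge> R" if "norm y \<ge> (R + norm a) / \<bar>c\<bar>" for y
  proof -
    have "R + norm a \<le> \<bar>c\<bar> * norm y" using that assms(2) by (simp add: pos_divide_le_eq mult.commute)
    also have "\<dots> = norm (c *\<^sub>R y)" by simp
    also have "\<dots> \<le> norm (c *\<^sub>R y + a) + norm a" by (metis add_diff_cancel_right' norm_triangle_ineq4)
    finally show ?thesis by simp
  qed
  then show ?thesis
    by (intro test_mapsI[of _ "(R + norm a) / \<bar>c\<bar>"] smooth_affine R(2)) (use R in auto)
qed

lemma test_maps_shift:
  assumes "X \<in> test_maps" shows "(\<lambda>y. X (y + a)) \<in> test_maps"
  using test_maps_affine[OF assms, of 1 a] by simp

lemma test_maps_bounded:
  assumes "X \<in> test_maps" obtains B where "B \<ge> 0" "\<And>x. norm (X x) \<le> B"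
proof -
  obtain R where R: "\<And>x. norm x \<ge> R \<Longrightarrow> X x = 0" using test_mapsE[OF assms] by blast
  obtain B where B: "\<And>x. norm x \<le> R \<Longrightarrow> norm (X x) \<le> B"
    using smooth_bounded_on_balls[OF test_maps_smooth[OF assms]] by metis
  show ?thesis
  proof (rule that)
    show "norm (X x) \<le> max 0 B" for x
      using R[of x] B[of x] by (cases "norm x \<ge> R") (auto simp: le_max_iff_disj)
  qed simp
qed

lemma euclidean_derivative_sum:
  fixes f :: "'a::euclidean_space \<Rightarrow> 'b::real_normed_vector"
  assumes "f differentiable (at x)"
  shows "DF f x k = (\<Sum>b\<in>Basis. (k \<bullet> b) *\<^sub>R DF f x b)"
proof -
  have "linear (DF f x)" using assms linear_frechet_derivative by blast
  then show ?thesis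
    by (subst (1) euclidean_representation[of k, symmetric]) (simp add: linear_sum linear_scale)
qed

lemma test_maps_derivative_bounded:
  assumes "X \<in> test_maps" obtains B where "B \<ge> 0" "\<And>x k. norm (DF X x k) \<le> B * norm k"
proof -
  have "\<exists>B\<ge>0. \<forall>x. norm (DF X x b) \<le> B" for b
    using test_maps_bounded[OF test_maps_directional_derivative[OF assms]] by metis
  then obtain B where B: "\<And>b. B b \<ge> 0" "\<And>b x. norm (DF X x b) \<le> B b" by metis
  show ?thesis
  proof (rule that)
    show "(\<Sum>b\<in>Basis. B b) \<ge> 0" using B by (simp add: sum_nonneg)
    fix x k
    have "norm (DF X x k) \<le> (\<Sum>b\<in>Basis. norm ((k \<bullet> b) *\<^sub>R DF X x b))"
      unfolding euclidean_derivative_sum[OF smooth_differentiable[OF test_maps_smooth[OF assms]], of x k]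
      by (rule norm_sum)
    also have "\<dots> \<le> (\<Sum>b\<in>Basis. norm k * B b)"
      by (intro sum_mono) (use B in \<open>auto intro!: mult_mono Basis_le_norm\<close>)
    finally show "norm (DF X x k) \<le> (\<Sum>b\<in>Basis. B b) * norm k"
      by (simp add: sum_distrib_left mult.commute)
  qed
qed

lemma test_maps_Lipschitz:
  assumes "X \<in> test_maps" obtains B where "B \<ge> 0" "\<And>x y. norm (X x - X y) \<le> B * norm (x - y)"
proof -
  obtain B where B: "B \<ge> 0" "\<And>x k. norm (DF X x k) \<le> B * norm k"
    using test_maps_derivative_bounded[OF assms] by blast
  have "norm (X x - X y) \<le> B * norm (x - y)" for x y
    by (rule differentiable_bound[where S = UNIV and f' = "\<lambda>x. DF X x"])
      (auto intro!: onorm_bound smooth_has_derivative test_maps_smooth assms B)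
  with B(1) show ?thesis by (rule that)
qed

text \<open>The remainder is uniform in \<open>x\<close>. Hence a functional that is bounded in the supremum norm may be
  differentiated under its argument.\<close>

lemma test_maps_Taylor:
  assumes "X \<in> test_maps" obtains B where "B \<ge> 0"
    "\<And>x k. norm (X (x + k) - X x - DF X x k) \<le> B * (norm k)\<^sup>2"
proof -
  have D: "(X has_derivative DF X x) (at x)" for x
    by (intro smooth_has_derivative test_maps_smooth assms)
  have "\<exists>B\<ge>0. \<forall>x y. norm (DF X x b - DF X y b) \<le> B * norm (x - y)" for b
    using test_maps_Lipschitz[OF test_maps_directional_derivative[OF assms]] by metis
  then obtain B where B: "\<And>b. B b \<ge> 0"
    "\<And>b x y. norm (DF X x b - DF X y b) \<le> B b * norm (x - y)" by metis
  let ?B = "\<Sum>b\<in>Basis. B b"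
  have L: "norm (DF X x h - DF X y h) \<le> ?B * norm (x - y) * norm h" for x y h
  proof -
    have "norm (DF X x h - DF X y h)
        = norm (\<Sum>b\<in>Basis. (h \<bullet> b) *\<^sub>R (DF X x b - DF X y b))"
      using D euclidean_derivative_sum[of X] by (simp add: differentiable_def sum_subtractf scaleR_diff_right) (metis (no_types))
    also have "\<dots> \<le> (\<Sum>b\<in>Basis. norm ((h \<bullet> b) *\<^sub>R (DF X x b - DF X y b)))"
      by (rule norm_sum)
    also have "\<dots> \<le> (\<Sum>b\<in>Basis. norm h * (B b * norm (x - y)))"
      by (intro sum_mono) (use B in \<open>auto intro!: mult_mono Basis_le_norm\<close>)
    also have "\<dots> = ?B * norm (x - y) * norm h" unfolding sum_distrib_right by (simp add: mult_ac)
    finally show ?thesis .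
  qed
  have "norm (X (x + k) - X x - DF X x k) \<le> ?B * (norm k)\<^sup>2" for x k
  proof -
    have "norm (X (x + k) - X x - DF X x ((x + k) - x)) \<le> norm ((x + k) - x) * (?B * norm k)"
    proof (rule differentiable_bound_linearization[where S = "closed_segment x (x + k)" and f' = "\<lambda>x. DF X x"])
      fix y assume "y \<in> closed_segment x (x + k)"
      then obtain t where t: "0 \<le> t" "t \<le> 1" "y = x + t *\<^sub>R k"
        by (auto simp: closed_segment_def algebra_simps)
      then have "norm (y - x) \<le> norm k" by (simp add: mult_left_le_one_le)
      then have "?B * norm (y - x) \<le> ?B * norm k" using B(1) by (intro mult_left_mono) (auto intro: sum_nonneg)
      then have "?B * norm (y - x) * norm h \<le> ?B * norm k * norm h" for h by (intro mult_right_mono) auto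
      then show "onorm (DF X y - DF X x) \<le> ?B * norm k"
        using L[of y _ x] by (intro onorm_bound) (auto intro!: mult_nonneg_nonneg sum_nonneg B(1) intro: order_trans)
      show "(X has_derivative DF X y) (at y within closed_segment x (x + k))"
        using D has_derivative_at_withinI by blast
    qed (auto simp: closed_segment_def algebra_simps)
    then show ?thesis by (simp add: power2_eq_square mult_ac)
  qed
  then show ?thesis by (intro that[of ?B]) (auto intro: sum_nonneg B(1))
qed

lemma integrable_of_bounded_support:
  fixes X :: "'a::euclidean_space \<Rightarrow> 'b::euclidean_space"
  assumes "continuous_on UNIV X" "\<And>x. norm x \<ge> R \<Longrightarrow> X x = 0"
  shows "integrable lebesgue X"
proof -
  have "integrable lborel (\<lambda>x. indicator (cball 0 R) x *\<^sub>R X x)"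
    by (rule borel_integrable_compact) (auto intro: continuous_on_subset[OF assms(1)])
  also have "(\<lambda>x. indicator (cball 0 R) x *\<^sub>R X x) = X"
    using assms(2) by (force simp: indicator_def)
  finally show ?thesis
    using integrable_completion[of X lborel] by (simp add: borel_measurable_integrable)
qed

lemma test_maps_integrable:
  assumes "X \<in> test_maps" shows "integrable lebesgue X"
proof -
  obtain R where R: "\<And>x. norm x \<ge> R \<Longrightarrow> X x = 0" using test_mapsE[OF assms] by metis
  show ?thesis by (rule integrable_of_bounded_support[OF test_maps_continuous_on[OF assms] R])
qed

lemma test_maps_set_integrable:
  assumes "X \<in> test_maps" "E \<in> sets lebesgue" shows "set_integrable lebesgue E X"
  unfolding set_integrable_def
  by (rule integrable_mult_indicator[OF assms(2) test_maps_integrable[OF assms(1)]])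

section \<open>Radon functionals and their convolutions\<close>

text \<open>A functional of order zero on test functions: linear and, on functions supported in a fixed
  ball, bounded in the supremum norm. These are the signed Radon measures, seen as
  distributions.\<close>

definition radon :: "(('a::euclidean_space \<Rightarrow> real) \<Rightarrow> real) \<Rightarrow> bool" where
  "radon L \<longleftrightarrow>
     (\<forall>f\<in>test_maps. \<forall>g\<in>test_maps. \<forall>a b. L (\<lambda>x. a * f x + b * g x) = a * L f + b * L g) \<and>
     (\<forall>R. \<exists>C\<ge>0. \<forall>f\<in>test_maps. \<forall>B. (\<forall>x. norm x \<ge> R \<longrightarrow> f x = 0) \<and> (\<forall>x. \<bar>f x\<bar> \<le> B) \<longrightarrow> \<bar>L f\<bar> \<le> C * B)"

lemma radon_linear:
  assumes "radon L" "f \<in> test_maps" "g \<in> test_maps"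
  shows "L (\<lambda>x. a * f x + b * g x) = a * L f + b * L g"
  using assms unfolding radon_def by blast

lemma radon_add:
  assumes "radon L" "f \<in> test_maps" "g \<in> test_maps"
  shows "L (\<lambda>x. f x + g x) = L f + L g"
  using radon_linear[OF assms, of 1 1] by simp

lemma radon_diff:
  assumes "radon L" "f \<in> test_maps" "g \<in> test_maps"
  shows "L (\<lambda>x. f x - g x) = L f - L g"
  using radon_linear[OF assms, of 1 "-1"] by simp

lemma radon_mult:
  assumes "radon L" "f \<in> test_maps"
  shows "L (\<lambda>x. a * f x) = a * L f"
  using radon_linear[OF assms assms(2), of a 0] by simp

lemma radon_zero: "radon L \<Longrightarrow> L (\<lambda>x. 0) = 0"
  using radon_mult[OF _ zero_test_map, of L 0] by simp

lemma radon_sum: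
  assumes "radon L" "\<And>i. i \<in> I \<Longrightarrow> f i \<in> test_maps"
  shows "L (\<lambda>x. \<Sum>i\<in>I. a i * f i x) = (\<Sum>i\<in>I. a i * L (f i))"
  using assms(2)
proof (induction I rule: infinite_finite_induct)
  case (insert i I)
  have "L (\<lambda>x. a i * f i x + 1 * (\<Sum>i\<in>I. a i * f i x)) = a i * L (f i) + 1 * L (\<lambda>x. \<Sum>i\<in>I. a i * f i x)"
    using insert.prems
    by (intro radon_linear[OF assms(1), of "f i" "\<lambda>x. \<Sum>i\<in>I. a i * f i x"] test_maps_sum test_maps_mult) auto
  then show ?case using insert by simp
qed (use radon_zero[OF assms(1)] in auto)

lemma radon_bound:
  assumes "radon L"
  obtains C where "C \<ge> 0" "\<And>f B. f \<in> test_maps \<Longrightarrow> (\<And>x. norm x \<ge> R \<Longrightarrow> f x = 0) \<Longrightarrow>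
    (\<And>x. \<bar>f x\<bar> \<le> B) \<Longrightarrow> \<bar>L f\<bar> \<le> C * B"
  using assms unfolding radon_def by metis

text \<open>The convolution of a Radon functional with a test function is differentiated by
  differentiating the test function, because the difference quotients converge uniformly and have
  a common bounded support. The factor \<open>c\<close> is \<open>-1\<close> for convolutions and \<open>1\<close> for translations.\<close>

lemma radon_shift_has_derivative:
  fixes L :: "('a::euclidean_space \<Rightarrow> real) \<Rightarrow> real"
  assumes L: "radon L" and \<zeta>: "\<zeta> \<in> test_maps"
  shows "((\<lambda>x. L (\<lambda>y. \<zeta> (y + c *\<^sub>R x))) has_derivative
    (\<lambda>h. L (\<lambda>y. DF \<zeta> (y + c *\<^sub>R x) (c *\<^sub>R h)))) (at x)"
proof -
  obtain R where R: "R > 0" "\<And>x. norm x \<ge> R \<Longrightarrow> \<zeta> x = 0" using test_mapsE[OF \<zeta>] by metis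
  obtain B where B: "B \<ge> 0"
    "\<And>x k. norm (\<zeta> (x + k) - \<zeta> x - DF \<zeta> x k) \<le> B * (norm k)\<^sup>2"
    using test_maps_Taylor[OF \<zeta>] by blast
  \<comment> \<open>For all increments of length at most one, the difference quotients vanish outside this radius.\<close>
  define S where "S = R + 1 + \<bar>c\<bar> * (norm x + 1)"
  obtain C where C: "C \<ge> 0" "\<And>f B. f \<in> test_maps \<Longrightarrow> (\<And>x. norm x \<ge> S \<Longrightarrow> f x = 0) \<Longrightarrow>
    (\<And>x. \<bar>f x\<bar> \<le> B) \<Longrightarrow> \<bar>L f\<bar> \<le> C * B"
    using radon_bound[OF L] by metis
  note D = smooth_has_derivative[OF test_maps_smooth[OF \<zeta>]]
  have lin: "linear (DF \<zeta> z)" for z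
    using D has_derivative_linear by blast
  have shift: "(\<lambda>y. DF \<zeta> (y + a) u) \<in> test_maps" for u a
    by (rule test_maps_shift[OF test_maps_directional_derivative[OF \<zeta>]])
  let ?D = "\<lambda>h. L (\<lambda>y. DF \<zeta> (y + c *\<^sub>R x) (c *\<^sub>R h))"
  have "linear ?D"
  proof (rule linearI)
    show "?D (h + k) = ?D h + ?D k" for h k
      using radon_add[OF L shift[of "c *\<^sub>R x" "c *\<^sub>R h"] shift[of "c *\<^sub>R x" "c *\<^sub>R k"]]
      by (simp add: scaleR_add_right linear_add[OF lin])
    show "?D (r *\<^sub>R h) = r *\<^sub>R ?D h" for r h
      using radon_mult[OF L shift[of "c *\<^sub>R x" "c *\<^sub>R h"], of r]
      by (simp add: linear_scale[OF lin] mult_ac)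
  qed
  then have bl: "bounded_linear ?D" by (simp add: linear_conv_bounded_linear)
  show ?thesis
  proof (rule has_derivativeI_sandwich[where e = 1 and H = "\<lambda>z. C * B * \<bar>c\<bar>\<^sup>2 * norm (z - x)"])
    show "((\<lambda>z. C * B * \<bar>c\<bar>\<^sup>2 * norm (z - x)) \<longlongrightarrow> 0) (at x)"
      by (auto intro!: tendsto_eq_intros)
    fix z assume z: "z \<noteq> x" "dist z x < 1"
    let ?F = "\<lambda>y. \<zeta> (y + c *\<^sub>R z) - \<zeta> (y + c *\<^sub>R x) - DF \<zeta> (y + c *\<^sub>R x) (c *\<^sub>R (z - x))"
    have "L ?F = L (\<lambda>y. \<zeta> (y + c *\<^sub>R z)) - L (\<lambda>y. \<zeta> (y + c *\<^sub>R x)) - ?D (z - x)"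
      using radon_diff[OF L test_maps_diff[OF test_maps_shift[OF \<zeta>] test_maps_shift[OF \<zeta>]] shift]
        radon_diff[OF L test_maps_shift[OF \<zeta>] test_maps_shift[OF \<zeta>]] by simp
    moreover have "\<bar>L ?F\<bar> \<le> C * (B * (norm (c *\<^sub>R (z - x)))\<^sup>2)"
    proof (rule C(2))
      show "?F \<in> test_maps" by (intro test_maps_diff shift test_maps_shift \<zeta>)
      show "\<bar>?F y\<bar> \<le> B * (norm (c *\<^sub>R (z - x)))\<^sup>2" for y
        using B(2)[of "y + c *\<^sub>R x" "c *\<^sub>R (z - x)"] by (simp add: algebra_simps)
      fix y :: 'a assume y: "norm y \<ge> S"
      have far: "norm (y + c *\<^sub>R w) \<ge> R + 1" if "norm w \<le> norm x + 1" for w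
      proof -
        have "\<bar>c\<bar> * norm w \<le> \<bar>c\<bar> * (norm x + 1)" using that by (simp add: mult_left_mono)
        then have "norm (c *\<^sub>R w) \<le> \<bar>c\<bar> * (norm x + 1)" by simp
        moreover have "norm y \<le> norm (y + c *\<^sub>R w) + norm (c *\<^sub>R w)"
          by (metis add_diff_cancel_right' norm_triangle_ineq4)
        ultimately show ?thesis using y unfolding S_def by linarith
      qed
      have zx: "norm z \<le> norm x + 1" using z(2) norm_triangle_ineq2[of z x] by (simp add: dist_norm)
      have "DF \<zeta> w = (\<lambda>h. 0)" if "norm w \<ge> R + 1" for w
        by (rule frechet_derivative_outside_support[OF R(2)]) (use that in auto)
      then show "?F y = 0" using far[OF zx] far[of x] R(2) by simp
    qed
    ultimately have "norm (L (\<lambda>y. \<zeta> (y + c *\<^sub>R z)) - L (\<lambda>y. \<zeta> (y + c *\<^sub>R x)) - ?D (z - x))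
        \<le> C * B * \<bar>c\<bar>\<^sup>2 * norm (z - x) * norm (z - x)"
      by (simp add: power_mult_distrib power2_eq_square mult_ac)
    then show "norm (L (\<lambda>y. \<zeta> (y + c *\<^sub>R z)) - L (\<lambda>y. \<zeta> (y + c *\<^sub>R x)) - ?D (z - x)) / norm (z - x)
        \<le> C * B * \<bar>c\<bar>\<^sup>2 * norm (z - x)"
      using z by (simp add: pos_divide_le_eq)
  qed (use bl in auto)
qed

lemma radon_shift_smooth:
  fixes L :: "('a::euclidean_space \<Rightarrow> real) \<Rightarrow> real"
  assumes L: "radon L" and \<zeta>: "\<zeta> \<in> test_maps"
  shows "smooth (\<lambda>x. L (\<lambda>y. \<zeta> (y + c *\<^sub>R x)))"
proof (rule smooth_coinduct[where P = "{g. \<exists>\<zeta>. g = (\<lambda>x. L (\<lambda>y. \<zeta> (y + c *\<^sub>R x))) \<and> \<zeta> \<in> test_maps}"])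
  fix g u and x :: 'a assume "g \<in> {g. \<exists>\<zeta>. g = (\<lambda>x. L (\<lambda>y. \<zeta> (y + c *\<^sub>R x))) \<and> \<zeta> \<in> test_maps}"
  then obtain \<zeta> where g: "g = (\<lambda>x. L (\<lambda>y. \<zeta> (y + c *\<^sub>R x)))" and \<zeta>: "\<zeta> \<in> test_maps" by blast
  note D = radon_shift_has_derivative[OF L \<zeta>, of c, folded g]
  show "g differentiable (at x)" using D by (auto simp: differentiable_def)
  have "(\<lambda>x. DF g x u) =
      (\<lambda>x. L (\<lambda>y. (\<lambda>z. DF \<zeta> z (c *\<^sub>R u)) (y + c *\<^sub>R x)))"
    using frechet_derivative_eqI[OF D] by simp
  then show "(\<lambda>x. DF g x u) \<in> {g. \<exists>\<zeta>. g = (\<lambda>x. L (\<lambda>y. \<zeta> (y + c *\<^sub>R x))) \<and> \<zeta> \<in> test_maps}"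
    using test_maps_directional_derivative[OF \<zeta>, of "c *\<^sub>R u"] by (intro CollectI exI conjI)
qed (use \<zeta> in blast)

lemma radon_set_integral:
  fixes E :: "'a::euclidean_space set"
  assumes E: "E \<in> sets lebesgue"
  shows "radon (\<lambda>f. set_lebesgue_integral lebesgue E f)"
  unfolding radon_def
proof (intro conjI ballI allI)
  fix f g :: "'a \<Rightarrow> real" and a b assume "f \<in> test_maps" "g \<in> test_maps"
  then show "(LINT x:E|lebesgue. a * f x + b * g x) = a * set_lebesgue_integral lebesgue E f + b * set_lebesgue_integral lebesgue E g"
    using test_maps_set_integrable[OF _ E] by (subst set_integral_add(2)) auto
next
  fix R
  show "\<exists>C\<ge>0. \<forall>f\<in>(test_maps :: ('a \<Rightarrow> real) set). \<forall>B. (\<forall>x. norm x \<ge> R \<longrightarrow> f x = 0) \<and> (\<forall>x. \<bar>f x\<bar> \<le> B) \<longrightarrow>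
      \<bar>set_lebesgue_integral lebesgue E f\<bar> \<le> C * B"
  proof (intro exI[of _ "measure lebesgue (cball (0::'a) R)"] conjI ballI allI impI)
    show "0 \<le> measure lebesgue (cball (0::'a) R)" by simp
    fix f :: "'a \<Rightarrow> real" and B
    assume f: "f \<in> test_maps" and B: "(\<forall>x. norm x \<ge> R \<longrightarrow> f x = 0) \<and> (\<forall>x. \<bar>f x\<bar> \<le> B)"
    have B0: "B \<ge> 0" using B by (meson abs_ge_zero order_trans)
    have "\<bar>set_lebesgue_integral lebesgue E f\<bar> \<le> (\<integral>x. \<bar>indicator E x * f x\<bar> \<partial>lebesgue)"
      unfolding set_lebesgue_integral_def using integral_norm_bound[of lebesgue "\<lambda>x. indicator E x *\<^sub>R f x"] by simp
    also have "\<dots> \<le> (\<integral>x. B * indicator (cball (0::'a) R) x \<partial>lebesgue)"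
    proof (rule Bochner_Integration.integral_mono)
      show "integrable lebesgue (\<lambda>x. \<bar>indicator E x * f x\<bar>)"
        using test_maps_set_integrable[OF f E] unfolding set_integrable_def by (simp add: integrable_abs)
      show "integrable lebesgue (\<lambda>x. B * indicator (cball (0::'a) R) x)"
        using lmeasurable_cball[of "0::'a" R] by (simp add: fmeasurable_def)
      show "\<bar>indicator E x * f x\<bar> \<le> B * indicator (cball 0 R) x" for x
        using B B0 by (auto simp: indicator_def not_le less_imp_le)
    qed
    also have "\<dots> = measure lebesgue (cball (0::'a) R) * B" by simp
    finally show "\<bar>set_lebesgue_integral lebesgue E f\<bar> \<le> measure lebesgue (cball (0::'a) R) * B" .
  qed
qed

lemma radon_diff_functional:
  fixes L K :: "('a::euclidean_space \<Rightarrow> real) \<Rightarrow> real"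
  assumes "radon L" "radon K" shows "radon (\<lambda>f. L f - K f)"
  unfolding radon_def
proof (intro conjI ballI allI)
  fix f g :: "'a \<Rightarrow> real" and a b assume "f \<in> test_maps" "g \<in> test_maps"
  then show "L (\<lambda>x. a * f x + b * g x) - K (\<lambda>x. a * f x + b * g x) = a * (L f - K f) + b * (L g - K g)"
    using radon_linear[OF assms(1)] radon_linear[OF assms(2)] by (simp add: algebra_simps)
next
  fix R :: real
  obtain C where C: "C \<ge> 0" "\<And>f B. f \<in> test_maps \<Longrightarrow> (\<And>x. norm x \<ge> R \<Longrightarrow> f x = 0) \<Longrightarrow>
    (\<And>x. \<bar>f x\<bar> \<le> B) \<Longrightarrow> \<bar>L f\<bar> \<le> C * B" using radon_bound[OF assms(1)] by metis
  obtain D where D: "D \<ge> 0" "\<And>f B. f \<in> test_maps \<Longrightarrow> (\<And>x. norm x \<ge> R \<Longrightarrow> f x = 0) \<Longrightarrow>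
    (\<And>x. \<bar>f x\<bar> \<le> B) \<Longrightarrow> \<bar>K f\<bar> \<le> D * B" using radon_bound[OF assms(2)] by metis
  show "\<exists>C\<ge>0. \<forall>f\<in>(test_maps :: ('a \<Rightarrow> real) set). \<forall>B. (\<forall>x. norm x \<ge> R \<longrightarrow> f x = 0) \<and> (\<forall>x. \<bar>f x\<bar> \<le> B) \<longrightarrow> \<bar>L f - K f\<bar> \<le> C * B"
  proof (intro exI[of _ "C + D"] conjI ballI allI impI)
    fix f :: "'a \<Rightarrow> real" and B assume "f \<in> test_maps" "(\<forall>x. norm x \<ge> R \<longrightarrow> f x = 0) \<and> (\<forall>x. \<bar>f x\<bar> \<le> B)"
    then have "\<bar>L f\<bar> \<le> C * B" "\<bar>K f\<bar> \<le> D * B" using C(2)[of f B] D(2)[of f B] by blast+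
    then show "\<bar>L f - K f\<bar> \<le> (C + D) * B" by (simp add: algebra_simps)
  qed (use C D in simp)
qed

lemma radon_weighted_integral:
  fixes g :: "'a::euclidean_space \<Rightarrow> real"
  assumes g: "g \<in> test_maps"
  shows "radon (\<lambda>f. \<integral>x. g x * f (c *\<^sub>R x) \<partial>lebesgue)"
proof -
  obtain S where S: "\<And>x. norm x \<ge> S \<Longrightarrow> g x = 0" using test_mapsE[OF g] by metis
  have I: "integrable lebesgue (\<lambda>x. g x * f (c *\<^sub>R x))" if f: "f \<in> test_maps" for f :: "'a \<Rightarrow> real"
  proof (rule integrable_of_bounded_support[where R = S])
    show "continuous_on UNIV (\<lambda>x. g x * f (c *\<^sub>R x))"
      by (intro continuous_intros test_maps_continuous_on g
        continuous_on_compose2[OF test_maps_continuous_on[OF f, of UNIV]]) auto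
  qed (use S in auto)
  show ?thesis
    unfolding radon_def
  proof (intro conjI ballI allI)
    fix f h :: "'a \<Rightarrow> real" and a b assume fh: "f \<in> test_maps" "h \<in> test_maps"
    have "(\<integral>x. g x * (a * f (c *\<^sub>R x) + b * h (c *\<^sub>R x)) \<partial>lebesgue)
        = (\<integral>x. a * (g x * f (c *\<^sub>R x)) + b * (g x * h (c *\<^sub>R x)) \<partial>lebesgue)"
      by (simp add: algebra_simps)
    also have "\<dots> = a * (\<integral>x. g x * f (c *\<^sub>R x) \<partial>lebesgue) + b * (\<integral>x. g x * h (c *\<^sub>R x) \<partial>lebesgue)"
      using I[OF fh(1)] I[OF fh(2)] by (subst Bochner_Integration.integral_add) auto
    finally show "(\<integral>x. g x * (a * f (c *\<^sub>R x) + b * h (c *\<^sub>R x)) \<partial>lebesgue) =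
        a * (\<integral>x. g x * f (c *\<^sub>R x) \<partial>lebesgue) + b * (\<integral>x. g x * h (c *\<^sub>R x) \<partial>lebesgue)" .
  next
    fix R
    show "\<exists>C\<ge>0. \<forall>f\<in>test_maps. \<forall>B. (\<forall>x. norm x \<ge> R \<longrightarrow> f x = 0) \<and> (\<forall>x. \<bar>f x\<bar> \<le> B) \<longrightarrow>
        \<bar>\<integral>x. g x * f (c *\<^sub>R x) \<partial>lebesgue\<bar> \<le> C * B"
    proof (intro exI conjI ballI allI impI)
      show "0 \<le> (\<integral>x. \<bar>g x\<bar> \<partial>lebesgue)" by simp
      fix f :: "'a \<Rightarrow> real" and B
      assume f: "f \<in> test_maps" and B: "(\<forall>x. norm x \<ge> R \<longrightarrow> f x = 0) \<and> (\<forall>x. \<bar>f x\<bar> \<le> B)"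
      have "\<bar>\<integral>x. g x * f (c *\<^sub>R x) \<partial>lebesgue\<bar> \<le> (\<integral>x. \<bar>g x * f (c *\<^sub>R x)\<bar> \<partial>lebesgue)"
        by (rule integral_abs_bound)
      also have "\<dots> \<le> (\<integral>x. \<bar>g x\<bar> * B \<partial>lebesgue)"
        using integrable_abs[OF I[OF f]] test_maps_integrable[OF g] B
        by (intro Bochner_Integration.integral_mono) (auto simp: abs_mult mult_left_mono)
      finally show "\<bar>\<integral>x. g x * f (c *\<^sub>R x) \<partial>lebesgue\<bar> \<le> (\<integral>x. \<bar>g x\<bar> \<partial>lebesgue) * B" by simp
    qed
  qed
qed

lemma has_integral_of_support:
  fixes f :: "'a::euclidean_space \<Rightarrow> 'b::euclidean_space"
  assumes "integrable lebesgue f" "\<And>x. x \<notin> S \<Longrightarrow> f x = 0"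
  shows "(f has_integral (\<integral>x. f x \<partial>lebesgue)) S"
proof -
  have "(\<lambda>x. if x \<in> S then f x else 0) = f" using assms(2) by auto
  moreover have "((\<lambda>x. if x \<in> S then f x else 0) has_integral (\<integral>x. f x \<partial>lebesgue)) UNIV \<longleftrightarrow>
      (f has_integral (\<integral>x. f x \<partial>lebesgue)) S"
    by (rule has_integral_restrict) simp
  ultimately show ?thesis using has_integral_integral_lebesgue[OF assms(1)] by simp
qed

text \<open>A convolution of test functions is itself a translate of \<open>\<zeta>\<close> under a Radon functional, namely
  integration against \<open>g\<close>, so that smoothness is inherited from \<open>radon_shift_smooth\<close>.\<close>

lemma convolution_test_map:
  fixes g \<zeta> :: "'a::euclidean_space \<Rightarrow> real"
  assumes g: "g \<in> test_maps" and \<zeta>: "\<zeta> \<in> test_maps"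
  shows "(\<lambda>y. \<integral>x. g x * \<zeta> (y + c *\<^sub>R x) \<partial>lebesgue) \<in> test_maps"
proof -
  obtain R where R: "\<And>x. norm x \<ge> R \<Longrightarrow> g x = 0" using test_mapsE[OF g] by metis
  obtain S where S: "\<And>x. norm x \<ge> S \<Longrightarrow> \<zeta> x = 0" using test_mapsE[OF \<zeta>] by metis
  show ?thesis
  proof (rule test_mapsI[where R = "S + \<bar>c\<bar> * R"])
    show "smooth (\<lambda>y. \<integral>x. g x * \<zeta> (y + c *\<^sub>R x) \<partial>lebesgue)"
      using radon_shift_smooth[OF radon_weighted_integral[OF g, of c] \<zeta>, of 1] by (simp add: add.commute)
    fix y :: 'a assume y: "norm y \<ge> S + \<bar>c\<bar> * R"
    have "g x * \<zeta> (y + c *\<^sub>R x) = 0" for x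
    proof (cases "norm x \<ge> R")
      case False
      then have "\<bar>c\<bar> * norm x \<le> \<bar>c\<bar> * R" by (simp add: mult_left_mono)
      moreover have "norm y \<le> norm (y + c *\<^sub>R x) + norm (c *\<^sub>R x)"
        by (metis add_diff_cancel_right' norm_triangle_ineq4)
      ultimately show ?thesis using y S by simp
    qed (simp add: R)
    then show "(\<integral>x. g x * \<zeta> (y + c *\<^sub>R x) \<partial>lebesgue) = 0" by (intro integral_eq_zero_AE) simp
  qed
qed

lemma convolution_integrable:
  fixes g \<zeta> :: "'a::euclidean_space \<Rightarrow> real"
  assumes g: "g \<in> test_maps" and \<zeta>: "\<zeta> \<in> test_maps"
  shows "integrable lebesgue (\<lambda>x. g x * \<zeta> (y + c *\<^sub>R x))"
proof -
  obtain R where R: "\<And>x. norm x \<ge> R \<Longrightarrow> g x = 0" using test_mapsE[OF g] by metis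
  show ?thesis
  proof (rule integrable_of_bounded_support[where R = R])
    show "continuous_on UNIV (\<lambda>x. g x * \<zeta> (y + c *\<^sub>R x))"
      by (intro continuous_intros test_maps_continuous_on g
        continuous_on_compose2[OF test_maps_continuous_on[OF \<zeta>, of UNIV]]) auto
  qed (use R in auto)
qed

instance bcontfun :: (metric_space, banach) banach ..

text \<open>Fubini's theorem for a Radon functional and a Lebesgue integral. The integral of the
  translates of \<open>\<zeta>\<close>, weighted by \<open>g\<close>, converges as a Riemann integral with values in the Banach
  space of bounded continuous functions; on Riemann sums \<open>L\<close> commutes with the sum, and \<open>L\<close> is bounded
  in the norm of that space.\<close>

lemma radon_integral_swap:
  fixes L :: "('a::euclidean_space \<Rightarrow> real) \<Rightarrow> real"
  assumes L: "radon L" and g: "g \<in> test_maps" and \<zeta>: "\<zeta> \<in> test_maps"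
  shows "L (\<lambda>y. \<integral>x. g x * \<zeta> (y + c *\<^sub>R x) \<partial>lebesgue) = (\<integral>x. g x * L (\<lambda>y. \<zeta> (y + c *\<^sub>R x)) \<partial>lebesgue)"
proof -
  obtain R where R: "R > 0" "\<And>x. norm x \<ge> R \<Longrightarrow> g x = 0" using test_mapsE[OF g] by metis
  obtain S where S: "\<And>x. norm x \<ge> S \<Longrightarrow> \<zeta> x = 0" using test_mapsE[OF \<zeta>] by metis
  obtain a where a: "cball (0::'a) R \<subseteq> cbox (-a) a"
    using bounded_subset_cbox_symmetric[of "cball (0::'a) R"] by auto
  define Q where "Q = cbox (-a) a"
  have outside: "g x = 0" if "x \<notin> Q" for x
    using that a R(2)[of x] unfolding Q_def by (force simp: subset_iff)
  obtain T where T: "\<And>x. x \<in> Q \<Longrightarrow> norm x \<le> T"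
    using bounded_cbox[of "-a" a] unfolding Q_def bounded_iff by blast
  define U where "U = S + \<bar>c\<bar> * T"
  have far: "\<zeta> (y + c *\<^sub>R x) = 0" if "x \<in> Q" "norm y \<ge> U" for x y
  proof -
    have "\<bar>c\<bar> * norm x \<le> \<bar>c\<bar> * T" using T[OF that(1)] by (simp add: mult_left_mono)
    moreover have "norm y \<le> norm (y + c *\<^sub>R x) + norm (c *\<^sub>R x)"
      by (metis add_diff_cancel_right' norm_triangle_ineq4)
    ultimately show ?thesis using that S unfolding U_def by simp
  qed
  obtain C where C: "C \<ge> 0" "\<And>f B. f \<in> test_maps \<Longrightarrow> (\<And>x. norm x \<ge> U \<Longrightarrow> f x = 0) \<Longrightarrow>
    (\<And>x. \<bar>f x\<bar> \<le> B) \<Longrightarrow> \<bar>L f\<bar> \<le> C * B"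
    using radon_bound[OF L] by metis
  obtain M where M: "M \<ge> 0" "\<And>x. norm (\<zeta> x) \<le> M" using test_maps_bounded[OF \<zeta>] by blast
  obtain B where B: "B \<ge> 0" "\<And>x y. norm (\<zeta> x - \<zeta> y) \<le> B * norm (x - y)"
    using test_maps_Lipschitz[OF \<zeta>] by blast
  define \<psi> where "\<psi> x = Bcontfun (\<lambda>y. \<zeta> (y + c *\<^sub>R x))" for x
  have \<psi>: "apply_bcontfun (\<psi> x) y = \<zeta> (y + c *\<^sub>R x)" for x y
  proof -
    have "(\<lambda>y. \<zeta> (y + c *\<^sub>R x)) \<in> bcontfun"
      by (intro bcontfun_normI[of _ M] test_maps_continuous_on test_maps_shift \<zeta> M(2))
    then show ?thesis unfolding \<psi>_def by (simp add: Bcontfun_inverse)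
  qed
  have "(B * \<bar>c\<bar>)-lipschitz_on UNIV \<psi>"
  proof (rule lipschitz_onI)
    fix x x'
    have "dist (\<psi> x) (\<psi> x') = norm (\<psi> x - \<psi> x')" by (rule dist_norm)
    also have "\<dots> \<le> B * \<bar>c\<bar> * norm (x - x')"
    proof (rule norm_bound)
      show "norm (apply_bcontfun (\<psi> x - \<psi> x') y) \<le> B * \<bar>c\<bar> * norm (x - x')" for y
        using B(2)[of "y + c *\<^sub>R x" "y + c *\<^sub>R x'"] by (simp add: \<psi> scaleR_diff_right[symmetric] mult.assoc)
    qed
    finally show "dist (\<psi> x) (\<psi> x') \<le> B * \<bar>c\<bar> * dist x x'" by (simp add: dist_norm)
  qed (use B in simp)
  then have "continuous_on UNIV \<psi>" by (rule lipschitz_on_continuous_on)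
  then have "continuous_on Q (\<lambda>x. g x *\<^sub>R \<psi> x)"
    by (intro continuous_intros test_maps_continuous_on g) (auto intro: continuous_on_subset)
  then have "(\<lambda>x. g x *\<^sub>R \<psi> x) integrable_on Q"
    unfolding Q_def by (rule Henstock_Kurzweil_Integration.integrable_continuous)
  then obtain I where I: "((\<lambda>x. g x *\<^sub>R \<psi> x) has_integral I) Q"
    unfolding integrable_on_def by blast
  have ev: "bounded_linear (\<lambda>f :: 'a \<Rightarrow>\<^sub>C real. apply_bcontfun f y)" for y
    by (rule bounded_linear_intro[where K = 1]) (auto intro: norm_bounded[where 'b = real, simplified])
  have I_apply: "apply_bcontfun I y = (\<integral>x. g x * \<zeta> (y + c *\<^sub>R x) \<partial>lebesgue)" for y
  proof -
    have "((\<lambda>x. g x * \<zeta> (y + c *\<^sub>R x)) has_integral apply_bcontfun I y) Q"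
      using has_integral_linear[OF I ev[of y]] by (simp add: o_def \<psi>)
    moreover have "((\<lambda>x. g x * \<zeta> (y + c *\<^sub>R x)) has_integral (\<integral>x. g x * \<zeta> (y + c *\<^sub>R x) \<partial>lebesgue)) Q"
      by (rule has_integral_of_support[OF convolution_integrable[OF g \<zeta>]]) (simp add: outside)
    ultimately show ?thesis by (rule has_integral_unique)
  qed
  define J where "J = (\<integral>x. g x * L (\<lambda>y. \<zeta> (y + c *\<^sub>R x)) \<partial>lebesgue)"
  have J: "((\<lambda>x. g x * L (\<lambda>y. \<zeta> (y + c *\<^sub>R x))) has_integral J) Q"
    unfolding J_def
  proof (rule has_integral_of_support)
    show "integrable lebesgue (\<lambda>x. g x * L (\<lambda>y. \<zeta> (y + c *\<^sub>R x)))"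
      using test_maps_integrable[OF test_maps_mult_smooth[OF g radon_shift_smooth[OF L \<zeta>, of c]]] by simp
  qed (simp add: outside)
  have close: "\<bar>J - L (apply_bcontfun I)\<bar> < e * (1 + C)" if e: "e > 0" for e
  proof -
    have "\<exists>\<gamma>. gauge \<gamma> \<and> (\<forall>\<D>. \<D> tagged_division_of Q \<and> \<gamma> fine \<D> \<longrightarrow>
        norm ((\<Sum>(x, k)\<in>\<D>. measure lborel k *\<^sub>R (g x *\<^sub>R \<psi> x)) - I) < e)"
      using I e unfolding Q_def has_integral by (elim allE[of _ e]) (simp only: mp)
    then obtain \<gamma> where \<gamma>: "gauge \<gamma>" "\<And>\<D>. \<D> tagged_division_of Q \<Longrightarrow> \<gamma> fine \<D> \<Longrightarrow>
        norm ((\<Sum>(x, k)\<in>\<D>. measure lborel k *\<^sub>R (g x *\<^sub>R \<psi> x)) - I) < e"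
      by blast
    have "\<exists>\<delta>. gauge \<delta> \<and> (\<forall>\<D>. \<D> tagged_division_of Q \<and> \<delta> fine \<D> \<longrightarrow>
        norm ((\<Sum>(x, k)\<in>\<D>. measure lborel k *\<^sub>R (g x * L (\<lambda>y. \<zeta> (y + c *\<^sub>R x)))) - J) < e)"
      using J e unfolding Q_def has_integral by (elim allE[of _ e]) (simp only: mp)
    then obtain \<delta> where \<delta>: "gauge \<delta>" "\<And>\<D>. \<D> tagged_division_of Q \<Longrightarrow> \<delta> fine \<D> \<Longrightarrow>
        norm ((\<Sum>(x, k)\<in>\<D>. measure lborel k *\<^sub>R (g x * L (\<lambda>y. \<zeta> (y + c *\<^sub>R x)))) - J) < e"
      by blast
    obtain \<D> where \<D>: "\<D> tagged_division_of Q" "(\<lambda>x. \<gamma> x \<inter> \<delta> x) fine \<D>"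
      using fine_division_exists[OF gauge_Int[OF \<gamma>(1) \<delta>(1)]] unfolding Q_def by blast
    define G where "G = (\<lambda>y. \<Sum>p\<in>\<D>. (measure lborel (snd p) * g (fst p)) * \<zeta> (y + c *\<^sub>R fst p))"
    have G: "G \<in> test_maps" unfolding G_def by (intro test_maps_sum test_maps_mult test_maps_shift \<zeta>)
    have I_test: "apply_bcontfun I \<in> test_maps"
      using convolution_test_map[OF g \<zeta>] by (simp add: I_apply[abs_def])
    have "\<bar>(\<Sum>(x, k)\<in>\<D>. measure lborel k *\<^sub>R (g x * L (\<lambda>y. \<zeta> (y + c *\<^sub>R x)))) - J\<bar> < e"
      using \<delta>(2)[OF \<D>(1)] \<D>(2) by (simp add: fine_Int)
    moreover have "L G = (\<Sum>(x, k)\<in>\<D>. measure lborel k *\<^sub>R (g x * L (\<lambda>y. \<zeta> (y + c *\<^sub>R x))))"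
      unfolding G_def
      by (subst radon_sum[OF L test_maps_shift[OF \<zeta>]]) (auto simp: case_prod_unfold mult.assoc intro!: sum.cong)
    moreover have "\<bar>L (\<lambda>y. G y - apply_bcontfun I y)\<bar> \<le> C * e"
    proof (rule C(2)[OF test_maps_diff[OF G I_test]])
      have tags: "fst p \<in> Q" if "p \<in> \<D>" for p
        using tag_in_interval[OF \<D>(1), of "fst p" "snd p"] that by simp
      show "G y - apply_bcontfun I y = 0" if "norm y \<ge> U" for y
      proof -
        have "g x * \<zeta> (y + c *\<^sub>R x) = 0" for x
          using far[OF _ that, of x] outside[of x] by auto
        then have "apply_bcontfun I y = 0" unfolding I_apply by (intro integral_eq_zero_AE) simp
        moreover have "G y = 0" unfolding G_def using far[OF tags that] by (auto intro: sum.neutral)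
        ultimately show ?thesis by simp
      qed
      let ?s = "\<Sum>(x, k)\<in>\<D>. measure lborel k *\<^sub>R (g x *\<^sub>R \<psi> x)"
      have "norm (?s - I) < e" using \<gamma>(2)[OF \<D>(1)] \<D>(2) by (simp add: fine_Int)
      then have "\<bar>apply_bcontfun (?s - I) y\<bar> \<le> e" for y
        using norm_bounded[of "?s - I" y] by simp
      moreover have "apply_bcontfun ?s y = G y" for y
        unfolding G_def linear_sum[OF bounded_linear.linear[OF ev]]
        by (auto simp: case_prod_unfold \<psi> mult.assoc intro!: sum.cong)
      ultimately show "\<bar>G y - apply_bcontfun I y\<bar> \<le> e" for y by simp
    qed
    then have "\<bar>L G - L (apply_bcontfun I)\<bar> \<le> C * e"
      using radon_diff[OF L G I_test] by simp
    ultimately show ?thesis by (simp add: algebra_simps)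
  qed
  have "J = L (apply_bcontfun I)"
  proof (rule ccontr)
    assume "J \<noteq> L (apply_bcontfun I)"
    then have "\<bar>J - L (apply_bcontfun I)\<bar> / (1 + C) > 0" using C(1) by simp
    from close[OF this] show False using C(1) by simp
  qed
  then show ?thesis unfolding J_def I_apply[abs_def, symmetric] by simp
qed

lemma lebesgue_integral_affine_isometry:
  fixes f :: "'a::euclidean_space \<Rightarrow> real"
  assumes "continuous_on UNIV f" "\<bar>c\<bar> = 1"
  shows "(\<integral>x. f (a + c *\<^sub>R x) \<partial>lebesgue) = (\<integral>x. f x \<partial>lebesgue)"
proof -
  have m: "f \<in> borel_measurable borel" using assms(1) by (rule borel_measurable_continuous_onI)
  have m': "(\<lambda>x. f (a + c *\<^sub>R x)) \<in> borel_measurable borel" using m by measurable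
  have "lborel = distr lborel borel (\<lambda>x::'a. a + c *\<^sub>R x)"
    using lborel_affine[of c a] assms(2) by (auto simp: density_1)
  then have "(\<integral>x. f x \<partial>lborel) = (\<integral>x. f x \<partial>distr lborel borel (\<lambda>x::'a. a + c *\<^sub>R x))" by simp
  also have "\<dots> = (\<integral>x. f (a + c *\<^sub>R x) \<partial>lborel)" by (rule integral_distr) (use m in auto)
  finally show ?thesis
    using m m' integral_completion[of f lborel] integral_completion[of "\<lambda>x. f (a + c *\<^sub>R x)" lborel]
    by simp
qed

lemma lebesgue_integral_translate:
  fixes f :: "'a::euclidean_space \<Rightarrow> real"
  assumes "continuous_on UNIV f"
  shows "(\<integral>x. f (x + a) \<partial>lebesgue) = (\<integral>x. f x \<partial>lebesgue)"
  using lebesgue_integral_affine_isometry[OF assms, of 1 a] by (simp add: add.commute)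

lemma lebesgue_integral_reflect:
  fixes f :: "'a::euclidean_space \<Rightarrow> real"
  assumes "continuous_on UNIV f"
  shows "(\<integral>x. f (a - x) \<partial>lebesgue) = (\<integral>x. f x \<partial>lebesgue)"
  using lebesgue_integral_affine_isometry[OF assms, of "-1" a] by simp

text \<open>The integral of the translates of \<open>f\<close> is constant, and its derivative is the integral of the
  derivative of \<open>f\<close>.\<close>

lemma integral_directional_derivative_test_map:
  fixes f :: "'a::euclidean_space \<Rightarrow> real"
  assumes f: "f \<in> test_maps"
  shows "(\<integral>x. DF f x u \<partial>lebesgue) = 0"
proof -
  let ?L = "\<lambda>f::'a \<Rightarrow> real. set_lebesgue_integral lebesgue UNIV f"
  have "radon ?L" by (rule radon_set_integral) simp
  from radon_shift_has_derivative[OF this f, of 1 0]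
  have "((\<lambda>x. \<integral>y. f (y + x) \<partial>lebesgue) has_derivative (\<lambda>h. \<integral>y. DF f y h \<partial>lebesgue)) (at 0)"
    by (simp add: set_lebesgue_integral_def)
  moreover have "((\<lambda>x. \<integral>y. f (y + x) \<partial>lebesgue) has_derivative (\<lambda>h. 0)) (at 0)"
    by (simp add: lebesgue_integral_translate[OF test_maps_continuous_on[OF f]])
  ultimately show ?thesis using has_derivative_unique by metis
qed

section \<open>Cutoff and bump functions\<close>

text \<open>The standard bump function. Normalised by \<open>exp 1\<close> it is \<open>1\<close> at the origin and increases to \<open>1\<close>
  everywhere as \<open>R\<close> tends to infinity.\<close>

definition cutoff :: "real \<Rightarrow> 'a::euclidean_space \<Rightarrow> real" where
  "cutoff R x = flat_exp 0 (1 - (norm x / R)\<^sup>2)"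

lemma cutoff_nonneg: "cutoff R x \<ge> 0"
  unfolding cutoff_def flat_exp_def by simp

lemma cutoff_support: "R > 0 \<Longrightarrow> norm x \<ge> R \<Longrightarrow> cutoff R x = 0"
proof -
  assume "R > 0" "norm x \<ge> R"
  then have "1 \<le> norm x / R" by simp
  then have "1 \<le> (norm x / R)\<^sup>2" by (rule one_le_power)
  then show ?thesis unfolding cutoff_def flat_exp_def by simp
qed

lemma cutoff_le: "exp 1 * cutoff R x \<le> 1"
proof (cases "1 - (norm x / R)\<^sup>2 > 0")
  case True
  then have "1 \<le> inverse (1 - (norm x / R)\<^sup>2)" by (intro one_le_inverse) auto
  then have "exp (1 - inverse (1 - (norm x / R)\<^sup>2)) \<le> exp 0" by (subst exp_le_cancel_iff) simp
  moreover have "exp 1 * exp (- inverse (1 - (norm x / R)\<^sup>2)) = exp (1 - inverse (1 - (norm x / R)\<^sup>2))"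
    by (simp add: exp_add[symmetric])
  ultimately show ?thesis using True by (simp add: cutoff_def flat_exp_def)
qed (simp add: cutoff_def flat_exp_def)

lemma cutoff_tendsto: "(\<lambda>k. exp 1 * cutoff (real (Suc k)) x) \<longlonglongrightarrow> 1"
proof -
  have "(\<lambda>k. norm x / real (Suc k)) \<longlonglongrightarrow> 0"
    by (rule LIMSEQ_Suc[OF lim_const_over_n])
  then have "(\<lambda>k. 1 - (norm x / real (Suc k))\<^sup>2) \<longlonglongrightarrow> 1 - 0\<^sup>2" by (intro tendsto_intros)
  then have "(\<lambda>k. 1 - (norm x / real (Suc k))\<^sup>2) \<longlonglongrightarrow> 1" by simp
  moreover have "isCont (flat_exp 0) 1" using DERIV_isCont[OF flat_exp_has_derivative] .
  ultimately have "(\<lambda>k. flat_exp 0 (1 - (norm x / real (Suc k))\<^sup>2)) \<longlonglongrightarrow> flat_exp 0 1"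
    by (rule isCont_tendsto_compose[rotated])
  then have "(\<lambda>k. exp 1 * cutoff (real (Suc k)) x) \<longlonglongrightarrow> exp 1 * flat_exp 0 1"
    unfolding cutoff_def by (rule tendsto_mult_left)
  then show ?thesis by (simp add: flat_exp_def exp_minus)
qed

lemma cutoff_test_map:
  assumes "R > 0" shows "(cutoff R :: 'a::euclidean_space \<Rightarrow> real) \<in> test_maps"
proof (rule test_mapsI[where R = R])
  have "smooth (\<lambda>x::'a. 1 - inverse (R\<^sup>2) * (x \<bullet> x))"
    by (intro smooth_diff smooth_mult smooth_inner smooth_const smooth_linear bounded_linear_ident)
  from smooth_flat_exp[OF this, of 0]
  show "smooth (cutoff R :: 'a \<Rightarrow> real)"
    unfolding cutoff_def[abs_def] by (simp add: power_divide power2_norm_eq_inner field_simps)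
  show "cutoff R x = 0" if "norm x \<ge> R" for x :: 'a
    using assms that by (rule cutoff_support)
qed

lemma bump_exists:
  assumes "\<epsilon> > 0"
  obtains \<eta> :: "'a::euclidean_space \<Rightarrow> real" where "\<eta> \<in> test_maps" "\<And>x. \<eta> x \<ge> 0"
    "\<And>x. norm x \<ge> \<epsilon> \<Longrightarrow> \<eta> x = 0" "(\<integral>x. \<eta> x \<partial>lebesgue) = 1"
proof -
  let ?f = "cutoff \<epsilon> :: 'a \<Rightarrow> real"
  define Z where "Z = (\<integral>x. ?f x \<partial>lebesgue)"
  have I: "integrable lebesgue ?f" by (rule test_maps_integrable[OF cutoff_test_map[OF assms]])
  have "Z \<noteq> 0"
  proof
    assume "Z = 0"
    then have "AE x in lebesgue. ?f x = 0"
      using integral_nonneg_eq_0_iff_AE[OF I] cutoff_nonneg unfolding Z_def by auto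
    moreover have "?f x \<noteq> 0" if "x \<in> ball 0 \<epsilon>" for x
    proof -
      have "norm x / \<epsilon> < 1" using that assms by simp
      then have "(norm x / \<epsilon>)\<^sup>2 < 1" using assms by (simp add: power_less_one_iff abs_square_less_1)
      then show ?thesis by (simp add: cutoff_def flat_exp_def)
    qed
    ultimately have "AE x in lebesgue. x \<notin> ball (0::'a) \<epsilon>" by (auto elim: eventually_mono)
    then have "ball (0::'a) \<epsilon> \<in> null_sets lebesgue"
      by (intro AE_iff_null_sets[THEN iffD2]) simp_all
    then have "negligible (ball (0::'a) \<epsilon>)" by (simp only: negligible_iff_null_sets)
    then show False using open_not_negligible[of "ball (0::'a) \<epsilon>"] assms by auto
  qed
  moreover have "Z \<ge> 0" unfolding Z_def by (simp add: cutoff_nonneg)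
  ultimately have Z: "Z > 0" by simp
  show ?thesis
  proof (rule that[of "\<lambda>x. inverse Z * ?f x"])
    show "(\<lambda>x. inverse Z * ?f x) \<in> test_maps" by (intro test_maps_mult cutoff_test_map assms)
    show "inverse Z * ?f x \<ge> 0" for x using Z cutoff_nonneg[of \<epsilon> x] by simp
    show "inverse Z * ?f x = 0" if "norm x \<ge> \<epsilon>" for x
      using cutoff_support[OF assms that] by simp
    show "(\<integral>x. inverse Z * ?f x \<partial>lebesgue) = 1" using Z by (simp add: Z_def)
  qed
qed

section \<open>Duality of integrable functions and test maps\<close>

text \<open>A measurable map is an almost everywhere limit of continuous maps, and these are
  approximated by polynomials on growing balls (Stone--Weierstrass).\<close>

lemma ae_limit_of_smooth_maps:
  fixes F :: "'a::euclidean_space \<Rightarrow> 'b::euclidean_space"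
  assumes "F \<in> borel_measurable lebesgue"
  obtains q where "\<And>n. smooth (q n)" "AE x in lebesgue. (\<lambda>n. q n x) \<longlonglongrightarrow> F x"
proof -
  have "F measurable_on UNIV" using assms by (rule lebesgue_measurable_imp_measurable_on) simp
  then obtain N g where N: "negligible N" "\<And>n. continuous_on UNIV (g n)"
    "\<And>x. x \<notin> N \<Longrightarrow> (\<lambda>n. g n x) \<longlonglongrightarrow> F x"
    unfolding measurable_on_def by auto
  have "\<exists>p. polynomial_function p \<and> (\<forall>x\<in>cball 0 (real n). norm (g n x - p x) < inverse (real (Suc n)))" for n
    by (rule Stone_Weierstrass_polynomial_function) (auto intro: continuous_on_subset[OF N(2)])
  then obtain q where q: "\<And>n. polynomial_function (q n)"
    "\<And>n x. x \<in> cball 0 (real n) \<Longrightarrow> norm (g n x - q n x) < inverse (real (Suc n))" by metis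
  have lim: "(\<lambda>n. q n x) \<longlonglongrightarrow> F x" if "x \<notin> N" for x
  proof -
    have "(\<lambda>n. g n x - q n x) \<longlonglongrightarrow> 0"
    proof (rule Lim_null_comparison[OF _ LIMSEQ_inverse_real_of_nat])
      obtain m :: nat where "norm x \<le> real m" using real_arch_simple by blast
      then show "\<forall>\<^sub>F n in sequentially. norm (g n x - q n x) \<le> inverse (real (Suc n))"
        using q(2) by (intro eventually_sequentiallyI[of m] less_imp_le) auto
    qed
    from tendsto_diff[OF N(3)[OF that] this] show ?thesis by simp
  qed
  show ?thesis
  proof (rule that)
    show "smooth (q n)" for n by (rule smooth_polynomial_function[OF q(1)])
    have "N \<in> null_sets lebesgue" using N(1) by (simp only: negligible_iff_null_sets)
    then show "AE x in lebesgue. (\<lambda>n. q n x) \<longlonglongrightarrow> F x"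
      by (rule AE_I') (use lim in auto)
  qed
qed

text \<open>Duality of \<open>L\<^sup>1\<close> with test maps. The optimal pairing is with \<open>F / |F|\<close>. It is replaced by
  \<open>\<kappa> q / sqrt (\<delta> + |q|\<^sup>2)\<close>, where \<open>q\<close> is a smooth approximation of \<open>F\<close> and \<open>\<kappa>\<close> a cutoff: this is
  smooth, has norm at most one, and its pairing with \<open>F\<close> tends to \<open>\<kappa> |F|\<^sup>2 / sqrt (\<delta> + |F|\<^sup>2)\<close> as \<open>q\<close>
  tends to \<open>F\<close>. Fatou's lemma then removes \<open>\<kappa>\<close> and \<open>\<delta>\<close>.\<close>

lemma nn_integral_norm_le_of_pairing:
  fixes F :: "'a::euclidean_space \<Rightarrow> 'b::euclidean_space"
  assumes meas: "F \<in> borel_measurable lebesgue"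
    and bdd: "\<And>R. \<exists>B. \<forall>x. norm x \<le> R \<longrightarrow> norm (F x) \<le> B"
    and pair: "\<And>X. X \<in> test_maps \<Longrightarrow> (\<And>x. norm (X x) \<le> 1) \<Longrightarrow> (\<integral>x. F x \<bullet> X x \<partial>lebesgue) \<le> C"
  shows "(\<integral>\<^sup>+x. ennreal (norm (F x)) \<partial>lebesgue) \<le> ennreal C"
proof -
  obtain q where q: "\<And>n. smooth (q n)" "AE x in lebesgue. (\<lambda>n. q n x) \<longlonglongrightarrow> F x"
    using ae_limit_of_smooth_maps[OF meas] by blast
  define \<delta> where "\<delta> k = inverse (real (Suc k))" for k
  have \<delta>: "\<delta> k > 0" for k by (simp add: \<delta>_def)
  define \<rho> where "\<rho> k v = (\<delta> k + v \<bullet> v) powr (-1/2)" for k and v :: 'b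
  have pos: "\<delta> k + v \<bullet> v > 0" for k and v :: 'b
    using \<delta>[of k] inner_ge_zero[of v] by linarith
  have \<rho>: "\<rho> k v > 0" for k v unfolding \<rho>_def using pos[of k v] by simp
  have \<rho>_le: "\<rho> k v * norm v \<le> 1" for k v
  proof -
    have "norm v = sqrt (v \<bullet> v)" by (rule norm_eq_sqrt_inner)
    also have "\<dots> \<le> sqrt (\<delta> k + v \<bullet> v)" using \<delta>[of k] by simp
    also have "\<dots> = inverse (\<rho> k v)"
      unfolding \<rho>_def using pos[of k v] by (simp add: powr_minus powr_half_sqrt)
    finally show ?thesis using \<rho>[of k v] by (simp add: inverse_eq_divide pos_le_divide_eq mult.commute)
  qed
  define \<kappa> where "\<kappa> k x = exp 1 * cutoff (real (Suc k)) x" for k and x :: 'a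
  have \<kappa>: "0 \<le> \<kappa> k x" "\<kappa> k x \<le> 1" for k x
    unfolding \<kappa>_def by (intro mult_nonneg_nonneg cutoff_nonneg cutoff_le; simp)+
  have \<kappa>_test: "\<kappa> k \<in> test_maps" for k
    unfolding \<kappa>_def[abs_def] by (intro test_maps_mult cutoff_test_map) simp
  define G where "G k x = \<kappa> k x * (\<rho> k (F x) * (F x \<bullet> F x))" for k x
  have G0: "G k x \<ge> 0" for k x unfolding G_def using \<kappa>[of k x] \<rho>[of k "F x"] by simp
  have "integrable lebesgue (G k) \<and> (\<integral>x. G k x \<partial>lebesgue) \<le> C" for k
  proof -
    define X where "X n x = \<kappa> k x *\<^sub>R (\<rho> k (q n x) *\<^sub>R q n x)" for n x
    have X_test: "X n \<in> test_maps" for n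
      unfolding X_def[abs_def] \<rho>_def[abs_def]
      by (intro test_maps_mult_smooth \<kappa>_test smooth_scaleR smooth_powr smooth_add_real smooth_inner
          smooth_const q(1) pos)
    have X_le: "norm (X n x) \<le> 1" for n x
    proof -
      have "norm (X n x) = \<kappa> k x * (\<rho> k (q n x) * norm (q n x))"
        using \<kappa>[of k x] \<rho>[of k "q n x"] by (simp add: X_def)
      also have "\<dots> \<le> 1 * 1"
        using \<kappa>[of k x] \<rho>_le[of k "q n x"] \<rho>[of k "q n x"] by (intro mult_mono) auto
      finally show ?thesis by simp
    qed
    obtain B where B: "\<And>x. norm x \<le> real (Suc k) \<Longrightarrow> norm (F x) \<le> B" using bdd by metis
    let ?w = "\<lambda>x. B * indicator (cball (0::'a) (real (Suc k))) x"
    have w: "integrable lebesgue ?w"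
      using lmeasurable_cball[of "0::'a" "real (Suc k)"] by (simp add: fmeasurable_def)
    have lim: "AE x in lebesgue. (\<lambda>n. F x \<bullet> X n x) \<longlonglongrightarrow> G k x"
      using q(2)
    proof eventually_elim
      fix x assume "(\<lambda>n. q n x) \<longlonglongrightarrow> F x"
      then have "(\<lambda>n. F x \<bullet> X n x) \<longlonglongrightarrow> F x \<bullet> (\<kappa> k x *\<^sub>R (\<rho> k (F x) *\<^sub>R F x))"
        unfolding X_def \<rho>_def using pos[of k "F x"] by (intro tendsto_intros) auto
      then show "(\<lambda>n. F x \<bullet> X n x) \<longlonglongrightarrow> G k x" by (simp add: G_def mult.assoc)
    qed
    have dom: "AE x in lebesgue. norm (F x \<bullet> X n x) \<le> ?w x" for n
    proof (rule AE_I2)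
      fix x :: 'a
      show "norm (F x \<bullet> X n x) \<le> ?w x"
      proof (cases "norm x \<le> real (Suc k)")
        case True
        have "norm (F x \<bullet> X n x) \<le> norm (F x) * norm (X n x)" by (simp add: Cauchy_Schwarz_ineq2)
        also have "\<dots> \<le> norm (F x) * 1" by (intro mult_left_mono X_le) simp
        finally show ?thesis using B[OF True] True by simp
      next
        case False
        then have "\<kappa> k x = 0" unfolding \<kappa>_def by (simp add: cutoff_support)
        then show ?thesis using False by (simp add: X_def)
      qed
    qed
    have mG: "G k \<in> borel_measurable lebesgue"
      unfolding G_def[abs_def] \<rho>_def[abs_def]
      using meas borel_measurable_integrable[OF test_maps_integrable[OF \<kappa>_test[of k]]]
      by measurable
    have mX: "(\<lambda>x. F x \<bullet> X n x) \<in> borel_measurable lebesgue" for n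
      using meas borel_measurable_integrable[OF test_maps_integrable[OF X_test[of n]]]
      by measurable
    have "integrable lebesgue (G k)"
      by (rule integrable_dominated_convergence[OF mG mX w lim dom])
    moreover have "(\<lambda>n. \<integral>x. F x \<bullet> X n x \<partial>lebesgue) \<longlonglongrightarrow> (\<integral>x. G k x \<partial>lebesgue)"
      by (rule integral_dominated_convergence[OF mG mX w lim dom])
    then have "(\<integral>x. G k x \<partial>lebesgue) \<le> C"
      by (rule LIMSEQ_le_const2) (use pair[OF X_test X_le] in auto)
    ultimately show ?thesis by blast
  qed
  then have GC: "(\<integral>\<^sup>+x. ennreal (G k x) \<partial>lebesgue) \<le> ennreal C"
    and mG: "G k \<in> borel_measurable lebesgue" for k
    using G0 by (simp_all add: nn_integral_eq_integral ennreal_leI borel_measurable_integrable)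
  have "(\<lambda>k. G k x) \<longlonglongrightarrow> norm (F x)" for x
  proof (cases "F x = 0")
    case True then show ?thesis by (simp add: G_def)
  next
    case False
    have "\<delta> \<longlonglongrightarrow> 0" unfolding \<delta>_def[abs_def] by (rule LIMSEQ_inverse_real_of_nat)
    then have "(\<lambda>k. \<kappa> k x * (\<rho> k (F x) * (F x \<bullet> F x))) \<longlonglongrightarrow> 1 * ((0 + F x \<bullet> F x) powr (-1/2) * (F x \<bullet> F x))"
      unfolding \<kappa>_def \<rho>_def using False by (intro tendsto_intros cutoff_tendsto) auto
    moreover have "(F x \<bullet> F x) powr (-1/2) * (F x \<bullet> F x) = norm (F x)"
    proof -
      have "(F x \<bullet> F x) powr (-1/2) * (F x \<bullet> F x) powr 1 = (F x \<bullet> F x) powr (1/2)"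
        by (subst powr_add[symmetric]) simp
      then show ?thesis by (simp add: powr_half_sqrt norm_eq_sqrt_inner)
    qed
    ultimately show ?thesis unfolding G_def by simp
  qed
  then have "(\<lambda>k. ennreal (G k x)) \<longlonglongrightarrow> ennreal (norm (F x))" for x
    by (intro tendsto_ennrealI)
  then have "(\<integral>\<^sup>+x. ennreal (norm (F x)) \<partial>lebesgue) = (\<integral>\<^sup>+x. liminf (\<lambda>k. ennreal (G k x)) \<partial>lebesgue)"
    by (intro nn_integral_cong) (metis lim_imp_Liminf trivial_limit_sequentially)
  also have "\<dots> \<le> liminf (\<lambda>k. \<integral>\<^sup>+x. ennreal (G k x) \<partial>lebesgue)"
    by (rule nn_integral_liminf) (use mG in measurable)
  also have "\<dots> \<le> ennreal C"
    by (rule Liminf_le) (use GC in auto)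
  finally show ?thesis .
qed

section \<open>Divergence and gradient\<close>

lemma divergence_componentwise:
  fixes X :: "'a::euclidean_space \<Rightarrow> 'a"
  assumes "smooth X"
  shows "divergence X x = (\<Sum>b\<in>Basis. DF (\<lambda>x. X x \<bullet> b) x b)"
proof -
  have "DF (\<lambda>x. X x \<bullet> b) x = (\<lambda>h. DF X x h \<bullet> b)" for b
    by (intro frechet_derivative_eqI has_derivative_inner_left smooth_has_derivative assms)
  then show ?thesis unfolding divergence_def by simp
qed

lemma divergence_test_map:
  fixes X :: "'a::euclidean_space \<Rightarrow> 'a"
  assumes "X \<in> test_maps" shows "divergence X \<in> test_maps"
  unfolding divergence_componentwise[OF test_maps_smooth[OF assms], abs_def]
  by (intro test_maps_sum test_maps_directional_derivative test_maps_inner assms)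

lemma integral_divergence_test_map:
  fixes X :: "'a::euclidean_space \<Rightarrow> 'a"
  assumes "X \<in> test_maps" shows "(\<integral>x. divergence X x \<partial>lebesgue) = 0"
proof -
  have "(\<integral>x. divergence X x \<partial>lebesgue)
      = (\<Sum>b\<in>Basis. \<integral>x. DF (\<lambda>x. X x \<bullet> b) x b \<partial>lebesgue)"
    unfolding divergence_componentwise[OF test_maps_smooth[OF assms], abs_def]
    by (intro Bochner_Integration.integral_sum test_maps_integrable
        test_maps_directional_derivative test_maps_inner assms)
  then show ?thesis
    using integral_directional_derivative_test_map[OF test_maps_inner[OF assms]] by simp
qed

lemma divergence_smooth_mult:
  fixes X :: "'a::euclidean_space \<Rightarrow> 'a"
  assumes "smooth w" "smooth X"
  shows "divergence (\<lambda>x. w x *\<^sub>R X x) x = w x * divergence X x + DF w x (X x)"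
proof -
  have "DF (\<lambda>x. w x *\<^sub>R X x) x =
      (\<lambda>h. w x *\<^sub>R DF X x h + DF w x h *\<^sub>R X x)"
    by (intro frechet_derivative_eqI has_derivative_scaleR smooth_has_derivative assms)
  then have "divergence (\<lambda>x. w x *\<^sub>R X x) x =
      w x * divergence X x + (\<Sum>b\<in>Basis. (X x \<bullet> b) *\<^sub>R DF w x b)"
    unfolding divergence_def
    by (simp add: inner_add_left sum.distrib sum_distrib_left mult.commute)
  then show ?thesis
    using euclidean_derivative_sum[OF smooth_differentiable[OF assms(1)], of x "X x"] by simp
qed

lemma divergence_scaleR:
  fixes Y :: "'a::euclidean_space \<Rightarrow> 'a"
  assumes "smooth Y" shows "divergence (\<lambda>x. c *\<^sub>R Y x) x = c * divergence Y x"
proof -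
  have "DF (\<lambda>x::'a. c) x = (\<lambda>h. 0)" by (rule frechet_derivative_eqI) simp
  then show ?thesis using divergence_smooth_mult[OF smooth_const assms, of c] by simp
qed

definition grad :: "('a::euclidean_space \<Rightarrow> real) \<Rightarrow> 'a \<Rightarrow> 'a" where
  "grad u x = (\<Sum>b\<in>Basis. DF u x b *\<^sub>R b)"

lemma grad_inner:
  assumes "smooth u" shows "grad u x \<bullet> v = DF u x v"
  unfolding grad_def euclidean_derivative_sum[OF smooth_differentiable[OF assms], of x v] inner_sum_left
  by (rule sum.cong) (simp_all add: inner_commute[of v])

lemma smooth_grad: "smooth u \<Longrightarrow> smooth (grad u)"
  unfolding grad_def[abs_def] by (intro smooth_sum smooth_scaleR smooth_directional_derivative smooth_const)

section \<open>The coarea inequality for smooth functions\<close>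

text \<open>A smooth increasing function with limits \<open>0\<close> and \<open>1\<close>. It is algebraic, so that its smoothness
  follows from that of powers.\<close>

definition sigmoid :: "real \<Rightarrow> real" where
  "sigmoid t = (1 + t * (1 + t\<^sup>2) powr (-1/2)) / 2"

definition sigmoid_deriv :: "real \<Rightarrow> real" where
  "sigmoid_deriv t = (1 + t\<^sup>2) powr (-3/2) / 2"

lemma sigmoid_has_derivative: "(sigmoid has_real_derivative sigmoid_deriv t) (at t)"
proof -
  have pos: "1 + t\<^sup>2 > 0" by (simp add: add_pos_nonneg)
  have "(sigmoid has_real_derivative
      ((1 + t\<^sup>2) powr (-1/2) + t * ((-1/2) * (1 + t\<^sup>2) powr (-1/2 - 1) * (2 * t))) / 2) (at t)"
    unfolding sigmoid_def[abs_def]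
    by (rule derivative_eq_intros refl pos | simp)+
  also have "(1 + t\<^sup>2) powr (-1/2) = (1 + t\<^sup>2) powr (-3/2) * (1 + t\<^sup>2)"
  proof -
    have "(1 + t\<^sup>2) powr (-1/2) = (1 + t\<^sup>2) powr (-3/2) * (1 + t\<^sup>2) powr 1"
      by (subst powr_add[symmetric]) simp
    then show ?thesis using pos by simp
  qed
  also have "((1 + t\<^sup>2) powr (-3/2) * (1 + t\<^sup>2) + t * ((-1/2) * (1 + t\<^sup>2) powr (-1/2 - 1) * (2 * t))) / 2
      = sigmoid_deriv t"
    by (simp add: sigmoid_deriv_def algebra_simps power2_eq_square)
  finally show ?thesis .
qed

lemma sigmoid_deriv_nonneg: "sigmoid_deriv t \<ge> 0"
  by (simp add: sigmoid_deriv_def)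

lemma sigmoid_eq: "sigmoid t = (1 + t / sqrt (1 + t\<^sup>2)) / 2"
proof -
  have "1 + t\<^sup>2 > 0" by (simp add: add_pos_nonneg)
  then have "(1 + t\<^sup>2) powr (-1/2) = inverse (sqrt (1 + t\<^sup>2))"
    by (simp add: powr_minus powr_half_sqrt)
  then show ?thesis by (simp only: sigmoid_def divide_inverse[of t])
qed

lemma sigmoid_bounds: "0 \<le> sigmoid t" "sigmoid t \<le> 1"
proof -
  have "sqrt (t\<^sup>2) \<le> sqrt (1 + t\<^sup>2)" by (rule real_sqrt_le_mono) simp
  then have "\<bar>t\<bar> \<le> sqrt (1 + t\<^sup>2)" by simp
  moreover have "sqrt (1 + t\<^sup>2) > 0" by (simp add: add_pos_nonneg)
  ultimately have "\<bar>t / sqrt (1 + t\<^sup>2)\<bar> \<le> 1" by simp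
  then have "- 1 \<le> t / sqrt (1 + t\<^sup>2)" "t / sqrt (1 + t\<^sup>2) \<le> 1" by (simp_all only: abs_le_iff) auto
  then show "0 \<le> sigmoid t" "sigmoid t \<le> 1" unfolding sigmoid_eq by auto
qed

lemma sigmoid_at_top: "(sigmoid \<longlongrightarrow> 1) at_top"
proof (rule tendsto_sandwich[of "\<lambda>t. 1 - inverse t" _ _ "\<lambda>t. 1"])
  show "\<forall>\<^sub>F t in at_top. 1 - inverse t \<le> sigmoid t"
    using eventually_gt_at_top[of 0]
  proof eventually_elim
    fix t :: real assume t: "0 < t"
    have "sqrt (1 + t\<^sup>2) \<le> sqrt ((1 + t)\<^sup>2)" using t by (intro real_sqrt_le_mono) (simp add: power2_sum)
    then have "sqrt (1 + t\<^sup>2) \<le> 1 + t" using t by simp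
    moreover have "sqrt (1 + t\<^sup>2) > 0" by (simp add: add_pos_nonneg)
    ultimately have "t / (1 + t) \<le> t / sqrt (1 + t\<^sup>2)" using t by (intro divide_left_mono) auto
    moreover have "1 - inverse t \<le> t / (1 + t)" using t by (simp add: field_simps)
    ultimately have "1 - inverse t \<le> t / sqrt (1 + t\<^sup>2)" by linarith
    moreover have "inverse t > 0" using t by simp
    ultimately show "1 - inverse t \<le> sigmoid t" unfolding sigmoid_eq by (simp add: field_simps)
  qed
  have "((\<lambda>t::real. 1 - inverse t) \<longlongrightarrow> 1 - 0) at_top"
    by (intro tendsto_intros tendsto_inverse_0_at_top filterlim_ident)
  then show "((\<lambda>t::real. 1 - inverse t) \<longlongrightarrow> 1) at_top" by simp
qed (auto intro: always_eventually sigmoid_bounds)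

lemma sigmoid_at_bot: "(sigmoid \<longlongrightarrow> 0) at_bot"
proof -
  have "sigmoid (- t) = 1 - sigmoid t" for t unfolding sigmoid_eq by (simp add: field_simps)
  moreover have "((\<lambda>t. 1 - sigmoid t) \<longlongrightarrow> 1 - 1) at_top" by (intro tendsto_intros sigmoid_at_top)
  ultimately show ?thesis by (simp add: filterlim_at_bot_mirror)
qed

text \<open>The shift by \<open>k\<close>, of lower order than the dilation by \<open>k\<^sup>2\<close>, forces the limit \<open>0\<close> at \<open>r = 0\<close>:
  the convergence to the indicator function of \<open>r > 0\<close> is everywhere, not only off the jump.\<close>

lemma sigmoid_sequence_tendsto:
  "(\<lambda>k. sigmoid ((real k)\<^sup>2 * r - real k)) \<longlonglongrightarrow> (if r > 0 then 1 else 0)"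
proof (cases "r > 0")
  case True
  have "filterlim (\<lambda>k. r * real k) at_top sequentially"
    by (rule filterlim_tendsto_pos_mult_at_top[OF tendsto_const True filterlim_real_sequentially])
  then have "filterlim (\<lambda>k. - 1 + r * real k) at_top sequentially"
    by (rule filterlim_tendsto_add_at_top[OF tendsto_const])
  then have "filterlim (\<lambda>k. real k * (- 1 + r * real k)) at_top sequentially"
    by (rule filterlim_at_top_mult_at_top[OF filterlim_real_sequentially])
  then have "filterlim (\<lambda>k. (real k)\<^sup>2 * r - real k) at_top sequentially"
    by (simp add: power2_eq_square algebra_simps)
  from filterlim_compose[OF sigmoid_at_top this] show ?thesis using True by simp
next
  case False
  have "filterlim (\<lambda>k. - real k) at_bot sequentially"
    using filterlim_real_sequentially by (simp only: filterlim_uminus_at_bot minus_minus)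
  then have "filterlim (\<lambda>k. (real k)\<^sup>2 * r - real k) at_bot sequentially"
  proof (rule filterlim_at_bot_mono)
    show "\<forall>\<^sub>F k in sequentially. (real k)\<^sup>2 * r - real k \<le> - real k"
      using False by (intro always_eventually allI) (simp add: mult_nonneg_nonpos)
  qed
  from filterlim_compose[OF sigmoid_at_bot this] show ?thesis using False by simp
qed

lemma smooth_sigmoid:
  fixes w :: "'a::euclidean_space \<Rightarrow> real"
  assumes "smooth w" shows "smooth (\<lambda>x. sigmoid (w x))"
proof -
  have "1 + w x * w x > 0" for x by (simp add: add_pos_nonneg)
  then have "smooth (\<lambda>x. (1/2) * (1 + w x * (1 + w x * w x) powr (-1/2)))"
    by (intro smooth_mult smooth_const smooth_add_real smooth_powr assms)
  then show ?thesis by (simp add: sigmoid_def power2_eq_square)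
qed

text \<open>The norm of the gradient of \<open>sigmoid (k\<^sup>2 (u - s) - k)\<close>, the smooth approximation of the indicator
  function of \<open>{u > s}\<close>. Its integral over \<open>s\<close> is at most \<open>|\<nabla>u|\<close>.\<close>

definition coarea_density :: "('a::euclidean_space \<Rightarrow> real) \<Rightarrow> nat \<Rightarrow> real \<Rightarrow> 'a \<Rightarrow> ennreal" where
  "coarea_density u k s x =
     ennreal ((real k)\<^sup>2 * sigmoid_deriv ((real k)\<^sup>2 * (u x - s) - real k)) * ennreal (norm (grad u x))"

text \<open>Lower semicontinuity of the perimeter along the smooth approximations of the indicator
  function: each of them is integrated by parts against a test field, and dominated convergence
  identifies the limit.\<close>

lemma perimeter_superlevel_le:
  fixes u :: "'a::euclidean_space \<Rightarrow> real"
  assumes u: "smooth u"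
  shows "perimeter {x. u x > s} \<le> liminf (\<lambda>k. \<integral>\<^sup>+x. coarea_density u k s x \<partial>lebesgue)"
  unfolding perimeter_def
proof (rule SUP_least)
  fix X :: "'a \<Rightarrow> 'a" assume "X \<in> {X \<in> test_fields. \<forall>x. norm (X x) \<le> 1}"
  then have X: "X \<in> test_maps" "\<And>x. norm (X x) \<le> 1" by (auto simp: test_fields_eq_test_maps)
  note div = divergence_test_map[OF X(1)]
  define a where "a k x = (real k)\<^sup>2 * (u x - s) - real k" for k x
  have a: "smooth (a k)" for k
    unfolding a_def[abs_def] by (intro smooth_diff smooth_mult smooth_const u)
  define r where "r k = - (\<integral>x. sigmoid (a k x) * divergence X x \<partial>lebesgue)" for k
  have "r \<longlonglongrightarrow> indicator_gradient {x. u x > s} X"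
    unfolding r_def indicator_gradient_def set_lebesgue_integral_def
  proof (intro tendsto_minus integral_dominated_convergence[where w = "\<lambda>x. norm (divergence X x)"])
    show "(\<lambda>x. indicator {x. u x > s} x *\<^sub>R divergence X x) \<in> borel_measurable lebesgue"
    proof -
      have "u \<in> borel_measurable lebesgue"
        by (rule smooth_borel_measurable_lebesgue[OF u])
      moreover have "divergence X \<in> borel_measurable lebesgue"
        using borel_measurable_integrable[OF test_maps_integrable[OF div]] .
      ultimately show ?thesis by measurable
    qed
    show "(\<lambda>x. sigmoid (a k x) * divergence X x) \<in> borel_measurable lebesgue" for k
      using test_maps_integrable[OF test_maps_smooth_mult[OF smooth_sigmoid[OF a[of k]] div]]
      by (simp add: borel_measurable_integrable)
    show "integrable lebesgue (\<lambda>x. norm (divergence X x))"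
      using test_maps_integrable[OF div] by (rule integrable_norm)
    show "AE x in lebesgue. (\<lambda>k. sigmoid (a k x) * divergence X x) \<longlonglongrightarrow> indicator {x. u x > s} x *\<^sub>R divergence X x"
    proof (rule AE_I2)
      fix x
      have "(\<lambda>k. sigmoid (a k x) * divergence X x) \<longlonglongrightarrow> (if u x - s > 0 then 1 else 0) * divergence X x"
        unfolding a_def by (intro tendsto_mult sigmoid_sequence_tendsto tendsto_const)
      then show "(\<lambda>k. sigmoid (a k x) * divergence X x) \<longlonglongrightarrow> indicator {x. u x > s} x *\<^sub>R divergence X x"
        by (cases "s < u x") simp_all
    qed
    show "AE x in lebesgue. norm (sigmoid (a k x) * divergence X x) \<le> norm (divergence X x)" for k
      using sigmoid_bounds by (intro AE_I2) (simp add: abs_mult mult_left_le_one_le)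
  qed
  then have "(\<lambda>k. ennreal (r k)) \<longlonglongrightarrow> ennreal (indicator_gradient {x. u x > s} X)"
    by (rule tendsto_ennrealI)
  then have "ennreal (indicator_gradient {x. u x > s} X) = liminf (\<lambda>k. ennreal (r k))"
    by (metis lim_imp_Liminf trivial_limit_sequentially)
  also have "\<dots> \<le> liminf (\<lambda>k. \<integral>\<^sup>+x. coarea_density u k s x \<partial>lebesgue)"
  proof (intro Liminf_mono always_eventually allI)
    fix k
    let ?w = "\<lambda>x. sigmoid (a k x)"
    note w = smooth_sigmoid[OF a[of k]]
    have Dw: "DF ?w x h = (real k)\<^sup>2 * sigmoid_deriv (a k x) * (grad u x \<bullet> h)" for x h
    proof -
      have "(a k has_derivative (\<lambda>h. (real k)\<^sup>2 * DF u x h)) (at x)"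
        unfolding a_def[abs_def] using smooth_has_derivative[OF u, of x]
        by (auto intro!: derivative_eq_intros)
      moreover have "(sigmoid has_derivative (\<lambda>h. sigmoid_deriv (a k x) * h)) (at (a k x))"
        using sigmoid_has_derivative[of "a k x"] by (simp add: has_field_derivative_def)
      ultimately have "(sigmoid \<circ> a k has_derivative (\<lambda>h. sigmoid_deriv (a k x) * h) \<circ> (\<lambda>h. (real k)\<^sup>2 * DF u x h)) (at x)"
        by (rule diff_chain_at)
      then have "(?w has_derivative (\<lambda>h. sigmoid_deriv (a k x) * ((real k)\<^sup>2 * DF u x h))) (at x)"
        by (simp add: o_def)
      from frechet_derivative_eqI[OF this] show ?thesis by (simp add: grad_inner[OF u])
    qed
    have test: "(\<lambda>x. ?w x * divergence X x) \<in> test_maps"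
      using test_maps_smooth_mult[OF w div] by simp
    have wX: "(\<lambda>x. ?w x *\<^sub>R X x) \<in> test_maps" by (rule test_maps_smooth_mult[OF w X(1)])
    have eq: "DF ?w x (X x) = divergence (\<lambda>x. ?w x *\<^sub>R X x) x - ?w x * divergence X x" for x
      using divergence_smooth_mult[OF w test_maps_smooth[OF X(1)], of x] by simp
    have I: "integrable lebesgue (\<lambda>x. DF ?w x (X x))"
      unfolding eq by (intro test_maps_integrable test_maps_diff divergence_test_map wX test)
    have "r k = (\<integral>x. DF ?w x (X x) \<partial>lebesgue)"
      unfolding eq r_def
      using integral_divergence_test_map[OF wX] test_maps_integrable[OF test]
        test_maps_integrable[OF divergence_test_map[OF wX]]
      by simp
    also have "ennreal (\<integral>x. DF ?w x (X x) \<partial>lebesgue)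
        \<le> (\<integral>\<^sup>+x. ennreal (norm (DF ?w x (X x))) \<partial>lebesgue)"
      by (rule order_trans[OF _ integral_norm_bound_ennreal[OF I]]) (simp add: ennreal_leI)
    also have "\<dots> \<le> (\<integral>\<^sup>+x. coarea_density u k s x \<partial>lebesgue)"
    proof (rule nn_integral_mono)
      fix x
      have "norm (DF ?w x (X x))
          \<le> (real k)\<^sup>2 * sigmoid_deriv (a k x) * (norm (grad u x) * norm (X x))"
        unfolding Dw using Cauchy_Schwarz_ineq2[of "grad u x" "X x"] sigmoid_deriv_nonneg[of "a k x"]
        by (simp add: abs_mult mult_left_mono)
      also have "\<dots> \<le> (real k)\<^sup>2 * sigmoid_deriv (a k x) * (norm (grad u x) * 1)"
        using sigmoid_deriv_nonneg[of "a k x"] by (intro mult_left_mono X(2)) auto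
      finally show "ennreal (norm (DF ?w x (X x))) \<le> coarea_density u k s x"
        unfolding coarea_density_def a_def
        using sigmoid_deriv_nonneg by (subst ennreal_mult[symmetric]) (auto intro: ennreal_leI)
    qed
    finally show "ennreal (r k) \<le> (\<integral>\<^sup>+x. coarea_density u k s x \<partial>lebesgue)" .
  qed
  finally show "ennreal (indicator_gradient {x. u x > s} X)
      \<le> liminf (\<lambda>k. \<integral>\<^sup>+x. coarea_density u k s x \<partial>lebesgue)" .
qed

lemma sigma_finite_lebesgue: "sigma_finite_measure (lebesgue :: 'a::euclidean_space measure)"
proof
  have "\<exists>A::'a set set. countable A \<and> A \<subseteq> sets lborel \<and> \<Union>A = space lborel \<and> (\<forall>a\<in>A. emeasure lborel a \<noteq> \<infinity>)"
    by (rule lborel.sigma_finite_countable)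
  then show "\<exists>A::'a set set. countable A \<and> A \<subseteq> sets lebesgue \<and> \<Union>A = space lebesgue \<and> (\<forall>a\<in>A. emeasure lebesgue a \<noteq> \<infinity>)"
    by (elim exE conjE, intro exI conjI) auto
qed

lemma nn_integral_sigmoid_deriv_le:
  "(\<integral>\<^sup>+s. ennreal ((real k)\<^sup>2 * sigmoid_deriv ((real k)\<^sup>2 * (t - s) - real k)) * indicator {0..1} s \<partial>lborel) \<le> 1"
proof -
  let ?F = "\<lambda>s. - sigmoid ((real k)\<^sup>2 * (t - s) - real k)"
  have "(\<integral>\<^sup>+s. ennreal ((real k)\<^sup>2 * sigmoid_deriv ((real k)\<^sup>2 * (t - s) - real k)) * indicator {0..1} s \<partial>lborel)
      = ennreal (?F 1 - ?F 0)"
  proof (rule nn_integral_FTC_Icc)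
    show "(\<lambda>s. (real k)\<^sup>2 * sigmoid_deriv ((real k)\<^sup>2 * (t - s) - real k)) \<in> borel_measurable borel"
      unfolding sigmoid_deriv_def by measurable
    show "(?F has_real_derivative (real k)\<^sup>2 * sigmoid_deriv ((real k)\<^sup>2 * (t - s) - real k)) (at s)" for s
    proof -
      have "((\<lambda>s. (real k)\<^sup>2 * (t - s) - real k) has_real_derivative - ((real k)\<^sup>2)) (at s)"
        by (auto intro!: derivative_eq_intros)
      from DERIV_minus[OF DERIV_chain2[OF sigmoid_has_derivative this]]
      show ?thesis by (simp add: mult.commute)
    qed
  qed (auto simp: sigmoid_deriv_nonneg)
  also have "\<dots> \<le> ennreal 1"
    using sigmoid_bounds(1)[of "(real k)\<^sup>2 * (t - 1) - real k"] sigmoid_bounds(2)[of "(real k)\<^sup>2 * (t - 0) - real k"]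
    by (intro ennreal_leI) linarith
  finally show ?thesis by simp
qed

text \<open>At a point where \<open>u\<close> has the value \<open>t\<close>, the levels \<open>s\<close> in \<open>[0, 1]\<close> for which \<open>{u > s}\<close> and \<open>\<Omega>\<close>
  disagree lie between \<open>t\<close> and the value \<open>0\<close> or \<open>1\<close> of the indicator function of \<open>\<Omega>\<close>.\<close>

lemma nn_integral_superlevel_sym_diff_le:
  fixes t :: real
  shows "(\<integral>\<^sup>+s. indicator {s. (t > s) \<noteq> P} s * indicator {0..1} s \<partial>lborel) \<le> ennreal \<bar>t - (if P then 1 else 0)\<bar>"
proof -
  let ?I = "if P then {t..max t 1} else {0..max 0 t}"
  have "(\<integral>\<^sup>+s. indicator {s. (t > s) \<noteq> P} s * indicator {0..1} s \<partial>lborel) \<le> (\<integral>\<^sup>+s. indicator ?I s \<partial>lborel)"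
    by (intro nn_integral_mono) (auto split: split_indicator)
  also have "\<dots> = emeasure lborel ?I" by simp
  also have "\<dots> \<le> ennreal \<bar>t - (if P then 1 else 0)\<bar>"
    by (auto simp: max_def intro: ennreal_leI)
  finally show ?thesis .
qed

text \<open>The coarea argument. For every \<open>s\<close> the set \<open>{u > s}\<close> is a competitor, hence \<open>c\<close> is at most the
  average over \<open>s\<close> in \<open>[0, 1]\<close> of upper bounds for the energies of these sets. By Tonelli's theorem the
  average of the perimeters is at most the integral of \<open>|\<nabla>u|\<close>, and the average of the
  symmetric differences at most that of \<open>|u - \<chi>\<^sub>\<Omega>|\<close>. It is the bounds that are
  averaged, since they are visibly measurable in \<open>s\<close>.\<close>

lemma F_CE_lower_bound_of_smooth_function:
  fixes u :: "'a::euclidean_space \<Rightarrow> real"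
  assumes \<Omega>: "\<Omega> \<in> sets lebesgue" and u: "smooth u"
    and c: "\<And>E. E \<in> sets lebesgue \<Longrightarrow> c \<le> F_CE \<Omega> E"
    and N: "(\<integral>\<^sup>+x. ennreal (norm (grad u x)) \<partial>lebesgue) \<le> N"
    and M: "(\<integral>\<^sup>+x. ennreal \<bar>u x - indicator \<Omega> x\<bar> \<partial>lebesgue) \<le> M"
  shows "c \<le> N + M"
proof -
  interpret leb: sigma_finite_measure "lebesgue :: 'a measure" by (rule sigma_finite_lebesgue)
  interpret pair: pair_sigma_finite "lborel :: real measure" "lebesgue :: 'a measure" ..
  have [measurable]: "u \<in> borel_measurable lebesgue" by (rule smooth_borel_measurable_lebesgue[OF u])
  have [measurable]: "grad u \<in> borel_measurable lebesgue"
    by (rule smooth_borel_measurable_lebesgue[OF smooth_grad[OF u]])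
  have [measurable]: "\<Omega> \<in> sets lebesgue" by (rule \<Omega>)
  have [measurable]: "(\<lambda>(s, x). coarea_density u k s x) \<in> borel_measurable (lborel \<Otimes>\<^sub>M lebesgue)" for k
    unfolding coarea_density_def sigmoid_deriv_def by measurable
  define \<phi> where "\<phi> k s = (\<integral>\<^sup>+x. coarea_density u k s x \<partial>lebesgue) * indicator {0..1} s" for k and s :: real
  define \<psi> where "\<psi> s = (\<integral>\<^sup>+x. indicator {x. (u x > s) \<noteq> (x \<in> \<Omega>)} x \<partial>lebesgue) * indicator {0..1} s" for s :: real
  have m\<phi>[measurable]: "\<phi> k \<in> borel_measurable lborel" for k
    unfolding \<phi>_def[abs_def] by measurable
  have [measurable]: "(\<lambda>(s, x). indicator {x. (u x > s) \<noteq> (x \<in> \<Omega>)} x :: ennreal) \<in> borel_measurable (lborel \<Otimes>\<^sub>M lebesgue)"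
    unfolding indicator_def by measurable
  have m\<psi>[measurable]: "\<psi> \<in> borel_measurable lborel"
    unfolding \<psi>_def[abs_def] by measurable
  have int_\<phi>: "(\<integral>\<^sup>+s. \<phi> k s \<partial>lborel) \<le> N" for k
  proof -
    have "(\<integral>\<^sup>+s. \<phi> k s \<partial>lborel) = (\<integral>\<^sup>+s. \<integral>\<^sup>+x. coarea_density u k s x * indicator {0..1} s \<partial>lebesgue \<partial>lborel)"
      unfolding \<phi>_def by (intro nn_integral_cong nn_integral_multc[symmetric]) measurable
    also have "\<dots> = (\<integral>\<^sup>+x. \<integral>\<^sup>+s. coarea_density u k s x * indicator {0..1} s \<partial>lborel \<partial>lebesgue)"
      by (rule pair.Fubini'[symmetric]) measurable
    also have "\<dots> \<le> (\<integral>\<^sup>+x. ennreal (norm (grad u x)) \<partial>lebesgue)"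
    proof (rule nn_integral_mono)
      fix x
      have "(\<integral>\<^sup>+s. coarea_density u k s x * indicator {0..1} s \<partial>lborel)
          = (\<integral>\<^sup>+s. ennreal (norm (grad u x)) * (ennreal ((real k)\<^sup>2 * sigmoid_deriv ((real k)\<^sup>2 * (u x - s) - real k)) * indicator {0..1} s) \<partial>lborel)"
        unfolding coarea_density_def by (intro nn_integral_cong) (simp add: mult_ac)
      also have "\<dots> = ennreal (norm (grad u x)) * (\<integral>\<^sup>+s. ennreal ((real k)\<^sup>2 * sigmoid_deriv ((real k)\<^sup>2 * (u x - s) - real k)) * indicator {0..1} s \<partial>lborel)"
        unfolding sigmoid_deriv_def by (rule nn_integral_cmult) measurable
      also have "\<dots> \<le> ennreal (norm (grad u x)) * 1"
        by (intro mult_left_mono nn_integral_sigmoid_deriv_le) simp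
      finally show "(\<integral>\<^sup>+s. coarea_density u k s x * indicator {0..1} s \<partial>lborel) \<le> ennreal (norm (grad u x))" by simp
    qed
    also note N
    finally show ?thesis .
  qed
  have int_\<psi>: "(\<integral>\<^sup>+s. \<psi> s \<partial>lborel) \<le> M"
  proof -
    have "(\<integral>\<^sup>+s. \<psi> s \<partial>lborel)
        = (\<integral>\<^sup>+s. \<integral>\<^sup>+x. indicator {x. (u x > s) \<noteq> (x \<in> \<Omega>)} x * indicator {0..1} s \<partial>lebesgue \<partial>lborel)"
      unfolding \<psi>_def by (intro nn_integral_cong nn_integral_multc[symmetric]) measurable
    also have "\<dots> = (\<integral>\<^sup>+x. \<integral>\<^sup>+s. indicator {x. (u x > s) \<noteq> (x \<in> \<Omega>)} x * indicator {0..1} s \<partial>lborel \<partial>lebesgue)"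
      by (rule pair.Fubini'[symmetric]) measurable
    also have "\<dots> \<le> (\<integral>\<^sup>+x. ennreal \<bar>u x - indicator \<Omega> x\<bar> \<partial>lebesgue)"
    proof (rule nn_integral_mono)
      fix x
      show "(\<integral>\<^sup>+s. indicator {x. (u x > s) \<noteq> (x \<in> \<Omega>)} x * indicator {0..1} s \<partial>lborel) \<le> ennreal \<bar>u x - indicator \<Omega> x\<bar>"
        using nn_integral_superlevel_sym_diff_le[of "u x" "x \<in> \<Omega>"]
        by (simp add: indicator_def of_bool_def)
    qed
    also note M
    finally show ?thesis .
  qed
  have "c = (\<integral>\<^sup>+s. c * indicator {0..1::real} s \<partial>lborel)" by (simp add: nn_integral_cmult_indicator)
  also have "\<dots> \<le> (\<integral>\<^sup>+s. liminf (\<lambda>k. \<phi> k s) + \<psi> s \<partial>lborel)"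
  proof (rule nn_integral_mono)
    fix s :: real
    show "c * indicator {0..1} s \<le> liminf (\<lambda>k. \<phi> k s) + \<psi> s"
    proof (cases "s \<in> {0..1}")
      case True
      have "{x \<in> space lebesgue. u x > s} \<in> sets lebesgue" by measurable
      then have "{x. u x > s} \<in> sets lebesgue" by simp
      then have "c \<le> perimeter {x. u x > s} + emeasure lebesgue (sym_diff {x. u x > s} \<Omega>)"
        using c unfolding F_CE_def by blast
      also have "perimeter {x. u x > s} \<le> liminf (\<lambda>k. \<phi> k s)"
        using perimeter_superlevel_le[OF u, of s] True by (simp add: \<phi>_def)
      also have "emeasure lebesgue (sym_diff {x. u x > s} \<Omega>) = \<psi> s"
      proof -
        have "sym_diff {x. u x > s} \<Omega> = {x. (u x > s) \<noteq> (x \<in> \<Omega>)}" by auto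
        moreover have "{x \<in> space lebesgue. (u x > s) \<noteq> (x \<in> \<Omega>)} \<in> sets lebesgue" by measurable
        ultimately show ?thesis using True by (simp add: \<psi>_def)
      qed
      finally show ?thesis using True by (simp add: add_right_mono)
    qed simp
  qed
  also have "\<dots> = (\<integral>\<^sup>+s. liminf (\<lambda>k. \<phi> k s) \<partial>lborel) + (\<integral>\<^sup>+s. \<psi> s \<partial>lborel)"
    by (rule nn_integral_add) measurable
  also have "(\<integral>\<^sup>+s. liminf (\<lambda>k. \<phi> k s) \<partial>lborel) \<le> liminf (\<lambda>k. \<integral>\<^sup>+s. \<phi> k s \<partial>lborel)"
    by (rule nn_integral_liminf) measurable
  also have "\<dots> \<le> N"
    by (rule Liminf_le) (use int_\<phi> in auto)
  finally show ?thesis using int_\<psi> by (meson add_mono order_refl order_trans)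
qed

section \<open>The lower bound for functionals of bounded variation\<close>

lemma abs_set_integral_divergence_le:
  fixes Y :: "'a::euclidean_space \<Rightarrow> 'a"
  assumes E: "E \<in> sets lebesgue" "perimeter E < \<infinity>"
    and Y: "Y \<in> test_maps" "\<And>x. norm (Y x) \<le> B"
  shows "\<bar>set_lebesgue_integral lebesgue E (divergence Y)\<bar> \<le> enn2real (perimeter E) * B"
proof -
  have scale: "indicator_gradient E (\<lambda>x. c *\<^sub>R Y x) = - c * set_lebesgue_integral lebesgue E (divergence Y)" for c
    unfolding indicator_gradient_def divergence_scaleR[OF test_maps_smooth[OF Y(1)], abs_def] by simp
  have grad_le: "- c * set_lebesgue_integral lebesgue E (divergence Y) \<le> enn2real (perimeter E)"
    if "\<And>x. norm (c *\<^sub>R Y x) \<le> 1" for c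
  proof -
    have "(\<lambda>x. c *\<^sub>R Y x) \<in> {X \<in> test_fields. \<forall>x. norm (X x) \<le> 1}"
      using that test_maps_scaleR[OF Y(1)] by (simp add: test_fields_eq_test_maps)
    then have "ennreal (indicator_gradient E (\<lambda>x. c *\<^sub>R Y x)) \<le> perimeter E"
      unfolding perimeter_def by (rule SUP_upper)
    also have "\<dots> = ennreal (enn2real (perimeter E))" using E(2) by simp
    finally show ?thesis unfolding scale by (simp add: ennreal_le_iff)
  qed
  have B: "B \<ge> 0" using Y(2)[of 0] norm_ge_zero order_trans by blast
  show ?thesis
  proof (cases "B = 0")
    case True
    then have "Y = (\<lambda>x. 0 *\<^sub>R Y x)" using Y(2) by (intro ext) simp
    then have "divergence Y x = 0" for x
      using divergence_scaleR[OF test_maps_smooth[OF Y(1)], of 0 x] by simp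
    then show ?thesis using True by (simp add: set_lebesgue_integral_def)
  next
    case False
    then have B: "B > 0" using B by simp
    have "norm ((1/B) *\<^sub>R Y x) \<le> 1" "norm ((-1/B) *\<^sub>R Y x) \<le> 1" for x
      using Y(2)[of x] B by (simp_all add: pos_divide_le_eq)
    from grad_le[OF this(1)] grad_le[OF this(2)] show ?thesis using B by (simp add: field_simps abs_le_iff)
  qed
qed

text \<open>A translation by \<open>z\<close> moves the indicator function of \<open>E\<close> by at most \<open>Per E \<cdot> |z|\<close>, tested
  against \<open>f\<close>: the derivative in direction \<open>h\<close> of the integral of the translate of \<open>f\<close> is the integral
  over \<open>E\<close> of the divergence of a field of norm at most \<open>|h|\<close>. This is what makes the mollification
  error small for sets of infinite measure.\<close>

lemma set_integral_translate_le:
  fixes f :: "'a::euclidean_space \<Rightarrow> real"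
  assumes E: "E \<in> sets lebesgue" "perimeter E < \<infinity>"
    and f: "f \<in> test_maps" "\<And>x. \<bar>f x\<bar> \<le> 1"
  shows "\<bar>set_lebesgue_integral lebesgue E (\<lambda>y. f (y + (-1) *\<^sub>R z)) - set_lebesgue_integral lebesgue E f\<bar>
    \<le> enn2real (perimeter E) * norm z"
proof -
  let ?\<Psi> = "\<lambda>x. set_lebesgue_integral lebesgue E (\<lambda>y. f (y + (-1) *\<^sub>R x))"
  let ?D = "\<lambda>x h. set_lebesgue_integral lebesgue E (\<lambda>y. DF f (y + (-1) *\<^sub>R x) ((-1) *\<^sub>R h))"
  have D: "(?\<Psi> has_derivative ?D x) (at x)" for x
    by (rule radon_shift_has_derivative[OF radon_set_integral[OF E(1)] f(1)])
  have D_le: "\<bar>?D x h\<bar> \<le> enn2real (perimeter E) * norm h" for x h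
  proof -
    let ?f = "\<lambda>y. f (y + (-1) *\<^sub>R x)"
    let ?Y = "\<lambda>y. ?f y *\<^sub>R ((-1) *\<^sub>R h)"
    note f' = test_maps_shift[OF f(1), of "(-1) *\<^sub>R x"]
    have Y: "?Y \<in> test_maps" by (rule test_maps_mult_smooth[OF f' smooth_const])
    have "divergence ?Y y = DF f (y + (-1) *\<^sub>R x) ((-1) *\<^sub>R h)" for y
    proof -
      have "divergence (\<lambda>y::'a. (-1) *\<^sub>R h) y = 0"
      proof -
        have "DF (\<lambda>y::'a. (-1) *\<^sub>R h) y = (\<lambda>h. 0)" by (rule frechet_derivative_eqI) simp
        then show ?thesis by (simp add: divergence_def)
      qed
      moreover have "DF ?f y = DF f (y + (-1) *\<^sub>R x)"
      proof (rule frechet_derivative_eqI)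
        have "((\<lambda>y. y + (-1) *\<^sub>R x) has_derivative (\<lambda>h. h)) (at y)"
          by (auto intro!: derivative_eq_intros)
        from diff_chain_at[OF this smooth_has_derivative[OF test_maps_smooth[OF f(1)]]]
        show "(?f has_derivative DF f (y + (-1) *\<^sub>R x)) (at y)" by (simp add: o_def)
      qed
      ultimately show ?thesis
        using divergence_smooth_mult[OF test_maps_smooth[OF f'] smooth_const, of "(-1) *\<^sub>R h" y] by simp
    qed
    then have div: "divergence ?Y = (\<lambda>y. DF f (y + (-1) *\<^sub>R x) ((-1) *\<^sub>R h))"
      by (rule ext)
    have "norm (?Y y) \<le> norm h" for y using f(2) by (simp add: mult_left_le_one_le)
    from abs_set_integral_divergence_le[OF E Y this] show ?thesis unfolding div .
  qed
  have "norm (?\<Psi> z - ?\<Psi> 0) \<le> enn2real (perimeter E) * norm (z - 0)"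
  proof (rule differentiable_bound[where S = UNIV and f' = ?D])
    show "(?\<Psi> has_derivative ?D x) (at x within UNIV)" for x by (rule D)
    show "onorm (?D x) \<le> enn2real (perimeter E)" for x
      by (rule onorm_bound) (simp_all only: real_norm_def D_le enn2real_nonneg)
  qed simp_all
  moreover have "?\<Psi> 0 = set_lebesgue_integral lebesgue E f" by simp
  ultimately show ?thesis by (simp only: real_norm_def diff_zero)
qed

lemma mollify_le:
  fixes f \<eta> :: "'a::euclidean_space \<Rightarrow> real"
  assumes f: "f \<in> test_maps" and f_le: "\<And>x. f x \<le> B"
    and \<eta>: "\<eta> \<in> test_maps" "\<And>x. \<eta> x \<ge> 0" "(\<integral>x. \<eta> x \<partial>lebesgue) = 1"
  shows "(\<integral>x. f x * \<eta> (y + (-1) *\<^sub>R x) \<partial>lebesgue) \<le> B"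
proof -
  have I: "integrable lebesgue (\<lambda>x. \<eta> (y + (-1) *\<^sub>R x))"
    using test_maps_integrable[OF test_maps_affine[OF \<eta>(1), of "-1" y]] by (simp add: add.commute)
  have "(\<integral>x. f x * \<eta> (y + (-1) *\<^sub>R x) \<partial>lebesgue) \<le> (\<integral>x. B * \<eta> (y + (-1) *\<^sub>R x) \<partial>lebesgue)"
    by (intro Bochner_Integration.integral_mono convolution_integrable f \<eta>(1) mult_right_mono f_le \<eta>(2)
        integrable_mult_right I)
  also have "\<dots> = B"
    using lebesgue_integral_reflect[OF test_maps_continuous_on[OF \<eta>(1)], of y] \<eta>(3) by simp
  finally show ?thesis .
qed

text \<open>Formally \<open>A f = \<integral>\<^sub>\<Omega> f - \<Lambda> f\<close> is integration against a function of bounded variation, and the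
  coarea argument applies to that function. It is applied to the mollification
  \<open>u x = A (\<lambda>y. \<eta> (y - x))\<close> instead, which is a smooth function. By transposition, \<open>\<integral> \<nabla>u \<bullet> X\<close> is \<open>A\<close> of
  the divergence of a mollification of \<open>-X\<close>, hence at most \<open>N\<close>; and \<open>\<integral> (u - \<chi>\<^sub>\<Omega>) f\<close> is \<open>- \<Lambda>\<close> of a
  mollification of \<open>f\<close>, hence at most \<open>M\<close>, plus the error from replacing \<open>f\<close> by its mollification in
  the integral over \<open>\<Omega>\<close>, hence at most \<open>\<epsilon> Per \<Omega>\<close>.\<close>

lemma F_CE_lower_bound_of_functional:
  fixes \<Lambda> :: "('a::euclidean_space \<Rightarrow> real) \<Rightarrow> real"
  assumes \<Omega>: "\<Omega> \<in> sets lebesgue" "perimeter \<Omega> < \<infinity>" and \<Lambda>: "radon \<Lambda>"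
    and M: "\<And>g. g \<in> test_maps \<Longrightarrow> (\<And>x. \<bar>g x\<bar> \<le> 1) \<Longrightarrow> \<Lambda> g \<le> M"
    and N: "\<And>Y. Y \<in> test_maps \<Longrightarrow> (\<And>x. norm (Y x) \<le> 1) \<Longrightarrow>
      set_lebesgue_integral lebesgue \<Omega> (divergence Y) - \<Lambda> (divergence Y) \<le> N"
    and c: "\<And>E. E \<in> sets lebesgue \<Longrightarrow> c \<le> F_CE \<Omega> E"
  shows "c \<le> ennreal N + ennreal M"
proof -
  let ?\<Theta> = "\<lambda>f. set_lebesgue_integral lebesgue \<Omega> f"
  let ?A = "\<lambda>f. ?\<Theta> f - \<Lambda> f"
  note \<Theta> = radon_set_integral[OF \<Omega>(1)]
  note A = radon_diff_functional[OF \<Theta> \<Lambda>]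
  define P where "P = enn2real (perimeter \<Omega>)"
  have P0: "P \<ge> 0" by (simp add: P_def)
  have main: "c \<le> ennreal N + ennreal (M + P * \<epsilon>)" if \<epsilon>: "\<epsilon> > 0" for \<epsilon>
  proof -
    obtain \<eta> :: "'a \<Rightarrow> real" where \<eta>: "\<eta> \<in> test_maps" "\<And>x. \<eta> x \<ge> 0"
      "\<And>x. norm x \<ge> \<epsilon> \<Longrightarrow> \<eta> x = 0" "(\<integral>x. \<eta> x \<partial>lebesgue) = 1"
      using bump_exists[OF \<epsilon>] by metis
    define u where "u x = ?A (\<lambda>y. \<eta> (y + (-1) *\<^sub>R x))" for x
    have u: "smooth u" unfolding u_def by (rule radon_shift_smooth[OF A \<eta>(1)])
    have "(\<integral>\<^sup>+x. ennreal (norm (grad u x)) \<partial>lebesgue) \<le> ennreal N"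
    proof (rule nn_integral_norm_le_of_pairing)
      show "grad u \<in> borel_measurable lebesgue"
        by (rule smooth_borel_measurable_lebesgue[OF smooth_grad[OF u]])
      show "\<exists>B. \<forall>x. norm x \<le> R \<longrightarrow> norm (grad u x) \<le> B" for R
        using smooth_bounded_on_balls[OF smooth_grad[OF u]] by metis
      fix X :: "'a \<Rightarrow> 'a" assume X: "X \<in> test_maps" "\<And>x. norm (X x) \<le> 1"
      define \<zeta> where "\<zeta> b z = DF \<eta> z ((-1) *\<^sub>R b)" for b z
      have \<zeta>: "\<zeta> b \<in> test_maps" for b
        unfolding \<zeta>_def[abs_def] by (rule test_maps_directional_derivative[OF \<eta>(1)])
      have Du: "DF u x b = ?A (\<lambda>y. \<zeta> b (y + (-1) *\<^sub>R x))" for x b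
        unfolding u_def \<zeta>_def by (subst frechet_derivative_eqI[OF radon_shift_has_derivative[OF A \<eta>(1)]]) simp
      define Yb where "Yb b y = (\<integral>x. (X x \<bullet> b) * \<eta> (y + (-1) *\<^sub>R x) \<partial>lebesgue)" for b y
      have Yb: "Yb b \<in> test_maps" for b
        unfolding Yb_def[abs_def] by (rule convolution_test_map[OF test_maps_inner[OF X(1)] \<eta>(1)])
      have DYb: "DF (Yb b) y h = - (\<integral>x. (X x \<bullet> b) * \<zeta> h (y + (-1) *\<^sub>R x) \<partial>lebesgue)" for b y h
      proof -
        have lin: "linear (DF \<eta> z)" for z
          using smooth_has_derivative[OF test_maps_smooth[OF \<eta>(1)]] has_derivative_linear by blast
        have "(Yb b has_derivative (\<lambda>h. \<integral>x. (X x \<bullet> b) * DF \<eta> ((-1) *\<^sub>R x + 1 *\<^sub>R y) (1 *\<^sub>R h) \<partial>lebesgue)) (at y)"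
          using radon_shift_has_derivative[OF radon_weighted_integral[OF test_maps_inner[OF X(1), of b], of "-1"] \<eta>(1), of 1 y]
          unfolding Yb_def[abs_def] by (simp add: add.commute)
        from frechet_derivative_eqI[OF this] show ?thesis
          by (simp add: \<zeta>_def linear_neg[OF lin])
      qed
      \<comment> \<open>The mollification of \<open>X\<close>; the minus sign comes from the integration by parts.\<close>
      define Y where "Y y = (\<Sum>b\<in>Basis. (- Yb b y) *\<^sub>R b)" for y
      have Y_inner: "Y y \<bullet> b = - Yb b y" if "b \<in> Basis" for y b
        unfolding Y_def using that by (simp add: inner_sum_left inner_Basis if_distrib cong: if_cong)
      have Y: "Y \<in> test_maps"
        unfolding Y_def[abs_def]
        using test_maps_mult_smooth[OF test_maps_mult[OF Yb, of "-1"] smooth_const]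
        by (intro test_maps_sum) simp
      \<comment> \<open>The norm is estimated through \<open>|Y y|\<^sup>2 = Y y \<bullet> Y y\<close>, a combination of scalar integrals.\<close>
      have Y_le: "norm (Y y) \<le> 1" for y
      proof -
        have "(norm (Y y))\<^sup>2 = (\<Sum>b\<in>Basis. (Y y \<bullet> b) * (Y y \<bullet> b))"
          unfolding power2_norm_eq_inner by (rule euclidean_inner)
        also have "\<dots> = (\<Sum>b\<in>Basis. \<integral>x. - ((X x \<bullet> b) * (Y y \<bullet> b)) * \<eta> (y + (-1) *\<^sub>R x) \<partial>lebesgue)"
        proof (rule sum.cong)
          fix b :: 'a assume b: "b \<in> Basis"
          have "(Y y \<bullet> b) * (Y y \<bullet> b) = - (Y y \<bullet> b) * Yb b y" using Y_inner[OF b, of y] by simp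
          also have "\<dots> = (\<integral>x. - (Y y \<bullet> b) * ((X x \<bullet> b) * \<eta> (y + (-1) *\<^sub>R x)) \<partial>lebesgue)"
            unfolding Yb_def by simp
          finally show "(Y y \<bullet> b) * (Y y \<bullet> b) = (\<integral>x. - ((X x \<bullet> b) * (Y y \<bullet> b)) * \<eta> (y + (-1) *\<^sub>R x) \<partial>lebesgue)"
            by (simp add: mult_ac)
        qed simp
        also have "\<dots> = (\<integral>x. (\<Sum>b\<in>Basis. - ((X x \<bullet> b) * (Y y \<bullet> b)) * \<eta> (y + (-1) *\<^sub>R x)) \<partial>lebesgue)"
        proof (rule Bochner_Integration.integral_sum[symmetric])
          fix b :: 'a
          have "integrable lebesgue (\<lambda>x. - (Y y \<bullet> b) * ((X x \<bullet> b) * \<eta> (y + (-1) *\<^sub>R x)))"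
            by (intro integrable_mult_right convolution_integrable[OF test_maps_inner[OF X(1)] \<eta>(1)])
          then show "integrable lebesgue (\<lambda>x. - ((X x \<bullet> b) * (Y y \<bullet> b)) * \<eta> (y + (-1) *\<^sub>R x))"
            by (simp add: mult_ac)
        qed
        also have "\<dots> = (\<integral>x. (X x \<bullet> (- Y y)) * \<eta> (y + (-1) *\<^sub>R x) \<partial>lebesgue)"
          by (subst (3) euclidean_inner) (simp add: sum_distrib_right sum_negf)
        also have "\<dots> \<le> norm (Y y)"
        proof (rule mollify_le[OF test_maps_inner[OF X(1)] _ \<eta>(1,2,4)])
          fix x
          have "X x \<bullet> (- Y y) \<le> norm (X x) * norm (- Y y)" by (rule norm_cauchy_schwarz)
          also have "\<dots> \<le> 1 * norm (- Y y)" by (intro mult_right_mono X(2)) simp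
          finally show "X x \<bullet> (- Y y) \<le> norm (Y y)" by simp
        qed
        finally have "norm (Y y) * norm (Y y) \<le> 1 * norm (Y y)" by (simp add: power2_eq_square)
        then show ?thesis by (cases "norm (Y y) = 0") (auto simp: mult_le_cancel_right)
      qed
      have divY: "divergence Y y = (\<Sum>b\<in>Basis. 1 * (\<integral>x. (X x \<bullet> b) * \<zeta> b (y + (-1) *\<^sub>R x) \<partial>lebesgue))" for y
      proof -
        have "DF (\<lambda>x. Y x \<bullet> b) y b = (\<integral>x. (X x \<bullet> b) * \<zeta> b (y + (-1) *\<^sub>R x) \<partial>lebesgue)" if b: "b \<in> Basis" for b
        proof -
          have "((\<lambda>x. - Yb b x) has_derivative (\<lambda>h. - DF (Yb b) y h)) (at y)"
            by (intro has_derivative_minus smooth_has_derivative test_maps_smooth Yb)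
          from frechet_derivative_eqI[OF this] show ?thesis
            by (simp add: Y_inner[OF b] DYb)
        qed
        then show ?thesis unfolding divergence_componentwise[OF test_maps_smooth[OF Y]] by simp
      qed
      have "grad u x \<bullet> X x = (\<Sum>b\<in>Basis. (X x \<bullet> b) * ?A (\<lambda>y. \<zeta> b (y + (-1) *\<^sub>R x)))" for x
        unfolding grad_inner[OF u]
        by (subst euclidean_derivative_sum[OF smooth_differentiable[OF u]]) (simp only: Du real_scaleR_def)
      then have "(\<integral>x. grad u x \<bullet> X x \<partial>lebesgue) = (\<integral>x. (\<Sum>b\<in>Basis. (X x \<bullet> b) * ?A (\<lambda>y. \<zeta> b (y + (-1) *\<^sub>R x))) \<partial>lebesgue)"
        by (simp only:)
      also have "\<dots> = (\<Sum>b\<in>Basis. \<integral>x. (X x \<bullet> b) * ?A (\<lambda>y. \<zeta> b (y + (-1) *\<^sub>R x)) \<partial>lebesgue)"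
      proof (rule Bochner_Integration.integral_sum)
        fix b :: 'a
        have "smooth (\<lambda>x. ?A (\<lambda>y. \<zeta> b (y + (-1) *\<^sub>R x)))"
          by (rule radon_shift_smooth[OF A \<zeta>])
        from test_maps_integrable[OF test_maps_mult_smooth[OF test_maps_inner[OF X(1)] this]]
        show "integrable lebesgue (\<lambda>x. (X x \<bullet> b) * ?A (\<lambda>y. \<zeta> b (y + (-1) *\<^sub>R x)))"
          by (simp only: real_scaleR_def)
      qed
      also have "\<dots> = (\<Sum>b\<in>Basis. 1 * ?A (\<lambda>y. \<integral>x. (X x \<bullet> b) * \<zeta> b (y + (-1) *\<^sub>R x) \<partial>lebesgue))"
        by (simp only: mult_1 radon_integral_swap[OF A test_maps_inner[OF X(1)] \<zeta>])
      also have "\<dots> = ?A (divergence Y)"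
        unfolding divY[abs_def]
        by (rule radon_sum[OF A, symmetric]) (rule convolution_test_map[OF test_maps_inner[OF X(1)] \<zeta>])
      also have "\<dots> \<le> N" by (rule N[OF Y Y_le])
      finally show "(\<integral>x. grad u x \<bullet> X x \<partial>lebesgue) \<le> N" .
    qed
    moreover have "(\<integral>\<^sup>+x. ennreal \<bar>u x - indicator \<Omega> x\<bar> \<partial>lebesgue) \<le> ennreal (M + P * \<epsilon>)"
    proof -
      have "(\<integral>\<^sup>+x. ennreal (norm (u x - indicator \<Omega> x)) \<partial>lebesgue) \<le> ennreal (M + P * \<epsilon>)"
      proof (rule nn_integral_norm_le_of_pairing)
        show "(\<lambda>x. u x - indicator \<Omega> x) \<in> borel_measurable lebesgue"
          using smooth_borel_measurable_lebesgue[OF u] \<Omega>(1) by measurable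
        show "\<exists>B. \<forall>x. norm x \<le> R \<longrightarrow> norm (u x - indicator \<Omega> x) \<le> B" for R
        proof -
          obtain B where B: "\<And>x. norm x \<le> R \<Longrightarrow> norm (u x) \<le> B"
            using smooth_bounded_on_balls[OF u] by metis
          have "norm (u x - indicator \<Omega> x) \<le> B + 1" if "norm x \<le> R" for x
            using B[OF that] norm_triangle_ineq4[of "u x" "indicator \<Omega> x"]
            by (auto simp: indicator_def split: if_splits)
          then show ?thesis by blast
        qed
        fix f :: "'a \<Rightarrow> real" assume f: "f \<in> test_maps" "\<And>x. norm (f x) \<le> 1"
        have f1: "f x \<le> 1" "- f x \<le> 1" "\<bar>f x\<bar> \<le> 1" for x using f(2)[of x] by auto
        define F where "F y = (\<integral>x. f x * \<eta> (y + (-1) *\<^sub>R x) \<partial>lebesgue)" for y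
        have F: "F \<in> test_maps" unfolding F_def[abs_def] by (rule convolution_test_map[OF f(1) \<eta>(1)])
        have "F y \<le> 1" for y unfolding F_def by (rule mollify_le[OF f(1) f1(1) \<eta>(1,2,4)])
        moreover have "- F y \<le> 1" for y
          using mollify_le[OF test_maps_mult[OF f(1), of "-1"] _ \<eta>(1,2,4), of 1 y] f1(2)
          unfolding F_def by simp
        ultimately have "\<bar>(-1) * F y\<bar> \<le> 1" for y by (simp add: abs_le_iff)
        then have "\<Lambda> (\<lambda>y. (-1) * F y) \<le> M" by (intro M test_maps_mult F)
        then have \<Lambda>F: "- \<Lambda> F \<le> M" using radon_mult[OF \<Lambda> F, of "-1"] by simp
        \<comment> \<open>In this form the mollification averages translates of \<open>f\<close>, so that the swap applies with \<open>\<eta>\<close> as the weight.\<close>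
        have F': "F y = (\<integral>z. \<eta> z * f (y + (-1) *\<^sub>R z) \<partial>lebesgue)" for y
        proof -
          have "continuous_on UNIV (\<lambda>x. f x * \<eta> (y + (-1) *\<^sub>R x))"
            by (intro continuous_intros test_maps_continuous_on f(1)
              continuous_on_compose2[OF test_maps_continuous_on[OF \<eta>(1), of UNIV]]) auto
          from lebesgue_integral_reflect[OF this, of y] show ?thesis
            unfolding F_def by (simp add: mult.commute)
        qed
        have \<Theta>F: "?\<Theta> F - ?\<Theta> f \<le> P * \<epsilon>"
        proof -
          have "smooth (\<lambda>z. ?\<Theta> (\<lambda>y. f (y + (-1) *\<^sub>R z)))"
            by (rule radon_shift_smooth[OF \<Theta> f(1)])
          from test_maps_integrable[OF test_maps_mult_smooth[OF \<eta>(1) this]]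
          have I: "integrable lebesgue (\<lambda>z. \<eta> z * ?\<Theta> (\<lambda>y. f (y + (-1) *\<^sub>R z)))"
            by (simp only: real_scaleR_def)
          have I': "integrable lebesgue (\<lambda>z. \<eta> z * a)" for a
            using test_maps_integrable[OF \<eta>(1)] by (rule integrable_mult_left)
          have "?\<Theta> F - ?\<Theta> f = (\<integral>z. \<eta> z * ?\<Theta> (\<lambda>y. f (y + (-1) *\<^sub>R z)) \<partial>lebesgue) - (\<integral>z. \<eta> z * ?\<Theta> f \<partial>lebesgue)"
          proof -
            have "F = (\<lambda>y. \<integral>z. \<eta> z * f (y + (-1) *\<^sub>R z) \<partial>lebesgue)" by (rule ext) (rule F')
            then have "?\<Theta> F = (\<integral>z. \<eta> z * ?\<Theta> (\<lambda>y. f (y + (-1) *\<^sub>R z)) \<partial>lebesgue)"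
              by (simp only: radon_integral_swap[OF \<Theta> \<eta>(1) f(1)])
            moreover have "(\<integral>z. \<eta> z * ?\<Theta> f \<partial>lebesgue) = ?\<Theta> f"
              unfolding integral_mult_left_zero \<eta>(4) by simp
            ultimately show ?thesis by (simp only:)
          qed
          also have "\<dots> = (\<integral>z. \<eta> z * (?\<Theta> (\<lambda>y. f (y + (-1) *\<^sub>R z)) - ?\<Theta> f) \<partial>lebesgue)"
            using Bochner_Integration.integral_diff[OF I I'[of "?\<Theta> f"]] by (simp only: right_diff_distrib)
          also have "\<dots> \<le> (\<integral>z. \<eta> z * (P * \<epsilon>) \<partial>lebesgue)"
          proof (rule Bochner_Integration.integral_mono[OF _ I'])
            show "integrable lebesgue (\<lambda>z. \<eta> z * (?\<Theta> (\<lambda>y. f (y + (-1) *\<^sub>R z)) - ?\<Theta> f))"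
              using Bochner_Integration.integrable_diff[OF I I'[of "?\<Theta> f"]] by (simp only: right_diff_distrib)
            fix z
            show "\<eta> z * (?\<Theta> (\<lambda>y. f (y + (-1) *\<^sub>R z)) - ?\<Theta> f) \<le> \<eta> z * (P * \<epsilon>)"
            proof (cases "norm z \<ge> \<epsilon>")
              case False
              have "?\<Theta> (\<lambda>y. f (y + (-1) *\<^sub>R z)) - ?\<Theta> f \<le> P * norm z"
                using set_integral_translate_le[OF \<Omega> f(1) f1(3), of z] unfolding P_def by linarith
              also have "\<dots> \<le> P * \<epsilon>" using False P0 by (intro mult_left_mono) auto
              finally show ?thesis using \<eta>(2) by (intro mult_left_mono)
            qed (simp add: \<eta>(3))
          qed
          also have "\<dots> = P * \<epsilon>" using \<eta>(4) by simp
          finally show ?thesis .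
        qed
        have "integrable lebesgue (\<lambda>x. f x * u x)"
          using test_maps_integrable[OF test_maps_mult_smooth[OF f(1) u]] by simp
        moreover have "integrable lebesgue (\<lambda>x. indicator \<Omega> x * f x)"
          using test_maps_set_integrable[OF f(1) \<Omega>(1)] by (simp add: set_integrable_def)
        ultimately have "(\<integral>x. (u x - indicator \<Omega> x) \<bullet> f x \<partial>lebesgue) = (\<integral>x. f x * u x \<partial>lebesgue) - ?\<Theta> f"
          by (simp add: set_lebesgue_integral_def left_diff_distrib mult.commute[of "u _"])
        also have "(\<integral>x. f x * u x \<partial>lebesgue) = ?A F"
          unfolding u_def F_def[abs_def] by (rule radon_integral_swap[OF A f(1) \<eta>(1), symmetric])
        finally show "(\<integral>x. (u x - indicator \<Omega> x) \<bullet> f x \<partial>lebesgue) \<le> M + P * \<epsilon>"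
          using \<Lambda>F \<Theta>F by linarith
      qed
      then show ?thesis by simp
    qed
    ultimately show ?thesis using F_CE_lower_bound_of_smooth_function[OF \<Omega>(1) u, of c] c by blast
  qed
  have M0: "M \<ge> 0" using M[OF zero_test_map] radon_zero[OF \<Lambda>] by simp
  show ?thesis
  proof (rule ennreal_le_epsilon)
    fix e :: real assume e: "0 < e"
    have pos: "e / (P + 1) > 0" using P0 e by simp
    have "P * (e / (P + 1)) \<le> e" using P0 e by (simp add: pos_divide_le_eq mult.commute mult_left_mono)
    then have "ennreal N + ennreal (M + P * (e / (P + 1))) \<le> ennreal N + ennreal (M + e)"
      by (intro add_left_mono ennreal_leI) simp
    also have "\<dots> = ennreal N + ennreal M + ennreal e" using M0 e by (simp add: ennreal_plus add.assoc)
    finally show "c \<le> ennreal N + ennreal M + ennreal e" using main[OF pos] by (rule order_trans[rotated])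
  qed
qed

section \<open>Covectors\<close>

lemma covector_cong:
  assumes "covector k \<omega>" "\<And>i. i < k \<Longrightarrow> v i = w i" shows "\<omega> v = \<omega> w"
  using assms unfolding covector_def by blast

lemma covector_linear:
  assumes "covector k \<omega>" "i < k" shows "linear (\<lambda>u. \<omega> (v(i := u)))"
  using assms unfolding covector_def by blast

lemma covector_alternating:
  assumes "covector k \<omega>" "i < k" "j < k" "i \<noteq> j" "v i = v j" shows "\<omega> v = 0"
  using assms unfolding covector_def by blast

lemma covector_swap:
  assumes \<omega>: "covector k \<omega>" and ab: "a < k" "b < k" "a \<noteq> b"
  shows "\<omega> (v(a := v b, b := v a)) = - \<omega> v"
proof -
  \<comment> \<open>Polarisation: expand the value at equal entries \<open>v a + v b\<close>, which is zero.\<close>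
  have add_a: "\<omega> (v(a := x + y, b := z)) = \<omega> (v(a := x, b := z)) + \<omega> (v(a := y, b := z))" for x y z
    using linear_add[OF covector_linear[OF \<omega> ab(1), of "v(b := z)"], of x y]
    by (simp add: fun_upd_twist[OF ab(3)])
  have add_b: "\<omega> (v(a := z, b := x + y)) = \<omega> (v(a := z, b := x)) + \<omega> (v(a := z, b := y))" for x y z
    using linear_add[OF covector_linear[OF \<omega> ab(2), of "v(a := z)"], of x y] by simp
  have zero: "\<omega> (v(a := x, b := x)) = 0" for x
    by (rule covector_alternating[OF \<omega> ab]) (use ab in simp)
  have "\<omega> (v(a := v a + v b, b := v a + v b)) = 0" by (rule zero)
  then have "\<omega> (v(a := v a, b := v b)) + \<omega> (v(a := v b, b := v a)) = 0"
    unfolding add_a add_b unfolding zero by simp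
  then show ?thesis by simp
qed

lemma abs_covector_permute:
  assumes \<omega>: "covector k \<omega>" and \<pi>: "\<pi> permutes {..<k}"
  shows "\<bar>\<omega> (v \<circ> \<pi>)\<bar> = \<bar>\<omega> v\<bar>"
  using \<pi> finite_lessThan
proof (induction arbitrary: v rule: permutes_induct)
  case id then show ?case by simp
next
  case (swap a b p)
  have "v \<circ> (Transposition.transpose a b \<circ> p) = (v(a := v b, b := v a)) \<circ> p"
    by (auto simp: Transposition.transpose_def fun_eq_iff)
  then have "\<bar>\<omega> (v \<circ> (Transposition.transpose a b \<circ> p))\<bar> = \<bar>\<omega> (v(a := v b, b := v a))\<bar>"
    by (simp only: swap.IH)
  also have "\<dots> = \<bar>\<omega> v\<bar>"
  proof (cases "a = b")
    case False
    then show ?thesis using covector_swap[OF \<omega>, of a b v] swap.hyps by simp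
  qed simp
  finally show ?case .
qed

lemma abs_covector_eq_of_same_image:
  assumes \<omega>: "covector k \<omega>" and v: "inj_on v {..<k}" and w: "inj_on w {..<k}"
    and eq: "v ` {..<k} = w ` {..<k}"
  shows "\<bar>\<omega> v\<bar> = \<bar>\<omega> w\<bar>"
proof -
  define \<pi> where "\<pi> i = (if i < k then inv_into {..<k} w (v i) else i)" for i
  have "bij_betw v {..<k} (w ` {..<k})" using v eq by (simp add: bij_betw_def)
  moreover have "bij_betw (inv_into {..<k} w) (w ` {..<k}) {..<k}"
    using w by (intro bij_betw_inv_into) (simp add: bij_betw_def)
  ultimately have "bij_betw (inv_into {..<k} w \<circ> v) {..<k} {..<k}" by (rule bij_betw_trans)
  then have "bij_betw \<pi> {..<k} {..<k}"
    by (rule bij_betw_cong[THEN iffD1, rotated]) (simp add: \<pi>_def)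
  then have "\<pi> permutes {..<k}" by (rule bij_imp_permutes) (simp add: \<pi>_def)
  then have "\<bar>\<omega> (w \<circ> \<pi>)\<bar> = \<bar>\<omega> w\<bar>" by (rule abs_covector_permute[OF \<omega>])
  moreover have "\<omega> (w \<circ> \<pi>) = \<omega> v"
  proof (rule covector_cong[OF \<omega>])
    fix i assume "i < k"
    then have "v i \<in> w ` {..<k}" using eq by blast
    then show "(w \<circ> \<pi>) i = v i" using \<open>i < k\<close> by (simp add: \<pi>_def f_inv_into_f)
  qed
  ultimately show ?thesis by simp
qed

text \<open>A covector is determined by its values on the coordinate vectors; the other entries are
  expanded one position at a time.\<close>

lemma covector_eq_0I:
  fixes \<omega> :: "(nat \<Rightarrow> 'a::euclidean_space) \<Rightarrow> real"
  assumes \<omega>: "covector k \<omega>"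
    and basis: "\<And>v. (\<And>i. i < k \<Longrightarrow> v i \<in> Basis) \<Longrightarrow> inj_on v {..<k} \<Longrightarrow> \<omega> v = 0"
  shows "\<omega> v = 0"
proof -
  have "\<omega> v = 0" if "j \<le> k" "\<And>i. i < k \<Longrightarrow> j \<le> i \<Longrightarrow> v i \<in> Basis" for j v
    using that
  proof (induction j arbitrary: v)
    case 0
    show ?case
    proof (cases "inj_on v {..<k}")
      case True then show ?thesis using 0 basis by simp
    next
      case False
      then obtain a b where "a < k" "b < k" "a \<noteq> b" "v a = v b" unfolding inj_on_def by auto
      then show ?thesis using covector_alternating[OF \<omega>] by blast
    qed
  next
    case (Suc j)
    have lin: "linear (\<lambda>u. \<omega> (v(j := u)))" by (rule covector_linear[OF \<omega>]) (use Suc.prems in simp)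
    have "\<omega> (v(j := b)) = 0" if "b \<in> Basis" for b
    proof (rule Suc.IH)
      show "(v(j := b)) i \<in> Basis" if "i < k" "j \<le> i" for i
        using Suc.prems(2)[of i] that \<open>b \<in> Basis\<close> by (cases "i = j") auto
    qed (use Suc.prems in simp)
    then have "(\<Sum>b\<in>Basis. \<omega> (v(j := (v j \<bullet> b) *\<^sub>R b))) = 0"
      using linear_scale[OF lin] by simp
    then have "\<omega> (v(j := (\<Sum>b\<in>Basis. (v j \<bullet> b) *\<^sub>R b))) = 0"
      by (simp add: linear_sum[OF lin])
    then show ?case by (simp add: euclidean_representation)
  qed
  from this[of k v] show ?thesis by simp
qed

lemma covector_diff:
  assumes \<omega>: "covector k \<omega>" and \<psi>: "covector k \<psi>"
  shows "covector k (\<lambda>v. \<omega> v - \<psi> v)"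
  unfolding covector_def
proof (intro conjI allI impI)
  show "\<omega> v - \<psi> v = \<omega> w - \<psi> w" if "\<forall>i<k. v i = w i" for v w
    using covector_cong[OF \<omega>, of v w] covector_cong[OF \<psi>, of v w] that by simp
  show "linear (\<lambda>u. \<omega> (v(i := u)) - \<psi> (v(i := u)))" if "i < k" for v i
    by (intro linear_compose_sub covector_linear[OF \<omega>] covector_linear[OF \<psi>] that)
  show "\<omega> v - \<psi> v = 0" if "i < k" "j < k" "i \<noteq> j \<and> v i = v j" for v i j
    using covector_alternating[OF \<omega>, of i j v] covector_alternating[OF \<psi>, of i j v] that by simp
qed

lemma covector_mult:
  assumes \<omega>: "covector k \<omega>" shows "covector k (\<lambda>v. c * \<omega> v)"
  unfolding covector_def
proof (intro conjI allI impI)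
  show "c * \<omega> v = c * \<omega> w" if "\<forall>i<k. v i = w i" for v w
    using covector_cong[OF \<omega>, of v w] that by simp
  show "linear (\<lambda>u. c * \<omega> (v(i := u)))" if "i < k" for v i
    using linear_compose_scale_right[OF covector_linear[OF \<omega> that], of c] by simp
  show "c * \<omega> v = 0" if "i < k" "j < k" "i \<noteq> j \<and> v i = v j" for v i j
    using covector_alternating[OF \<omega>, of i j v] that by simp
qed

lemma case_nat_fun_upd: "case_nat z (w(i := u)) = (case_nat z w)(Suc i := u)"
  by (auto simp: fun_eq_iff split: nat.splits)

lemma fun_upd_0_case_nat: "(case_nat y w)(0 := z) = case_nat z w"
  by (auto simp: fun_eq_iff split: nat.splits)

lemma covector_contract:
  assumes \<omega>: "covector (Suc k) \<omega>" shows "covector k (\<lambda>w. \<omega> (case_nat z w))"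
  unfolding covector_def
proof (intro conjI allI impI)
  show "\<omega> (case_nat z v) = \<omega> (case_nat z w)" if "\<forall>i<k. v i = w i" for v w
    by (rule covector_cong[OF \<omega>]) (use that in \<open>auto split: nat.splits\<close>)
  show "linear (\<lambda>u. \<omega> (case_nat z (v(i := u))))" if "i < k" for v i
    unfolding case_nat_fun_upd by (rule covector_linear[OF \<omega>]) (use that in simp)
  show "\<omega> (case_nat z v) = 0" if "i < k" "j < k" "i \<noteq> j \<and> v i = v j" for v i j
    by (rule covector_alternating[OF \<omega>, of "Suc i" "Suc j"]) (use that in auto)
qed

lemma covector_linear_first:
  assumes "covector (Suc k) \<omega>" shows "linear (\<lambda>z. \<omega> (case_nat z w))"
  using covector_linear[OF assms, of 0 "case_nat undefined w"] by (simp add: fun_upd_0_case_nat)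

definition drop_nth :: "nat \<Rightarrow> (nat \<Rightarrow> 'a) \<Rightarrow> nat \<Rightarrow> 'a" where
  "drop_nth i v = (\<lambda>j. if j < i then v j else v (Suc j))"

text \<open>Moving the entry at position \<open>i\<close> to the front costs \<open>i\<close> transpositions. This is the sign in the
  exterior derivative.\<close>

lemma covector_move_to_front:
  assumes \<omega>: "covector k \<omega>" and "i < k"
  shows "\<omega> (case_nat (v i) (drop_nth i v)) = (-1) ^ i * \<omega> v"
  using assms(2)
proof (induction i arbitrary: v)
  case 0
  have "case_nat (v 0) (drop_nth 0 v) = v" by (auto simp: drop_nth_def fun_eq_iff split: nat.splits)
  then show ?case by simp
next
  case (Suc i)
  let ?v = "v(i := v (Suc i), Suc i := v i)"
  have "case_nat (v (Suc i)) (drop_nth (Suc i) v) = case_nat (?v i) (drop_nth i ?v)"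
    by (auto simp: drop_nth_def fun_eq_iff less_Suc_eq split: nat.splits)
  then have "\<omega> (case_nat (v (Suc i)) (drop_nth (Suc i) v)) = (-1) ^ i * \<omega> ?v"
    using Suc.IH[of ?v] Suc_lessD[OF Suc.prems] by (simp only:)
  then show ?case using covector_swap[OF \<omega>, of i "Suc i" v] Suc.prems by simp
qed

section \<open>The volume form\<close>

definition coord_rank :: "'m::{finite, linorder} \<Rightarrow> nat" where
  "coord_rank = inv_into {..<CARD('m)} ((!) (sorted_list_of_set UNIV))"

lemma bij_betw_sorted_list: "bij_betw ((!) (sorted_list_of_set (UNIV :: 'm::{finite, linorder} set))) {..<CARD('m)} UNIV"
  by (rule bij_betw_nth) simp_all

lemma coord_rank_less: "coord_rank (i :: 'm::{finite, linorder}) < CARD('m)"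
  using bij_betw_apply[OF bij_betw_inv_into[OF bij_betw_sorted_list], of i] by (simp add: coord_rank_def)

lemma nth_coord_rank: "sorted_list_of_set UNIV ! coord_rank i = (i :: 'm::{finite, linorder})"
  unfolding coord_rank_def using bij_betw_inv_into_right[OF bij_betw_sorted_list, of i] by simp

lemma coord_rank_nth: "j < CARD('m) \<Longrightarrow> coord_rank (sorted_list_of_set (UNIV :: 'm::{finite, linorder} set) ! j) = j"
  unfolding coord_rank_def using bij_betw_inv_into_left[OF bij_betw_sorted_list, of j] by simp

lemma std_frame_coord_rank: "std_frame (coord_rank i) = axis i 1"
  by (simp add: std_frame_def nth_coord_rank)

lemma bij_betw_std_frame:
  "bij_betw (std_frame :: nat \<Rightarrow> real ^ 'm::{finite, linorder}) {..<CARD('m)} Basis"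
proof -
  have "bij_betw (\<lambda>i :: 'm. axis i (1::real)) UNIV Basis"
    unfolding bij_betw_def by (auto simp: inj_on_def axis_eq_axis Basis_vec_def)
  from bij_betw_trans[OF bij_betw_sorted_list this] show ?thesis
    by (simp add: std_frame_def[abs_def] o_def)
qed

lemma std_frame_Basis: "j < CARD('m) \<Longrightarrow> (std_frame j :: real ^ 'm::{finite, linorder}) \<in> Basis"
  using bij_betw_std_frame bij_betw_apply by fastforce

lemma inj_on_std_frame: "inj_on (std_frame :: nat \<Rightarrow> real ^ 'm::{finite, linorder}) {..<CARD('m)}"
  using bij_betw_std_frame by (rule bij_betw_imp_inj_on)

lemma std_frame_inner:
  assumes "i < CARD('m)" "j < CARD('m)"
  shows "(std_frame i :: real ^ 'm::{finite, linorder}) \<bullet> std_frame j = (if i = j then 1 else 0)"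
  using inner_Basis[OF std_frame_Basis[OF assms(1)] std_frame_Basis[OF assms(2)]]
    inj_onD[OF inj_on_std_frame, of i j] assms by auto

text \<open>The volume form. The coordinates are indexed by a linearly ordered type, whereas a covector
  takes its arguments from a sequence; \<open>coord_rank\<close> translates between the two.\<close>

definition vol :: "(nat \<Rightarrow> real ^ 'm::{finite, linorder}) \<Rightarrow> real" where
  "vol v = det (\<chi> i. v (coord_rank i))"

lemma covector_vol: "covector CARD('m) (vol :: (nat \<Rightarrow> real ^ 'm::{finite, linorder}) \<Rightarrow> real)"
  unfolding covector_def
proof (intro conjI allI impI)
  show "vol v = vol w" if "\<forall>i<CARD('m). v i = w i" for v w :: "nat \<Rightarrow> (real, 'm) vec"
    using that by (simp add: vol_def coord_rank_less)
next
  fix v :: "nat \<Rightarrow> (real, 'm) vec" and j assume j: "j < CARD('m)"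
  let ?k = "sorted_list_of_set (UNIV :: 'm set) ! j"
  have "coord_rank i = j \<longleftrightarrow> i = ?k" for i using coord_rank_nth[OF j] nth_coord_rank by metis
  then have eq: "vol (v(j := u)) = det (\<chi> i. if i = ?k then u else v (coord_rank i))" for u
    unfolding vol_def by (simp add: fun_upd_def)
  show "linear (\<lambda>u. vol (v(j := u)))"
  proof (rule linearI)
    show "vol (v(j := x + y)) = vol (v(j := x)) + vol (v(j := y))" for x y
      unfolding eq by (rule det_row_add)
    show "vol (v(j := c *\<^sub>R x)) = c *\<^sub>R vol (v(j := x))" for c x
    proof -
      have s: "c *\<^sub>R x = c *s x" by (simp add: vec_eq_iff)
      show ?thesis unfolding eq s real_scaleR_def by (rule det_row_mul)
    qed
  qed
next
  fix v :: "nat \<Rightarrow> (real, 'm) vec" and i j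
  assume *: "i < CARD('m)" "j < CARD('m)" "i \<noteq> j \<and> v i = v j"
  let ?e = "\<lambda>j. sorted_list_of_set (UNIV :: 'm set) ! j"
  show "vol v = 0"
    unfolding vol_def
  proof (rule det_identical_rows)
    show "?e i \<noteq> ?e j" using coord_rank_nth[OF *(1)] coord_rank_nth[OF *(2)] * by metis
    show "row (?e i) (\<chi> i. v (coord_rank i)) = row (?e j) (\<chi> i. v (coord_rank i))"
      using * by (simp add: row_def coord_rank_nth vec_eq_iff)
  qed
qed

lemma vol_std_frame: "vol (std_frame :: nat \<Rightarrow> real ^ 'm::{finite, linorder}) = 1"
proof -
  have "(\<chi> i. std_frame (coord_rank i)) = (mat 1 :: ((real, 'm) vec, 'm) vec)"
    by (auto simp: std_frame_coord_rank mat_def axis_def vec_eq_iff)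
  then show ?thesis by (simp add: vol_def)
qed

lemma abs_vol_orthonormal:
  fixes v :: "nat \<Rightarrow> real ^ 'm::{finite, linorder}"
  assumes "\<And>i j. i < CARD('m) \<Longrightarrow> j < CARD('m) \<Longrightarrow> v i \<bullet> v j = (if i = j then 1 else 0)"
  shows "\<bar>vol v\<bar> = 1"
proof -
  have "coord_rank i \<noteq> coord_rank j" if "i \<noteq> j" for i j :: 'm using nth_coord_rank that by metis
  then have "orthogonal_matrix (\<chi> i::'m. v (coord_rank i))"
    unfolding orthogonal_matrix_orthonormal_rows using assms
    by (simp add: row_def orthogonal_def norm_eq_1 coord_rank_less)
  from det_orthogonal_matrix[OF this] show ?thesis unfolding vol_def by auto
qed

lemma top_covector_eq:
  fixes \<omega> :: "(nat \<Rightarrow> real ^ 'm::{finite, linorder}) \<Rightarrow> real"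
  assumes \<omega>: "covector CARD('m) \<omega>" shows "\<omega> v = \<omega> std_frame * vol v"
proof -
  let ?\<psi> = "\<lambda>v. \<omega> v - \<omega> std_frame * vol v"
  have \<psi>: "covector CARD('m) ?\<psi>" by (intro covector_diff \<omega> covector_mult covector_vol)
  have "?\<psi> v = 0"
  proof (rule covector_eq_0I[OF \<psi>])
    fix v :: "nat \<Rightarrow> (real, 'm) vec"
    assume v: "\<And>i. i < CARD('m) \<Longrightarrow> v i \<in> Basis" "inj_on v {..<CARD('m)}"
    have "v ` {..<CARD('m)} = Basis"
      by (rule card_subset_eq) (use v in \<open>auto simp: card_image\<close>)
    also have "Basis = (std_frame :: nat \<Rightarrow> (real, 'm) vec) ` {..<CARD('m)}" by (rule bij_betw_imp_surj_on[OF bij_betw_std_frame, symmetric])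
    finally have "\<bar>?\<psi> v\<bar> = \<bar>?\<psi> std_frame\<bar>" by (rule abs_covector_eq_of_same_image[OF \<psi> v(2) inj_on_std_frame])
    then show "?\<psi> v = 0" by (simp add: vol_std_frame)
  qed
  then show ?thesis by simp
qed

text \<open>For \<open>\<omega>\<close> of codimension one, the vector whose contraction with the volume form is \<open>\<omega>\<close>, that is,
  the Hodge dual of \<open>\<omega>\<close> up to sign.\<close>

definition hodge :: "nat \<Rightarrow> ((nat \<Rightarrow> real ^ 'm::{finite, linorder}) \<Rightarrow> real) \<Rightarrow> real ^ 'm::{finite, linorder}" where
  "hodge n \<omega> = (\<Sum>i\<le>n. ((-1) ^ i * \<omega> (drop_nth i std_frame)) *\<^sub>R std_frame i)"

text \<open>Up to order, a sequence of \<open>n\<close> distinct coordinate vectors omits exactly one of them, say the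
  one at position \<open>i\<close>. There the two sides agree because all summands of \<open>hodge\<close> but the one for \<open>i\<close>
  repeat a vector.\<close>

lemma codim_one_covector_eq:
  fixes \<omega> :: "(nat \<Rightarrow> real ^ 'm::{finite, linorder}) \<Rightarrow> real"
  assumes n: "Suc n = CARD('m)" and \<omega>: "covector n \<omega>"
  shows "\<omega> w = vol (case_nat (hodge n \<omega>) w)"
proof -
  have vol: "covector (Suc n) (vol :: (nat \<Rightarrow> (real, 'm) vec) \<Rightarrow> real)" unfolding n by (rule covector_vol)
  let ?\<psi> = "\<lambda>w. \<omega> w - vol (case_nat (hodge n \<omega>) w)"
  have \<psi>: "covector n ?\<psi>" by (intro covector_diff \<omega> covector_contract vol)
  let ?e = "std_frame :: nat \<Rightarrow> (real, 'm) vec"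
  have inj: "inj_on ?e {..<Suc n}" using inj_on_std_frame n by simp
  have "?\<psi> w = 0"
  proof (rule covector_eq_0I[OF \<psi>])
    fix w :: "nat \<Rightarrow> (real, 'm) vec"
    assume w: "\<And>i. i < n \<Longrightarrow> w i \<in> Basis" "inj_on w {..<n}"
    have img: "?e ` {..<Suc n} = Basis" using bij_betw_std_frame n by (auto simp: bij_betw_def)
    have card: "card (w ` {..<n}) = n" using w(2) by (simp add: card_image)
    moreover have "card (Basis :: ((real, 'm) vec) set) = Suc n" using n by simp
    ultimately have "w ` {..<n} \<noteq> Basis" by (metis n_not_Suc_n)
    then obtain b where b: "b \<in> Basis" "b \<notin> w ` {..<n}" using w(1) by blast
    then obtain i where i: "i < Suc n" "b = ?e i" using img by (metis imageE lessThan_iff)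
    have "w ` {..<n} = Basis - {b}"
      by (rule card_subset_eq) (use w b card n in auto)
    also have "\<dots> = drop_nth i ?e ` {..<n}"
    proof -
      have "Basis - {b} = ?e ` ({..<Suc n} - {i})"
        unfolding img[symmetric] i(2) using i(1) inj by (auto simp: inj_on_def)
      also have "{..<Suc n} - {i} = (\<lambda>j. if j < i then j else Suc j) ` {..<n}"
      proof (intro set_eqI iffI)
        fix j assume "j \<in> {..<Suc n} - {i}"
        then show "j \<in> (\<lambda>j. if j < i then j else Suc j) ` {..<n}"
          using i(1) by (intro image_eqI[of _ _ "if j < i then j else j - 1"]) auto
      qed (use i(1) in \<open>auto split: if_splits\<close>)
      also have "?e ` ((\<lambda>j. if j < i then j else Suc j) ` {..<n}) = drop_nth i ?e ` {..<n}"
        unfolding image_image drop_nth_def by (intro image_cong) auto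
      finally show ?thesis .
    qed
    finally have eq: "w ` {..<n} = drop_nth i ?e ` {..<n}" .
    have "inj_on (drop_nth i ?e) {..<n}"
      by (rule inj_onI) (use i(1) in \<open>auto simp: drop_nth_def split: if_splits dest!: inj_onD[OF inj]\<close>)
    from abs_covector_eq_of_same_image[OF \<psi> w(2) this eq]
    have "\<bar>?\<psi> w\<bar> = \<bar>?\<psi> (drop_nth i ?e)\<bar>" .
    moreover have "vol (case_nat (hodge n \<omega>) (drop_nth i ?e)) = \<omega> (drop_nth i ?e)"
    proof -
      note lin = covector_linear_first[OF vol, of "drop_nth i ?e"]
      have basis_value: "vol (case_nat (?e j) (drop_nth i ?e)) = (if j = i then (-1) ^ i else 0)" if "j \<le> n" for j
      proof (cases "j = i")
        case True
        then show ?thesis using covector_move_to_front[OF vol i(1), of ?e] by (simp add: vol_std_frame)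
      next
        case False
        let ?l = "if j < i then j else j - 1"
        have "drop_nth i ?e ?l = ?e j" "?l < n" using False that i(1) by (auto simp: drop_nth_def)
        then have "vol (case_nat (?e j) (drop_nth i ?e)) = 0"
          by (intro covector_alternating[OF vol, of 0 "Suc ?l"]) auto
        then show ?thesis using False by simp
      qed
      have "vol (case_nat (hodge n \<omega>) (drop_nth i ?e))
          = (\<Sum>j\<le>n. ((-1) ^ j * \<omega> (drop_nth j ?e)) * vol (case_nat (?e j) (drop_nth i ?e)))"
        unfolding hodge_def linear_sum[OF lin] linear_scale[OF lin] by simp
      also have "\<dots> = (\<Sum>j\<le>n. if j = i then ((-1) ^ j * (-1) ^ j) * \<omega> (drop_nth j ?e) else 0)"
        by (rule sum.cong) (auto simp: basis_value)
      also have "\<dots> = \<omega> (drop_nth i ?e)"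
        using i(1) by (simp add: sum.delta power_mult_distrib[symmetric])
      finally show ?thesis .
    qed
    ultimately show "?\<psi> w = 0" by simp
  qed
  then show ?thesis by simp
qed

text \<open>Hadamard's inequality with one free vector. As a functional of \<open>y\<close> the left-hand side is the
  inner product with some \<open>a\<close> orthogonal to the frame, and completing the frame by \<open>a / |a|\<close> gives
  \<open>|a| = 1\<close> unless \<open>a = 0\<close>.\<close>

lemma abs_vol_contract_le:
  fixes w :: "nat \<Rightarrow> real ^ 'm::{finite, linorder}"
  assumes n: "Suc n = CARD('m)"
    and w: "\<And>i j. i < n \<Longrightarrow> j < n \<Longrightarrow> w i \<bullet> w j = (if i = j then 1 else 0)"
  shows "\<bar>vol (case_nat y w)\<bar> \<le> norm y"
proof -
  have vol: "covector (Suc n) (vol :: (nat \<Rightarrow> (real, 'm) vec) \<Rightarrow> real)" unfolding n by (rule covector_vol)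
  note lin = covector_linear_first[OF vol, of w]
  define a :: "(real, 'm) vec" where "a = (\<Sum>b\<in>Basis. vol (case_nat b w) *\<^sub>R b)"
  have a: "vol (case_nat y w) = a \<bullet> y" for y
  proof -
    have "vol (case_nat y w) = vol (case_nat (\<Sum>b\<in>Basis. (y \<bullet> b) *\<^sub>R b) w)"
      by (simp add: euclidean_representation)
    also have "\<dots> = (\<Sum>b\<in>Basis. (y \<bullet> b) * vol (case_nat b w))"
      by (simp add: linear_sum[OF lin] linear_scale[OF lin])
    also have "\<dots> = a \<bullet> y"
      unfolding a_def inner_sum_left by (rule sum.cong) (simp_all add: inner_commute[of y] mult.commute)
    finally show ?thesis .
  qed
  have perp: "a \<bullet> w i = 0" if "i < n" for i
    unfolding a[symmetric] by (rule covector_alternating[OF vol, of 0 "Suc i"]) (use that in auto)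
  have "norm a \<le> 1"
  proof (cases "a = 0")
    case False
    define e where "e = a /\<^sub>R norm a"
    have e: "e \<bullet> e = 1" "e \<bullet> w i = 0" "w i \<bullet> e = 0" if "i < n" for i
      using False perp[OF that] by (simp_all add: e_def power2_norm_eq_inner[symmetric] power2_eq_square inner_commute[of "w i"])
    have e1: "e \<bullet> e = 1" using False by (simp add: e_def power2_norm_eq_inner[symmetric] power2_eq_square)
    have "\<bar>vol (case_nat e w)\<bar> = 1"
    proof (rule abs_vol_orthonormal)
      fix i j assume "i < CARD('m)" "j < CARD('m)"
      then show "case_nat e w i \<bullet> case_nat e w j = (if i = j then 1 else 0)"
        unfolding n[symmetric] using e1 e(2,3) w by (auto split: nat.splits)
    qed
    moreover have "vol (case_nat e w) = norm a"
      unfolding a e_def using False by (simp add: power2_norm_eq_inner[symmetric] power2_eq_square)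
    ultimately show ?thesis by simp
  qed simp
  have "\<bar>vol (case_nat y w)\<bar> \<le> norm a * norm y" unfolding a by (rule Cauchy_Schwarz_ineq2)
  also have "\<dots> \<le> 1 * norm y" by (intro mult_right_mono \<open>norm a \<le> 1\<close>) simp
  finally show ?thesis by simp
qed

text \<open>An orthonormal frame that begins with the direction of \<open>hodge n \<omega>\<close> shows that the comass is
  attained on its remaining vectors, with the value \<open>|hodge n \<omega>|\<close>.\<close>

lemma norm_hodge_le:
  fixes \<omega> :: "(nat \<Rightarrow> real ^ 'm::{finite, linorder}) \<Rightarrow> real"
  assumes n: "Suc n = CARD('m)" and \<omega>: "covector n \<omega>" and comass: "comass n \<omega> \<le> 1"
  shows "norm (hodge n \<omega>) \<le> 1"
proof (cases "hodge n \<omega> = 0")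
  case False
  let ?z = "hodge n \<omega>"
  have vol: "covector (Suc n) (vol :: (nat \<Rightarrow> (real, 'm) vec) \<Rightarrow> real)" unfolding n by (rule covector_vol)
  have "norm (?z /\<^sub>R norm ?z) = 1" using False by simp
  then obtain A :: "((real, 'm) vec, 'm) vec" where A: "orthogonal_matrix A"
    "A *v axis (sorted_list_of_set UNIV ! 0) 1 = ?z /\<^sub>R norm ?z"
    using orthogonal_matrix_exists_basis by blast
  define v where "v j = A *v std_frame j" for j
  have "orthogonal_transformation ((*v) A)" using A(1) by (simp add: orthogonal_transformation_matrix)
  then have orth: "v i \<bullet> v j = (if i = j then 1 else 0)" if "i < CARD('m)" "j < CARD('m)" for i j
    using std_frame_inner[OF that] by (simp add: v_def orthogonal_transformation_def)
  have v0: "v 0 = ?z /\<^sub>R norm ?z" using A(2) by (simp add: v_def std_frame_def)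
  let ?w = "\<lambda>j. v (Suc j)"
  have v_eq: "case_nat (v 0) ?w = v" by (auto simp: fun_eq_iff split: nat.splits)
  have "\<omega> ?w = vol (case_nat ?z ?w)" by (rule codim_one_covector_eq[OF n \<omega>])
  also have "?z = norm ?z *\<^sub>R v 0" using v0 False by simp
  also have "vol (case_nat (norm ?z *\<^sub>R v 0) ?w) = norm ?z * vol v"
    using linear_scale[OF covector_linear_first[OF vol, of ?w], of "norm ?z" "v 0"] by (simp add: v_eq)
  finally have "\<bar>\<omega> ?w\<bar> = norm ?z" using abs_vol_orthonormal[of v] orth by (simp add: abs_mult)
  moreover have "ennreal \<bar>\<omega> ?w\<bar> \<le> comass n \<omega>"
    unfolding comass_def by (rule SUP_upper) (use orth n in auto)
  ultimately have "ennreal (norm ?z) \<le> 1" using comass by (metis order_trans)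
  then show ?thesis by (simp add: ennreal_le_1)
qed simp

lemma covector_trace_sum:
  fixes \<omega> :: "(nat \<Rightarrow> 'a::real_vector) \<Rightarrow> real"
  assumes \<omega>: "covector k \<omega>" and B: "linear B"
  shows "covector k (\<lambda>v. \<Sum>i<k. \<omega> (v(i := B (v i))))"
  unfolding covector_def
proof (intro conjI allI impI)
  fix v w :: "nat \<Rightarrow> 'a" assume "\<forall>i<k. v i = w i"
  then show "(\<Sum>i<k. \<omega> (v(i := B (v i)))) = (\<Sum>i<k. \<omega> (w(i := B (w i))))"
    by (intro sum.cong covector_cong[OF \<omega>]) auto
next
  fix v :: "nat \<Rightarrow> 'a" and j assume j: "j < k"
  show "linear (\<lambda>u. \<Sum>i<k. \<omega> ((v(j := u))(i := B ((v(j := u)) i))))"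
  proof (rule linear_compose_sum, intro ballI)
    fix i assume "i \<in> {..<k}"
    show "linear (\<lambda>u. \<omega> ((v(j := u))(i := B ((v(j := u)) i))))"
    proof (cases "i = j")
      case True
      have "linear ((\<lambda>u. \<omega> (v(j := u))) \<circ> B)" by (rule linear_compose[OF B covector_linear[OF \<omega> j]])
      then show ?thesis using True by (simp add: o_def)
    next
      case False
      have "linear (\<lambda>u. \<omega> ((v(i := B (v i)))(j := u)))" by (rule covector_linear[OF \<omega> j])
      then show ?thesis using False by (simp add: fun_upd_twist[OF False])
    qed
  qed
next
  fix v :: "nat \<Rightarrow> 'a" and a b assume a: "a < k" and b: "b < k" and ab: "a \<noteq> b \<and> v a = v b"
  let ?t = "\<lambda>i. \<omega> (v(i := B (v i)))"
  have "(\<Sum>i<k. ?t i) = (\<Sum>i\<in>{a, b}. ?t i)"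
  proof (rule sum.mono_neutral_right)
    show "\<forall>i\<in>{..<k} - {a, b}. ?t i = 0"
    proof
      fix i assume "i \<in> {..<k} - {a, b}"
      then show "?t i = 0" by (intro covector_alternating[OF \<omega> a b]) (use ab in auto)
    qed
  qed (use a b in auto)
  also have "\<dots> = ?t a + ?t b" using ab by simp
  also have "?t b = - ?t a"
  proof -
    let ?v = "v(a := B (v a))"
    have "?v(a := ?v b, b := ?v a) = v(b := B (v b))" using ab by (auto simp: fun_eq_iff)
    then show ?thesis using covector_swap[OF \<omega> a b, of ?v] ab by simp
  qed
  finally show "(\<Sum>i<k. ?t i) = 0" by (simp only: add.right_inverse)
qed

text \<open>The derivative of the determinant is the trace: the left-hand side is again a covector of top
  degree, hence a multiple of the volume form, and the factor is read off on the standard frame.\<close>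

lemma sum_vol_replace:
  fixes v :: "nat \<Rightarrow> real ^ 'm::{finite, linorder}"
  assumes B: "linear B"
  shows "(\<Sum>i<CARD('m). vol (v(i := B (v i)))) = (\<Sum>b\<in>Basis. B b \<bullet> b) * vol v"
proof -
  let ?e = "std_frame :: nat \<Rightarrow> (real, 'm) vec"
  have coord: "vol (?e(i := u)) = u \<bullet> ?e i" if i: "i < CARD('m)" for i u
  proof -
    note lin = covector_linear[OF covector_vol i, of ?e]
    have basis: "vol (?e(i := ?e j)) = (if j = i then 1 else 0)" if j: "j < CARD('m)" for j
    proof (cases "j = i")
      case False
      then show ?thesis
        using covector_alternating[OF covector_vol i j, of "?e(i := ?e j)"] by simp
    qed (simp add: vol_std_frame)
    have "vol (?e(i := u)) = vol (?e(i := (\<Sum>b\<in>Basis. (u \<bullet> b) *\<^sub>R b)))"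
      by (simp add: euclidean_representation)
    also have "\<dots> = (\<Sum>b\<in>Basis. (u \<bullet> b) * vol (?e(i := b)))"
      by (simp add: linear_sum[OF lin] linear_scale[OF lin])
    also have "\<dots> = (\<Sum>j<CARD('m). (u \<bullet> ?e j) * vol (?e(i := ?e j)))"
      by (rule sum.reindex_bij_betw[OF bij_betw_std_frame, symmetric])
    also have "\<dots> = (\<Sum>j<CARD('m). if j = i then u \<bullet> ?e j else 0)"
      by (rule sum.cong) (auto simp: basis)
    finally show ?thesis using i by simp
  qed
  have "(\<Sum>i<CARD('m). vol (v(i := B (v i)))) = (\<Sum>i<CARD('m). vol (?e(i := B (?e i)))) * vol v"
    by (rule top_covector_eq[OF covector_trace_sum[OF covector_vol B]])
  also have "(\<Sum>i<CARD('m). vol (?e(i := B (?e i)))) = (\<Sum>i<CARD('m). B (?e i) \<bullet> ?e i)"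
    by (rule sum.cong) (auto simp: coord)
  also have "\<dots> = (\<Sum>b\<in>Basis. B b \<bullet> b)"
    by (rule sum.reindex_bij_betw[OF bij_betw_std_frame])
  finally show ?thesis .
qed

text \<open>Cartan's formula for the volume form: after moving the derivative of \<open>Y\<close> back to the position
  of the vector it is taken along, the alternating sum becomes the trace in \<open>sum_vol_replace\<close>.\<close>

lemma ext_deriv_contract_vol:
  fixes Y :: "real ^ 'm::{finite, linorder} \<Rightarrow> real ^ 'm::{finite, linorder}"
  assumes n: "Suc n = CARD('m)" and Y: "smooth Y"
  shows "ext_deriv n (\<lambda>x w. vol (case_nat (Y x) w)) = (\<lambda>x v. divergence Y x * vol v)"
proof (intro ext)
  fix x :: "(real, 'm) vec" and v :: "nat \<Rightarrow> (real, 'm) vec"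
  have vol: "covector (Suc n) (vol :: (nat \<Rightarrow> (real, 'm) vec) \<Rightarrow> real)" unfolding n by (rule covector_vol)
  let ?B = "DF Y x"
  note D = smooth_has_derivative[OF Y, of x]
  have B: "linear ?B" using D has_derivative_linear by blast
  have "DF (\<lambda>y. vol (case_nat (Y y) w)) x = (\<lambda>h. vol (case_nat (?B h) w))" for w
  proof (rule frechet_derivative_eqI)
    have "bounded_linear (\<lambda>z. vol (case_nat z w))"
      using covector_linear_first[OF vol, of w] by (simp add: linear_conv_bounded_linear)
    from bounded_linear.has_derivative[OF this D]
    show "((\<lambda>y. vol (case_nat (Y y) w)) has_derivative (\<lambda>h. vol (case_nat (?B h) w))) (at x)" .
  qed
  then have "ext_deriv n (\<lambda>x w. vol (case_nat (Y x) w)) x v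
      = (\<Sum>i\<le>n. (-1) ^ i * vol (case_nat (?B (v i)) (drop_nth i v)))"
    unfolding ext_deriv_def drop_nth_def by simp
  also have "\<dots> = (\<Sum>i\<le>n. vol (v(i := ?B (v i))))"
  proof (rule sum.cong)
    fix i assume i: "i \<in> {..n}"
    let ?v = "v(i := ?B (v i))"
    have "drop_nth i ?v = drop_nth i v" by (auto simp: drop_nth_def fun_eq_iff)
    then have "vol (case_nat (?B (v i)) (drop_nth i v)) = (-1) ^ i * vol ?v"
      using covector_move_to_front[OF vol, of i ?v] i by simp
    then show "(-1) ^ i * vol (case_nat (?B (v i)) (drop_nth i v)) = vol ?v"
      by (simp add: power_mult_distrib[symmetric] mult.assoc[symmetric])
  qed simp
  also have "\<dots> = (\<Sum>i<CARD('m). vol (v(i := ?B (v i))))"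
    unfolding n[symmetric] lessThan_Suc_atMost ..
  also have "\<dots> = divergence Y x * vol v"
    unfolding sum_vol_replace[OF B] divergence_def ..
  finally show "ext_deriv n (\<lambda>x w. vol (case_nat (Y x) w)) x v = divergence Y x * vol v" .
qed

section \<open>Test forms and currents of top degree\<close>

lemma abs_le_1_of_comass:
  fixes \<omega> :: "(nat \<Rightarrow> real ^ 'm::{finite, linorder}) \<Rightarrow> real"
  assumes "comass CARD('m) \<omega> \<le> 1" shows "\<bar>\<omega> std_frame\<bar> \<le> 1"
proof -
  have "ennreal \<bar>\<omega> std_frame\<bar> \<le> comass CARD('m) \<omega>"
    unfolding comass_def by (rule SUP_upper) (auto simp: std_frame_inner)
  then have "ennreal \<bar>\<omega> std_frame\<bar> \<le> 1" using assms by (rule order_trans)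
  then show ?thesis by (simp add: ennreal_le_1)
qed

lemma test_forms_coefficient:
  assumes "\<phi> \<in> test_forms k" shows "(\<lambda>x. \<phi> x v) \<in> test_maps"
proof -
  obtain K where K: "compact K" "\<phi> \<in> test_forms_on k K" using assms unfolding test_forms_def by blast
  then obtain R where R: "\<forall>x\<in>K. norm x < R"
    using bounded_normE_less[of K] compact_imp_bounded by metis
  show ?thesis
  proof (rule test_mapsI[where R = R])
    show "smooth (\<lambda>x. \<phi> x v)" using K(2) unfolding test_forms_on_def by blast
    show "\<phi> x v = 0" if "norm x \<ge> R" for x
      using K(2) R that unfolding test_forms_on_def by force
  qed
qed

lemma test_formsI:
  assumes "\<And>x. covector k (\<phi> x)" "\<And>v. smooth (\<lambda>x. \<phi> x v)" "\<And>x v. norm x \<ge> R \<Longrightarrow> \<phi> x v = 0"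
  shows "\<phi> \<in> test_forms k"
proof -
  have "\<phi> \<in> test_forms_on k (cball 0 R)"
    unfolding test_forms_on_def using assms by auto
  then show ?thesis unfolding test_forms_def using compact_cball by blast
qed

lemma mult_vol_test_form:
  fixes g :: "real ^ 'm::{finite, linorder} \<Rightarrow> real"
  assumes "g \<in> test_maps"
  shows "(\<lambda>x v. g x * vol v) \<in> test_forms CARD('m)"
proof -
  obtain R where R: "\<And>x. norm x \<ge> R \<Longrightarrow> g x = 0" using test_mapsE[OF assms] by metis
  show ?thesis
  proof (rule test_formsI[where R = R])
    show "covector CARD('m) (\<lambda>v :: nat \<Rightarrow> (real, 'm) vec. g x * vol v)" for x
      by (rule covector_mult[OF covector_vol])
    show "smooth (\<lambda>x. g x * vol v)" for v :: "nat \<Rightarrow> (real, 'm) vec"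
      by (rule smooth_mult[OF test_maps_smooth[OF assms] smooth_const])
  qed (simp add: R)
qed

lemma comass_mult_vol_le:
  assumes "\<bar>c\<bar> \<le> 1"
  shows "comass CARD('m) (\<lambda>v :: nat \<Rightarrow> real ^ 'm::{finite, linorder}. c * vol v) \<le> 1"
  unfolding comass_def
proof (rule SUP_least)
  fix v :: "nat \<Rightarrow> (real, 'm) vec"
  assume "v \<in> {v. \<forall>i<CARD('m). \<forall>j<CARD('m). v i \<bullet> v j = (if i = j then 1 else 0)}"
  then have "\<bar>vol v\<bar> = 1" by (intro abs_vol_orthonormal) auto
  then show "ennreal \<bar>c * vol v\<bar> \<le> 1" using assms by (simp add: abs_mult ennreal_le_1)
qed

lemma current_linear:
  assumes "is_current k T" "\<phi> \<in> test_forms k" "\<psi> \<in> test_forms k"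
  shows "T (\<lambda>x v. a * \<phi> x v + b * \<psi> x v) = a * T \<phi> + b * T \<psi>"
  using assms unfolding is_current_def by blast

lemma current_le_mass:
  assumes "mass k T < \<infinity>" "\<phi> \<in> test_forms k" "\<And>x. comass k (\<phi> x) \<le> 1"
  shows "T \<phi> \<le> enn2real (mass k T)"
proof -
  have "ennreal (T \<phi>) \<le> mass k T"
    unfolding mass_def by (rule SUP_upper) (use assms in blast)
  also have "\<dots> = ennreal (enn2real (mass k T))" using assms(1) by simp
  finally show ?thesis by (simp add: ennreal_le_iff)
qed

text \<open>With the volume form as a basis, a current of top degree and finite mass is a functional of
  order zero on functions, bounded by the mass.\<close>

lemma radon_top_current:
  fixes S :: "(real ^ 'm::{finite, linorder}) functional"
  assumes S: "is_current CARD('m) S" "mass CARD('m) S < \<infinity>"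
  shows "radon (\<lambda>g. S (\<lambda>x v. g x * vol v))"
    and "\<And>g. g \<in> test_maps \<Longrightarrow> (\<And>x. \<bar>g x\<bar> \<le> 1) \<Longrightarrow> S (\<lambda>x v. g x * vol v) \<le> enn2real (mass CARD('m) S)"
proof -
  let ?M = "enn2real (mass CARD('m) S)"
  let ?\<Lambda> = "\<lambda>g. S (\<lambda>x v. g x * vol v)"
  show le: "?\<Lambda> g \<le> ?M" if "g \<in> test_maps" "\<And>x. \<bar>g x\<bar> \<le> 1" for g
    by (rule current_le_mass[OF S(2) mult_vol_test_form[OF that(1)] comass_mult_vol_le[OF that(2)]])
  have lin: "?\<Lambda> (\<lambda>x. a * f x + b * g x) = a * ?\<Lambda> f + b * ?\<Lambda> g"
    if "f \<in> test_maps" "g \<in> test_maps" for f g a b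
    using current_linear[OF S(1) mult_vol_test_form[OF that(1)] mult_vol_test_form[OF that(2)], of a b]
    by (simp add: algebra_simps)
  show "radon ?\<Lambda>"
    unfolding radon_def
  proof (intro conjI ballI allI)
    fix f g :: "(real, 'm) vec \<Rightarrow> real" and a b assume "f \<in> test_maps" "g \<in> test_maps"
    then show "?\<Lambda> (\<lambda>x. a * f x + b * g x) = a * ?\<Lambda> f + b * ?\<Lambda> g" by (rule lin)
  next
    fix R :: real
    show "\<exists>C\<ge>0. \<forall>f\<in>test_maps. \<forall>B. (\<forall>x. norm x \<ge> R \<longrightarrow> f x = 0) \<and> (\<forall>x. \<bar>f x\<bar> \<le> B) \<longrightarrow> \<bar>?\<Lambda> f\<bar> \<le> C * B"
    proof (intro exI[of _ ?M] conjI ballI allI impI)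
      fix f :: "(real, 'm) vec \<Rightarrow> real" and B
      assume f: "f \<in> test_maps" and "(\<forall>x. norm x \<ge> R \<longrightarrow> f x = 0) \<and> (\<forall>x. \<bar>f x\<bar> \<le> B)"
      then have B: "\<bar>f x\<bar> \<le> B" for x by blast
      have scale: "c * ?\<Lambda> f \<le> ?M" if "\<And>x. \<bar>c * f x\<bar> \<le> 1" for c
        using le[OF test_maps_mult[OF f] that] lin[OF f f, of c 0] by simp
      have "B \<ge> 0" using B[of 0] by linarith
      show "\<bar>?\<Lambda> f\<bar> \<le> ?M * B"
      proof (cases "B = 0")
        case True
        then have "f = (\<lambda>x. 0)" using B by (intro ext) simp
        then have "?\<Lambda> f = 0" using lin[OF f f, of 0 0] by simp
        then show ?thesis using True by simp
      next
        case False
        then have "B > 0" using \<open>B \<ge> 0\<close> by simp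
        then have "\<bar>(1/B) * f x\<bar> \<le> 1" "\<bar>(-1/B) * f x\<bar> \<le> 1" for x
          using B[of x] by (simp_all add: abs_mult pos_divide_le_eq)
        from scale[OF this(1)] scale[OF this(2)] show ?thesis using \<open>B > 0\<close> by (simp add: field_simps abs_le_iff)
      qed
    qed simp
  qed
qed

lemma contract_vol_test_form:
  fixes Y :: "real ^ 'm::{finite, linorder} \<Rightarrow> real ^ 'm::{finite, linorder}"
  assumes n: "Suc n = CARD('m)" and Y: "Y \<in> test_maps" "\<And>x. norm (Y x) \<le> 1"
  shows "(\<lambda>x w. vol (case_nat (Y x) w)) \<in> test_forms n"
    and "comass n (\<lambda>w. vol (case_nat (Y x) w)) \<le> 1"
proof -
  have vol: "covector (Suc n) (vol :: (nat \<Rightarrow> (real, 'm) vec) \<Rightarrow> real)" unfolding n by (rule covector_vol)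
  obtain R where R: "\<And>x. norm x \<ge> R \<Longrightarrow> Y x = 0" using test_mapsE[OF Y(1)] by metis
  show "(\<lambda>x w. vol (case_nat (Y x) w)) \<in> test_forms n"
  proof (rule test_formsI[where R = R])
    show "covector n (\<lambda>w. vol (case_nat (Y x) w))" for x by (rule covector_contract[OF vol])
    show "smooth (\<lambda>x. vol (case_nat (Y x) w))" for w
    proof (rule smooth_bounded_linear[OF _ test_maps_smooth[OF Y(1)]])
      show "bounded_linear (\<lambda>z. vol (case_nat z w))"
        using covector_linear_first[OF vol, of w] by (simp add: linear_conv_bounded_linear)
    qed
    show "vol (case_nat (Y x) w) = 0" if "norm x \<ge> R" for x w
      using linear_0[OF covector_linear_first[OF vol, of w]] R[OF that] by simp
  qed
  show "comass n (\<lambda>w. vol (case_nat (Y x) w)) \<le> 1"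
    unfolding comass_def
  proof (rule SUP_least)
    fix w :: "nat \<Rightarrow> (real, 'm) vec"
    assume "w \<in> {v. \<forall>i<n. \<forall>j<n. v i \<bullet> v j = (if i = j then 1 else 0)}"
    then have "\<bar>vol (case_nat (Y x) w)\<bar> \<le> norm (Y x)" by (intro abs_vol_contract_le[OF n]) auto
    also note Y(2)
    finally show "ennreal \<bar>vol (case_nat (Y x) w)\<bar> \<le> 1" by (simp add: ennreal_le_1)
  qed
qed

text \<open>A form \<open>\<phi>\<close> of codimension one is the contraction of the volume form with the field
  \<open>hodge n \<phi>\<close>, whose norm is at most the comass of \<open>\<phi>\<close> and whose divergence is the coefficient of
  \<open>d\<phi>\<close>.\<close>

lemma mass_boundary_set_current_le:
  fixes E :: "(real ^ 'm::{finite, linorder}) set"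
  assumes n: "Suc n = CARD('m)" and E: "E \<in> sets lebesgue"
  shows "mass n (boundary n (set_current E)) \<le> perimeter E"
  unfolding mass_def
proof (rule SUP_least)
  fix \<phi> :: "(real, 'm) vec dform" assume "\<phi> \<in> {\<phi> \<in> test_forms n. \<forall>x. comass n (\<phi> x) \<le> 1}"
  then have \<phi>: "\<phi> \<in> test_forms n" "\<And>x. comass n (\<phi> x) \<le> 1" by auto
  let ?e = "std_frame :: nat \<Rightarrow> (real, 'm) vec"
  have cov: "covector n (\<phi> x)" for x using \<phi>(1) unfolding test_forms_def test_forms_on_def by blast
  \<comment> \<open>The sign compensates the minus sign of the distributional gradient.\<close>
  define Z where "Z x = (-1) *\<^sub>R hodge n (\<phi> x)" for x
  have Z: "Z \<in> test_maps"
    unfolding Z_def[abs_def] hodge_def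
    by (intro test_maps_scaleR test_maps_sum test_maps_mult_smooth test_maps_mult test_forms_coefficient[OF \<phi>(1)] smooth_const)
  have Z_le: "norm (Z x) \<le> 1" for x
    using norm_hodge_le[OF n cov \<phi>(2), of x] by (simp add: Z_def)
  have Z_inner: "Z x \<bullet> ?e i = - ((-1) ^ i * \<phi> x (drop_nth i ?e))" if i: "i \<le> n" for x i
  proof -
    have "hodge n (\<phi> x) \<bullet> ?e i = (\<Sum>j\<le>n. ((-1) ^ j * \<phi> x (drop_nth j ?e)) * (?e j \<bullet> ?e i))"
      by (simp add: hodge_def inner_sum_left)
    also have "\<dots> = (\<Sum>j\<le>n. if j = i then (-1) ^ j * \<phi> x (drop_nth j ?e) else 0)"
      using i n by (intro sum.cong) (auto simp: std_frame_inner)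
    finally show ?thesis using i by (simp add: Z_def)
  qed
  have "ext_deriv n \<phi> x ?e = - divergence Z x" for x
  proof -
    have "divergence Z x = (\<Sum>i<CARD('m). DF (\<lambda>x. Z x \<bullet> ?e i) x (?e i))"
      unfolding divergence_componentwise[OF test_maps_smooth[OF Z]]
      by (rule sum.reindex_bij_betw[OF bij_betw_std_frame, symmetric])
    also have "\<dots> = (\<Sum>i\<le>n. DF (\<lambda>x. Z x \<bullet> ?e i) x (?e i))"
      unfolding n[symmetric] lessThan_Suc_atMost ..
    also have "\<dots> = (\<Sum>i\<le>n. - ((-1) ^ i * DF (\<lambda>x. \<phi> x (drop_nth i ?e)) x (?e i)))"
    proof (rule sum.cong)
      fix i assume "i \<in> {..n}"
      then have "(\<lambda>x. Z x \<bullet> ?e i) = (\<lambda>x. - ((-1) ^ i * \<phi> x (drop_nth i ?e)))" using Z_inner by auto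
      moreover have "((\<lambda>x. - ((-1) ^ i * \<phi> x (drop_nth i ?e))) has_derivative
          (\<lambda>h. - ((-1) ^ i * DF (\<lambda>x. \<phi> x (drop_nth i ?e)) x h))) (at x)"
        by (intro has_derivative_minus has_derivative_mult_right smooth_has_derivative
            test_maps_smooth[OF test_forms_coefficient[OF \<phi>(1)]])
      ultimately show "DF (\<lambda>x. Z x \<bullet> ?e i) x (?e i)
          = - ((-1) ^ i * DF (\<lambda>x. \<phi> x (drop_nth i ?e)) x (?e i))"
        using frechet_derivative_eqI by metis
    qed simp
    finally show ?thesis by (simp add: ext_deriv_def drop_nth_def sum_negf)
  qed
  then have "boundary n (set_current E) \<phi> = indicator_gradient E Z"
    unfolding boundary_def set_current_def indicator_gradient_def set_lebesgue_integral_def by simp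
  moreover have "ennreal (indicator_gradient E Z) \<le> perimeter E"
    unfolding perimeter_def by (rule SUP_upper) (use Z Z_le in \<open>auto simp: test_fields_eq_test_maps\<close>)
  ultimately show "ennreal (boundary n (set_current E) \<phi>) \<le> perimeter E" by simp
qed

lemma mass_sym_diff_current_le:
  fixes \<Omega> \<Sigma> :: "(real ^ 'm::{finite, linorder}) set"
  assumes \<Omega>: "\<Omega> \<in> sets lebesgue" and \<Sigma>: "\<Sigma> \<in> sets lebesgue"
  shows "mass CARD('m) (sym_diff_current \<Sigma> \<Omega>) \<le> emeasure lebesgue (sym_diff \<Sigma> \<Omega>)"
  unfolding mass_def
proof (rule SUP_least)
  fix \<phi> :: "(real, 'm) vec dform" assume "\<phi> \<in> {\<phi> \<in> test_forms CARD('m). \<forall>x. comass CARD('m) (\<phi> x) \<le> 1}"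
  then have \<phi>: "\<phi> \<in> test_forms CARD('m)" "\<And>x. comass CARD('m) (\<phi> x) \<le> 1" by auto
  let ?g = "\<lambda>x. \<phi> x std_frame"
  have g: "?g \<in> test_maps" by (rule test_forms_coefficient[OF \<phi>(1)])
  note I = test_maps_set_integrable[OF g, unfolded set_integrable_def]
  let ?h = "\<lambda>x. indicator \<Omega> x *\<^sub>R ?g x - indicator \<Sigma> x *\<^sub>R ?g x"
  have h: "integrable lebesgue ?h" by (intro Bochner_Integration.integrable_diff I \<Omega> \<Sigma>)
  have "sym_diff_current \<Sigma> \<Omega> \<phi> = (\<integral>x. ?h x \<partial>lebesgue)"
    unfolding sym_diff_current_def set_current_def set_lebesgue_integral_def
    by (simp only: minus_apply Bochner_Integration.integral_diff[OF I[OF \<Omega>] I[OF \<Sigma>]])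
  then have "ennreal (sym_diff_current \<Sigma> \<Omega> \<phi>) \<le> ennreal (norm (\<integral>x. ?h x \<partial>lebesgue))"
    by (simp add: ennreal_leI)
  also have "\<dots> \<le> (\<integral>\<^sup>+x. ennreal (norm (?h x)) \<partial>lebesgue)" by (rule integral_norm_bound_ennreal[OF h])
  also have "\<dots> \<le> (\<integral>\<^sup>+x. indicator (sym_diff \<Sigma> \<Omega>) x \<partial>lebesgue)"
    using abs_le_1_of_comass[OF \<phi>(2)]
    by (intro nn_integral_mono) (auto simp: indicator_def ennreal_le_1)
  also have "\<dots> = emeasure lebesgue (sym_diff \<Sigma> \<Omega>)"
    using \<Omega> \<Sigma> by (simp add: nn_integral_indicator)
  finally show "ennreal (sym_diff_current \<Sigma> \<Omega> \<phi>) \<le> emeasure lebesgue (sym_diff \<Sigma> \<Omega>)" .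
qed

text \<open>Boundedness in the supremum norm on each compact set gives continuity already for the
  topology defined by \<open>C\<^sup>0\<close>-balls.\<close>

lemma is_current_radon:
  fixes L :: "(real ^ 'm::{finite, linorder} \<Rightarrow> real) \<Rightarrow> real"
  assumes L: "radon L" shows "is_current CARD('m) (\<lambda>\<phi>. L (\<lambda>x. \<phi> x std_frame))"
  unfolding is_current_def
proof (intro conjI ballI allI)
  fix \<phi> \<psi> :: "(real, 'm) vec dform" and a b
  assume "\<phi> \<in> test_forms CARD('m)" "\<psi> \<in> test_forms CARD('m)"
  then show "L (\<lambda>x. a * \<phi> x std_frame + b * \<psi> x std_frame) = a * L (\<lambda>x. \<phi> x std_frame) + b * L (\<lambda>x. \<psi> x std_frame)"
    by (intro radon_linear[OF L] test_forms_coefficient)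
next
  let ?T = "\<lambda>\<phi> :: (real, 'm) vec dform. L (\<lambda>x. \<phi> x std_frame)"
  have "open_test_forms CARD('m) {\<phi> \<in> test_forms CARD('m). ?T \<phi> \<in> V}" if V: "open V" for V
    unfolding open_test_forms_def
  proof (intro conjI allI impI ballI)
    fix K :: "(real, 'm) vec set" and \<phi>
    assume K: "compact K" and "\<phi> \<in> {\<phi> \<in> test_forms CARD('m). ?T \<phi> \<in> V} \<inter> test_forms_on CARD('m) K"
    then have \<phi>: "\<phi> \<in> test_forms CARD('m)" "?T \<phi> \<in> V" "\<phi> \<in> test_forms_on CARD('m) K" by auto
    obtain R where R: "\<forall>x\<in>K. norm x < R"
      using bounded_normE_less[of K] compact_imp_bounded[OF K] by metis
    obtain C where C: "C \<ge> 0" "\<And>f B. f \<in> test_maps \<Longrightarrow> (\<And>x. norm x \<ge> R \<Longrightarrow> f x = 0) \<Longrightarrow>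
      (\<And>x. \<bar>f x\<bar> \<le> B) \<Longrightarrow> \<bar>L f\<bar> \<le> C * B"
      using radon_bound[OF L] by metis
    obtain e where e: "e > 0" "\<And>y. dist y (?T \<phi>) < e \<Longrightarrow> y \<in> V"
      using V \<phi>(2) unfolding open_dist by blast
    let ?\<epsilon> = "e / (C + 1)"
    have "?T \<psi> \<in> V \<and> \<psi> \<in> test_forms CARD('m)"
      if \<psi>: "\<psi> \<in> test_forms_on CARD('m) K \<inter> form_ball CARD('m) 0 ?\<epsilon> \<phi>" for \<psi>
    proof
      show \<psi>': "\<psi> \<in> test_forms CARD('m)" using \<psi> K unfolding test_forms_def by blast
      let ?f = "\<lambda>x. \<psi> x std_frame - \<phi> x std_frame"
      have "\<bar>L ?f\<bar> \<le> C * ?\<epsilon>"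
      proof (rule C(2))
        show "?f \<in> test_maps" by (intro test_maps_diff test_forms_coefficient[OF \<psi>'] test_forms_coefficient[OF \<phi>(1)])
        show "?f x = 0" if "norm x \<ge> R" for x
        proof -
          have "x \<notin> K" using R that by force
          then show ?thesis using \<psi> \<phi>(3) unfolding test_forms_on_def by simp
        qed
        show "\<bar>?f x\<bar> \<le> ?\<epsilon>" for x
        proof -
          have "\<forall>us v x. set us \<subseteq> Basis \<and> length us \<le> 0 \<and> (\<forall>i<CARD('m). v i \<in> Basis) \<longrightarrow>
              \<bar>iter_deriv us (\<lambda>y. \<psi> y v - \<phi> y v) x\<bar> < ?\<epsilon>"
            using \<psi> unfolding form_ball_def by simp
          from this[rule_format, of "[]" std_frame x] show ?thesis by (simp add: std_frame_Basis)
        qed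
      qed
      also have "C * ?\<epsilon> < e" using C(1) e(1) by (simp add: pos_divide_less_eq mult.commute)
      finally have "\<bar>?T \<psi> - ?T \<phi>\<bar> < e"
        using radon_diff[OF L test_forms_coefficient[OF \<psi>'] test_forms_coefficient[OF \<phi>(1)]] by simp
      then show "?T \<psi> \<in> V" by (intro e(2)) (simp add: dist_real_def)
    qed
    then show "\<exists>N. \<exists>\<epsilon>>0. test_forms_on CARD('m) K \<inter> form_ball CARD('m) N \<epsilon> \<phi> \<subseteq> {\<phi> \<in> test_forms CARD('m). ?T \<phi> \<in> V}"
      using C(1) e(1) by (intro exI[of _ 0] exI[of _ ?\<epsilon>]) auto
  qed auto
  then show "continuous_map (test_form_topology CARD('m)) euclideanreal ?T"
    unfolding continuous_map_def by simp
qed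

section \<open>The flat norm of the boundary\<close>

theorem theorem2p1:
  fixes \<Omega> \<Sigma> :: "(real ^ 'm::{finite, linorder}) set" and n :: nat
  assumes "\<Omega> \<in> sets lebesgue" and "perimeter \<Omega> < \<infinity>"
    and "n = CARD('m) - 1"
    and "is_arg_min (F_CE \<Omega>) (\<lambda>E. E \<in> sets lebesgue) \<Sigma>"
  shows "flat_norm n (boundary_current \<Omega>) = F_CE \<Omega> \<Sigma> \<and>
    optimal_decomposition n (boundary_current \<Omega>) (sym_diff_current \<Sigma> \<Omega>)"
proof -
  have n: "Suc n = CARD('m)" using assms(3) by simp
  have \<Sigma>: "\<Sigma> \<in> sets lebesgue" and min: "\<And>E. E \<in> sets lebesgue \<Longrightarrow> F_CE \<Omega> \<Sigma> \<le> F_CE \<Omega> E"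
    using assms(4) unfolding is_arg_min_def by (auto simp: not_less)
  let ?T = "boundary_current \<Omega>" and ?S = "sym_diff_current \<Sigma> \<Omega>"
  have T: "?T = boundary n (set_current \<Omega>)" by (simp add: boundary_current_def assms(3))
  have "is_current CARD('m) (\<lambda>\<phi>. set_lebesgue_integral lebesgue \<Omega> (\<lambda>x. \<phi> x std_frame)
      - set_lebesgue_integral lebesgue \<Sigma> (\<lambda>x. \<phi> x std_frame))"
    by (rule is_current_radon[OF radon_diff_functional[OF radon_set_integral[OF assms(1)] radon_set_integral[OF \<Sigma>]]])
  then have S: "is_current (Suc n) ?S"
    unfolding n by (simp add: sym_diff_current_def set_current_def fun_diff_def)
  have "?T - boundary n ?S = boundary n (set_current \<Sigma>)"
    unfolding T by (simp add: boundary_def sym_diff_current_def fun_diff_def)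
  then have S_le: "mass (Suc n) ?S + mass n (?T - boundary n ?S) \<le> F_CE \<Omega> \<Sigma>"
    using mass_sym_diff_current_le[OF assms(1) \<Sigma>] mass_boundary_set_current_le[OF n \<Sigma>]
    unfolding F_CE_def n by (simp add: add_mono add.commute[of "perimeter \<Sigma>"])
  have lower: "F_CE \<Omega> \<Sigma> \<le> mass (Suc n) S + mass n (?T - boundary n S)" if S: "is_current (Suc n) S" for S
  proof (cases "mass (Suc n) S < \<infinity> \<and> mass n (?T - boundary n S) < \<infinity>")
    case True
    then have fin: "mass CARD('m) S < \<infinity>" "mass n (?T - boundary n S) < \<infinity>" by (simp_all add: n)
    note \<Lambda> = radon_top_current[OF S[unfolded n] fin(1)]
    have "F_CE \<Omega> \<Sigma> \<le> ennreal (enn2real (mass n (?T - boundary n S))) + ennreal (enn2real (mass CARD('m) S))"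
    proof (rule F_CE_lower_bound_of_functional[OF assms(1,2) \<Lambda>])
      fix Y :: "(real, 'm) vec \<Rightarrow> (real, 'm) vec"
      assume Y: "Y \<in> test_maps" "\<And>x. norm (Y x) \<le> 1"
      have "(?T - boundary n S) (\<lambda>x w. vol (case_nat (Y x) w)) \<le> enn2real (mass n (?T - boundary n S))"
        by (rule current_le_mass[OF fin(2) contract_vol_test_form[OF n Y]])
      moreover have "(?T - boundary n S) (\<lambda>x w. vol (case_nat (Y x) w))
          = set_lebesgue_integral lebesgue \<Omega> (divergence Y) - S (\<lambda>x v. divergence Y x * vol v)"
        unfolding T by (simp add: boundary_def set_current_def ext_deriv_contract_vol[OF n test_maps_smooth[OF Y(1)]] vol_std_frame)
      ultimately show "set_lebesgue_integral lebesgue \<Omega> (divergence Y) - S (\<lambda>x v. divergence Y x * vol v)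
          \<le> enn2real (mass n (?T - boundary n S))" by simp
    qed (auto intro: min)
    then show ?thesis using fin by (simp add: n add.commute)
  next
    case False
    then have "mass (Suc n) S + mass n (?T - boundary n S) = \<infinity>"
      by (auto simp: less_top[symmetric])
    then show ?thesis by (simp only: infinity_ennreal_def top_greatest)
  qed
  have "F_CE \<Omega> \<Sigma> \<le> flat_norm n ?T"
    unfolding flat_norm_def by (rule INF_greatest) (use lower in auto)
  moreover have "flat_norm n ?T \<le> mass (Suc n) ?S + mass n (?T - boundary n ?S)"
    unfolding flat_norm_def by (rule INF_lower) (use S in simp)
  ultimately show ?thesis
    unfolding optimal_decomposition_def using S S_le by (metis order_antisym order_trans)
qed

end
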